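(* Let $\mathcal{U},\mathcal{X},\mathcal{Y},\mathcal{V}$ be finite sets, $\mathcal{P}_U$ a source distribution on $\mathcal{U}$, and $\mathcal{W}_{Y|X,Y'}$ a Markov channel kernel such that for every input distribution $\mathcal{P}_X$ on $\mathcal{X}$ the Markov chain on $\mathcal{Y}$ with transition matrix $T(y|y')=\sum_{x}\mathcal{P}_X(x)\mathcal{W}_{Y|X,Y'}(y|x,y')$ has a unique recurrent class, which is irreducible and aperiodic. Achievability of a distribution $\mathcal{P}_{U,X,Y',Y,V}\in\Delta(\mathcal{U}\times\mathcal{X}\times\mathcal{Y}\times\mathcal{Y}\times\mathcal{V})$ is as defined in the context. (Inner bound) A joint distribution $\mathcal{P}_{U,X,Y',Y,V}$ is achievable if there exists an auxiliary random variable $W$ (with values in a finite set) such that the joint distribution of $(U,X,W,Y',Y,V)$, whose marginal on $(U,X,Y',Y,V)$ is $\mathcal{P}_{U,X,Y',Y,V}$, factorizes as $$\mathcal{P}_U\,\mathcal{P}_X\,\mathcal{P}_{W|U,X}\,\pi_{Y'}\,\mathcal{W}_{Y|X,Y'}\,\mathcal{P}_{V|Y,X,W}$$ and satisfies $$I(X;Y|Y')-I(U;W|X)\ \geq\ 0,$$ where $\pi_{Y'}$ is the unique equilibrium distribution associated with $\mathcal{P}_X$, i.e. the unique probability distribution on $\mathcal{Y}$ with $\pi(y)=\sum_{x,y'}\pi(y')\mathcal{P}_X(x)\mathcal{W}_{Y|X,Y'}(y|x,y')$ for all $y\in\mathcal{Y}$. (Outer bound) Conversely, $\mathcal{P}_{U,X,Y',Y,V}$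 is achievable only if there exists an auxiliary random variable $W$ (with values in a finite set) such that the joint distribution of $(U,X,W,Y',Y,V)$, whose marginal on $(U,X,Y',Y,V)$ is $\mathcal{P}_{U,X,Y',Y,V}$, satisfies $I(X;Y|Y')-I(U;W|X)\geq 0$ and decomposes as $$\mathcal{P}_U\,\mathcal{P}_X\,\mathcal{P}_{Y'|X}\,\mathcal{W}_{Y|X,Y'}\,\mathcal{P}_{W|U,X,Y,Y'}\,\mathcal{P}_{V|Y,X,W}.$$
   Context: $\Delta(\mathcal{A})$ is the set of probability distributions on the finite set $\mathcal{A}$, and $\lVert\mathcal{Q}-\mathcal{P}\rVert_1=\sum_a|\mathcal{Q}(a)-\mathcal{P}(a)|$. In the factorizations, $\mathcal{P}_U$ is the given source distribution and $\mathcal{W}_{Y|X,Y'}$ the given channel kernel ($\mathcal{W}_{Y|X,Y'}(y|x,y')$ is the probability of new state/output $y$ given input $x$ and previous state $y'$); the other factors are arbitrary (conditional) distributions. Mutual informations are computed under the joint distribution of $(U,X,W,Y',Y,V)$. Codes. For $n\in\mathbb{N}$, a code $c\in\mathcal{C}(n)$ with strictly causal encoder and noncausal decoder consists of deterministic functions $f^{(t)}:\mathcal{U}^{t-1}\to\mathcal{X}$, $t=1,\dots,n$ ($f^{(1)}$ being a constant), and $g:\mathcal{Y}^n\to\mathcal{V}^n$. The starting channel state $Y_0=y_0\in\mathcal{Y}$ is arbitrary. The code induces random sequences $(U^n,X^n,Y^n,V^n)$ as follows: $U_1,\dots,U_n$ are i.i.d. $\sim\mathcal{P}_U$, $X_t=f^{(t)}(U^{t-1})$,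 $V^n=g(Y^n)$, and the joint distribution is $\mathcal{P}_U^{\otimes n}\prod_{t=1}^n\big[f^{(t)}_{X_t|U^{t-1}}\,\mathcal{W}_{Y|X,Y'}(Y_t|X_t,Y_{t-1})\big]\,g_{V^n|Y^n}$. Empirical distribution: for $(u,x,y',y,v)\in\mathcal{U}\times\mathcal{X}\times\mathcal{Y}\times\mathcal{Y}\times\mathcal{V}$, $$Q^n(u,x,y',y,v)=\frac1n\sum_{t=1}^n\mathbf{1}\{U_t=u,\,X_t=x,\,Y_{t-1}=y',\,Y_t=y,\,V_t=v\}.$$ Achievability: $\mathcal{P}_{U,X,Y',Y,V}$ is achievable if for all $\varepsilon>0$ there exists $N_0\in\mathbb{N}$ such that for all $n\geq N_0$ there is a code $c\in\mathcal{C}(n)$ whose induced empirical distribution satisfies $\mathbb{P}\big(\lVert Q^n-\mathcal{P}_{U,X,Y',Y,V}\rVert_1\geq\varepsilon\big)\leq\varepsilon$. *)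

theory Defs
  imports "HOL-Probability.Probability"
begin

text \<open>A chain on \<open>'s\<close> is given by its transition kernel \<open>T\<close>: \<open>pmf (T a) b\<close> is the probability of
  moving from \<open>a\<close> to \<open>b\<close>.\<close>

primrec nstep :: "('s \<Rightarrow> 's pmf) \<Rightarrow> nat \<Rightarrow> 's \<Rightarrow> 's pmf" where
  "nstep T 0 a = return_pmf a"
| "nstep T (Suc n) a = bind_pmf (T a) (nstep T n)"

definition accessible :: "('s \<Rightarrow> 's pmf) \<Rightarrow> 's \<Rightarrow> 's \<Rightarrow> bool" where
  "accessible T a b \<longleftrightarrow> (\<exists>n. pmf (nstep T n a) b > 0)"

text \<open>\<open>first_passage T b n a\<close> is the probability that the chain started in \<open>a\<close> visits \<open>b\<close> at time
  \<open>Suc n\<close> and at none of the times \<open>1, \<dots>, n\<close>.\<close>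

primrec first_passage :: "('s::finite \<Rightarrow> 's pmf) \<Rightarrow> 's \<Rightarrow> nat \<Rightarrow> 's \<Rightarrow> real" where
  "first_passage T b 0 a = pmf (T a) b"
| "first_passage T b (Suc n) a = (\<Sum>c\<in>UNIV - {b}. pmf (T a) c * first_passage T b n c)"

definition recurrent :: "('s::finite \<Rightarrow> 's pmf) \<Rightarrow> 's \<Rightarrow> bool" where
  "recurrent T a \<longleftrightarrow> (\<lambda>n. first_passage T a n a) sums 1"

definition communicating_class :: "('s \<Rightarrow> 's pmf) \<Rightarrow> 's set \<Rightarrow> bool" where
  "communicating_class T C \<longleftrightarrow> (\<exists>a. C = {b. accessible T a b \<and> accessible T b a})"

definition recurrent_class :: "('s::finite \<Rightarrow> 's pmf) \<Rightarrow> 's set \<Rightarrow> bool" where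
  "recurrent_class T C \<longleftrightarrow> communicating_class T C \<and> (\<forall>a\<in>C. recurrent T a)"

definition irreducible_class :: "('s \<Rightarrow> 's pmf) \<Rightarrow> 's set \<Rightarrow> bool" where
  "irreducible_class T C \<longleftrightarrow> (\<forall>a\<in>C. \<forall>b\<in>C. accessible T a b)"

definition period :: "('s \<Rightarrow> 's pmf) \<Rightarrow> 's \<Rightarrow> nat" where
  "period T a = Gcd {n. n > 0 \<and> pmf (nstep T n a) a > 0}"

definition aperiodic_class :: "('s \<Rightarrow> 's pmf) \<Rightarrow> 's set \<Rightarrow> bool" where
  "aperiodic_class T C \<longleftrightarrow> (\<forall>a\<in>C. period T a = 1)"

text \<open>A channel is a kernel \<open>Wch\<close>, where \<open>pmf (Wch x y') y\<close> is the probability of the new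
  state/output \<open>y\<close> given the input \<open>x\<close> and the previous state \<open>y'\<close>.\<close>

definition averaged_chain :: "('x \<Rightarrow> 'y \<Rightarrow> 'y pmf) \<Rightarrow> 'x pmf \<Rightarrow> 'y \<Rightarrow> 'y pmf" where
  "averaged_chain Wch PX y' = bind_pmf PX (\<lambda>x. Wch x y')"

definition ergodic_channel :: "('x \<Rightarrow> 'y::finite \<Rightarrow> 'y pmf) \<Rightarrow> bool" where
  "ergodic_channel Wch \<longleftrightarrow>
     (\<forall>PX. \<exists>C. recurrent_class (averaged_chain Wch PX) C \<and>
        (\<forall>D. recurrent_class (averaged_chain Wch PX) D \<longrightarrow> D = C) \<and>
        irreducible_class (averaged_chain Wch PX) C \<and>
        aperiodic_class (averaged_chain Wch PX) C)"

text \<open>For an ergodic channel there is exactly one such distribution for every \<open>PX\<close>.\<close>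

definition equilibrium ::
    "('x::finite \<Rightarrow> 'y::finite \<Rightarrow> 'y pmf) \<Rightarrow> 'x pmf \<Rightarrow> 'y pmf \<Rightarrow> bool" where
  "equilibrium Wch PX \<pi> \<longleftrightarrow>
     (\<forall>y. pmf \<pi> y = (\<Sum>x\<in>UNIV. \<Sum>y'\<in>UNIV. pmf \<pi> y' * pmf PX x * pmf (Wch x y') y))"

text \<open>Encoder \<open>f\<close> and decoder \<open>g\<close>. The symbol sent at time \<open>t\<close> is \<open>f t us\<close>, where \<open>us\<close> is the list
  of the \<open>t - 1\<close> strictly past source symbols.\<close>

type_synonym ('u, 'x, 'y, 'v) code = "(nat \<Rightarrow> 'u list \<Rightarrow> 'x) \<times> ('y list \<Rightarrow> 'v list)"

definition codes :: "nat \<Rightarrow> ('u, 'x, 'y, 'v) code set" where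
  "codes n = {(f, g). \<forall>ys. length ys = n \<longrightarrow> length (g ys) = n}"

definition channel_inputs :: "(nat \<Rightarrow> 'u list \<Rightarrow> 'x) \<Rightarrow> 'u list \<Rightarrow> 'x list" where
  "channel_inputs f us = map (\<lambda>t. f t (take (t - 1) us)) [1..<Suc (length us)]"

text \<open>The law of the outputs for the given inputs, when the state before the first input is \<open>y'\<close>.\<close>

primrec channel_outputs :: "('x \<Rightarrow> 'y \<Rightarrow> 'y pmf) \<Rightarrow> 'x list \<Rightarrow> 'y \<Rightarrow> 'y list pmf" where
  "channel_outputs Wch [] y' = return_pmf []"
| "channel_outputs Wch (x # xs) y' =
     bind_pmf (Wch x y') (\<lambda>y. map_pmf (\<lambda>ys. y # ys) (channel_outputs Wch xs y))"

definition induced_pmf ::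
    "'u pmf \<Rightarrow> ('x \<Rightarrow> 'y \<Rightarrow> 'y pmf) \<Rightarrow> 'y \<Rightarrow> nat \<Rightarrow> ('u, 'x, 'y, 'v) code
      \<Rightarrow> ('u list \<times> 'x list \<times> 'y list \<times> 'v list) pmf" where
  "induced_pmf PU Wch y0 n = (\<lambda>(f, g).
     bind_pmf (replicate_pmf n PU) (\<lambda>us.
       bind_pmf (channel_outputs Wch (channel_inputs f us) y0) (\<lambda>ys.
         return_pmf (us, channel_inputs f us, ys, g ys))))"

text \<open>List positions count from \<open>0\<close>, so position \<open>i\<close> belongs to time \<open>Suc i\<close>; the previous state
  is therefore \<open>(y0 # ys) ! i\<close>.\<close>

definition empirical ::
    "'y \<Rightarrow> nat \<Rightarrow> 'u list \<times> 'x list \<times> 'y list \<times> 'v list \<Rightarrow> 'u \<times> 'x \<times> 'y \<times> 'y \<times> 'v \<Rightarrow> real" where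
  "empirical y0 n = (\<lambda>(us, xs, ys, vs) (u, x, y', y, v).
     1 / real n * (\<Sum>i<n. of_bool (us ! i = u \<and> xs ! i = x \<and> (y0 # ys) ! i = y' \<and>
                                   ys ! i = y \<and> vs ! i = v)))"

definition l1_dist :: "('a::finite \<Rightarrow> real) \<Rightarrow> ('a \<Rightarrow> real) \<Rightarrow> real" where
  "l1_dist Q P = (\<Sum>a\<in>UNIV. \<bar>Q a - P a\<bar>)"

definition achievable ::
    "'u::finite pmf \<Rightarrow> ('x::finite \<Rightarrow> 'y::finite \<Rightarrow> 'y pmf) \<Rightarrow> 'y
      \<Rightarrow> ('u \<times> 'x \<times> 'y \<times> 'y \<times> 'v::finite) pmf \<Rightarrow> bool" where
  "achievable PU Wch y0 P \<longleftrightarrow>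
     (\<forall>\<epsilon>>0. \<exists>N0::nat. \<forall>n\<ge>N0. \<exists>c\<in>codes n.
        measure_pmf.prob (induced_pmf PU Wch y0 n c)
          {s. l1_dist (empirical y0 n s) (pmf P) \<ge> \<epsilon>} \<le> \<epsilon>)"

text \<open>The random variables are meant to be discrete, hence the counting measures.\<close>

definition cond_mutual_info ::
    "'a pmf \<Rightarrow> ('a \<Rightarrow> 'b) \<Rightarrow> ('a \<Rightarrow> 'c) \<Rightarrow> ('a \<Rightarrow> 'd) \<Rightarrow> real" where
  "cond_mutual_info p X Y Z =
     prob_space.conditional_mutual_information (measure_pmf p) 2
       (count_space UNIV) (count_space UNIV) (count_space UNIV) X Y Z"

text \<open>A joint outcome is \<open>(u, x, w, y', y, v)\<close>. Since any finite set embeds into \<open>nat\<close>, the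
  auxiliary variable takes its values in a finite set \<open>A\<close> of natural numbers.\<close>

type_synonym ('u, 'x, 'y, 'v) joint = "('u \<times> 'x \<times> nat \<times> 'y \<times> 'y \<times> 'v) pmf"

definition marginal_UXYYV ::
    "('u, 'x, 'y, 'v) joint \<Rightarrow> ('u \<times> 'x \<times> 'y \<times> 'y \<times> 'v) pmf" where
  "marginal_UXYYV Q = map_pmf (\<lambda>(u, x, w, y', y, v). (u, x, y', y, v)) Q"

definition info_gap :: "('u, 'x, 'y, 'v) joint \<Rightarrow> real" where
  "info_gap Q =
     cond_mutual_info Q (\<lambda>(u, x, w, y', y, v). x) (\<lambda>(u, x, w, y', y, v). y)
       (\<lambda>(u, x, w, y', y, v). y') -
     cond_mutual_info Q (\<lambda>(u, x, w, y', y, v). u) (\<lambda>(u, x, w, y', y, v). w)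
       (\<lambda>(u, x, w, y', y, v). x)"

definition inner_factorization ::
    "'u pmf \<Rightarrow> ('x::finite \<Rightarrow> 'y::finite \<Rightarrow> 'y pmf) \<Rightarrow> nat set \<Rightarrow> ('u, 'x, 'y, 'v) joint \<Rightarrow> bool" where
  "inner_factorization PU Wch A Q \<longleftrightarrow>
     (\<exists>(PX :: 'x pmf) (PW :: 'u \<Rightarrow> 'x \<Rightarrow> nat pmf) (\<pi> :: 'y pmf) (PV :: 'y \<Rightarrow> 'x \<Rightarrow> nat \<Rightarrow> 'v pmf).
        (\<forall>u x. set_pmf (PW u x) \<subseteq> A) \<and> equilibrium Wch PX \<pi> \<and>
        (\<forall>u x w y' y v. pmf Q (u, x, w, y', y, v) =
           pmf PU u * pmf PX x * pmf (PW u x) w * pmf \<pi> y' * pmf (Wch x y') y * pmf (PV y x w) v))"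

definition outer_factorization ::
    "'u pmf \<Rightarrow> ('x \<Rightarrow> 'y \<Rightarrow> 'y pmf) \<Rightarrow> nat set \<Rightarrow> ('u, 'x, 'y, 'v) joint \<Rightarrow> bool" where
  "outer_factorization PU Wch A Q \<longleftrightarrow>
     (\<exists>(PX :: 'x pmf) (PY' :: 'x \<Rightarrow> 'y pmf) (PW :: 'u \<Rightarrow> 'x \<Rightarrow> 'y \<Rightarrow> 'y \<Rightarrow> nat pmf)
       (PV :: 'y \<Rightarrow> 'x \<Rightarrow> nat \<Rightarrow> 'v pmf).
        (\<forall>u x y y'. set_pmf (PW u x y y') \<subseteq> A) \<and>
        (\<forall>u x w y' y v. pmf Q (u, x, w, y', y, v) =
           pmf PU u * pmf PX x * pmf (PY' x) y' * pmf (Wch x y') y * pmf (PW u x y y') w *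
           pmf (PV y x w) v))"

end

theory Submission
  imports Defs
begin

text \<open>
  Inner bound: in each block of a fixed length the encoder sends a codeword \<open>x(m)\<close>, where \<open>m\<close> selects
  a description of the source symbols of the previous block. A description exists for a random
  codebook by covering, \<open>m\<close> is recovered by packing, and the expected distance to the target adds up
  over the blocks, so that only the number of blocks has to tend to infinity. A functional
  representation moves the randomness of \<open>V\<close> into the auxiliary variable, which becomes a random
  function \<open>s\<close> with \<open>v = s y\<close>; erasing it with a small probability makes the rate inequality strict.
  The law of large numbers for the channel states follows from the Poisson equation.

  Outer bound: with \<open>s\<close> the reconstruction at time \<open>t\<close> as a function of the output at time \<open>t\<close>, the
  time-averaged law of a code has a nonnegative gap, because the gap is a Kullback-Leibler divergence
  divided by the block length. The range of \<open>s\<close> is a fixed finite set, so that compactness gives the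
  claim in the limit.
\<close>

section \<open>Expectations over finitely supported distributions\<close>

text \<open>The statement allows equality of the two informations, whereas random coding needs a
  rate strictly between them. Erasure multiplies I(U;W|X) by 1 - \<delta>, leaves I(X;Y|Y') alone
  and moves the target by at most 2 \<delta>. Only if I(U;W|X) = 0 does it gain nothing, and then
  the description need not depend on the source, so that one message suffices. Two further obstacles
  shape the block code. The channel state at the start of a block depends on everything before, and
  the encoder never sees it: costs and error probabilities are therefore summed over all start
  states, at the price of a factor \<open>CARD('y)\<close>. The code is deterministic, so the law of
  message and state at the start of a block is fixed by the earlier choices and need be neither
  uniform nor a product: each block code is chosen for a given law. A function-valued auxiliary
  variable serves both directions: in the inner bound the encoder can choose s without knowing the
  outputs, in the outer bound s is determined by the outputs at the other times and v = s y holds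
  exactly.\<close>

abbreviation expct :: "'a pmf \<Rightarrow> ('a \<Rightarrow> real) \<Rightarrow> real" where
  "expct p f \<equiv> measure_pmf.expectation p f"

abbreviation prob :: "'a pmf \<Rightarrow> 'a set \<Rightarrow> real" where
  "prob p A \<equiv> measure_pmf.prob p A"

lemma expct_finite_type: "expct p f = (\<Sum>a\<in>UNIV. pmf p a * f a)" for p :: "'a::finite pmf"
  by (subst integral_measure_pmf_real[where A=UNIV]) (auto simp: mult.commute)

lemma expct_mono:
  assumes "finite (set_pmf p)" "\<And>a. a \<in> set_pmf p \<Longrightarrow> f a \<le> g a"
  shows "expct p f \<le> expct p g"
  by (rule integral_mono_AE) (auto simp: AE_measure_pmf_iff assms integrable_measure_pmf_finite)

lemma expct_cong:
  assumes "\<And>a. a \<in> set_pmf p \<Longrightarrow> f a = g a"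
  shows "expct p f = expct p g"
  by (rule integral_cong_AE) (auto simp: AE_measure_pmf_iff assms)

lemma expct_bind:
  assumes "finite (set_pmf p)" "\<And>a. a \<in> set_pmf p \<Longrightarrow> finite (set_pmf (k a))"
  shows "expct (bind_pmf p k) f = expct p (\<lambda>a. expct (k a) f)"
  using assms by (simp add: pmf_expectation_bind[of "set_pmf p"]
      integral_measure_pmf_real[where A="set_pmf p"] mult.commute)

lemma expct_add:
  assumes "finite (set_pmf p)"
  shows "expct p (\<lambda>a. f a + g a) = expct p f + expct p g"
  by (simp add: assms integrable_measure_pmf_finite)

lemma expct_sum:
  assumes "finite (set_pmf p)"
  shows "expct p (\<lambda>a. \<Sum>i\<in>I. f i a) = (\<Sum>i\<in>I. expct p (f i))"
  by (simp add: assms integrable_measure_pmf_finite)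

lemma expct_swap:
  assumes "finite (set_pmf p)" "finite (set_pmf q)"
  shows "expct p (\<lambda>a. expct q (f a)) = expct q (\<lambda>b. expct p (\<lambda>a. f a b))"
proof -
  have "expct p (\<lambda>a. expct q (f a)) = (\<Sum>a\<in>set_pmf p. \<Sum>b\<in>set_pmf q. f a b * pmf q b * pmf p a)"
    using assms by (simp add: integral_measure_pmf_real[where A="set_pmf p"]
        integral_measure_pmf_real[where A="set_pmf q"] sum_distrib_right)
  also have "\<dots> = (\<Sum>b\<in>set_pmf q. \<Sum>a\<in>set_pmf p. f a b * pmf p a * pmf q b)"
    by (subst sum.swap) (simp add: mult_ac)
  also have "\<dots> = expct q (\<lambda>b. expct p (\<lambda>a. f a b))"
    using assms by (simp add: integral_measure_pmf_real[where A="set_pmf p"]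
        integral_measure_pmf_real[where A="set_pmf q"] sum_distrib_right)
  finally show ?thesis .
qed

text \<open>This is how random codebooks are turned into fixed ones.\<close>

lemma expct_le_imp_ex:
  assumes "finite (set_pmf p)" "expct p f \<le> c"
  shows "\<exists>a\<in>set_pmf p. f a \<le> c"
proof (rule ccontr)
  assume "\<not> ?thesis"
  then have gt: "\<And>a. a \<in> set_pmf p \<Longrightarrow> f a - c > 0" by auto
  have "expct p f - c = expct p (\<lambda>a. f a - c)"
    by (simp add: assms integrable_measure_pmf_finite)
  also have "\<dots> = (\<Sum>a\<in>set_pmf p. (f a - c) * pmf p a)"
    using assms by (simp add: integral_measure_pmf_real[where A="set_pmf p"])
  also have "\<dots> > 0"
    using assms gt by (intro sum_pos) (auto simp: set_pmf_not_empty pmf_positive)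
  finally show False using assms by simp
qed

lemma expct_prob: "expct p (\<lambda>a. of_bool (a \<in> A)) = prob p A"
proof -
  have "expct p (\<lambda>a. of_bool (a \<in> A)) = expct p (indicator A)"
    by (intro expct_cong) (simp add: indicator_def)
  then show ?thesis by simp
qed

lemma expct_of_bool: "expct p (\<lambda>a. of_bool (P a)) = prob p {a. P a}"
  using expct_prob[of p "{a. P a}"] by simp

text \<open>It drives the maximum principles for chains and the equality case of the mutual
  information.\<close>

lemma expct_max_attained:
  fixes p :: "'a::finite pmf"
  assumes le: "\<And>c. c \<in> set_pmf p \<Longrightarrow> f c \<le> m" and eq: "expct p f = m" and c: "c \<in> set_pmf p"
  shows "f c = m"
proof -
  have "(\<Sum>a\<in>set_pmf p. (m - f a) * pmf p a) = expct p (\<lambda>a. m - f a)"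
    by (simp add: integral_measure_pmf_real[where A="set_pmf p"])
  also have "\<dots> = 0" using eq by (simp add: integrable_measure_pmf_finite)
  finally have "(m - f c) * pmf p c = 0"
    using le c by (subst (asm) sum_nonneg_eq_0_iff) auto
  then show ?thesis using c by (simp add: set_pmf_iff)
qed

section \<open>Finite chains with a single recurrent class\<close>

abbreviation step_rel :: "('s \<Rightarrow> 's pmf) \<Rightarrow> ('s \<times> 's) set" where
  "step_rel T \<equiv> {(a, b). b \<in> set_pmf (T a)}"

lemma accessible_iff_rtrancl: "accessible T a b \<longleftrightarrow> (a, b) \<in> (step_rel T)\<^sup>*"
proof -
  have "b \<in> set_pmf (nstep T n a) \<longleftrightarrow> (a, b) \<in> step_rel T ^^ n" for n
  proof (induction n arbitrary: a)
    case (Suc n)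
    have "(a, b) \<in> step_rel T ^^ Suc n \<longleftrightarrow> (\<exists>c. (a, c) \<in> step_rel T \<and> (c, b) \<in> step_rel T ^^ n)"
      by (metis relpow_Suc_D2 relpow_Suc_I2)
    then show ?case using Suc by (simp del: relpow.simps) blast
  qed auto
  then show ?thesis
    unfolding accessible_def rtrancl_is_UN_relpow by (auto simp: pmf_positive_iff)
qed

text \<open>The probability \<open>l\<close> of never visiting \<open>b\<close> is harmonic once
  mass entering \<open>b\<close> is discarded. A positive maximum of \<open>l\<close> on
  \<open>C\<close> would be passed on to every successor without ever meeting \<open>b\<close>,
  although \<open>b\<close> can be reached from all of \<open>C\<close>.\<close>

lemma first_passage_sums_1:
  fixes T :: "'s::finite \<Rightarrow> 's pmf"
  assumes closed: "\<And>a. a \<in> C \<Longrightarrow> set_pmf (T a) \<subseteq> C"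
    and acc: "\<And>a. a \<in> C \<Longrightarrow> (a, b) \<in> (step_rel T)\<^sup>*" and "a0 \<in> C"
  shows "(\<lambda>n. first_passage T b n a0) sums 1"
proof -
  define fp where "fp = first_passage T b"
  \<comment> \<open>\<open>surv n a\<close> is the probability of avoiding \<open>b\<close> at the
    times 1 to n, and \<open>kill l\<close> sets the value at \<open>b\<close> to 0, so that one
    step of the recursion is a plain expectation.\<close>
  define surv where "surv n a = 1 - (\<Sum>k<n. fp k a)" for n a
  define kill where "kill l c = (if c = b then 0 else l c :: real)" for l c
  have kill_sum: "expct (T a) (kill l) = (\<Sum>c\<in>UNIV - {b}. pmf (T a) c * l c)" for a l
    unfolding expct_finite_type kill_def
    by (rule sum.mono_neutral_cong_right) auto
  have surv_Suc: "surv (Suc n) a = expct (T a) (kill (surv n))" for n a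
  proof -
    have one: "pmf (T a) b + (\<Sum>c\<in>UNIV - {b}. pmf (T a) c) = 1"
      using sum_pmf_eq_1[of UNIV "T a"] sum.remove[of UNIV b "pmf (T a)"] by simp
    have "(\<Sum>k<Suc n. fp k a) = pmf (T a) b + (\<Sum>k<n. \<Sum>c\<in>UNIV - {b}. pmf (T a) c * fp k c)"
      by (subst sum.lessThan_Suc_shift) (simp add: fp_def)
    also have "(\<Sum>k<n. \<Sum>c\<in>UNIV - {b}. pmf (T a) c * fp k c)
        = (\<Sum>c\<in>UNIV - {b}. pmf (T a) c * (\<Sum>k<n. fp k c))"
      by (subst sum.swap) (simp add: sum_distrib_left)
    finally show ?thesis
      using one by (simp add: kill_sum surv_def right_diff_distrib sum_subtractf)
  qed
  have fp_nonneg: "fp n a \<ge> 0" for n a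
    unfolding fp_def by (induction n arbitrary: a) (auto intro!: sum_nonneg)
  have surv_nonneg: "surv n a \<ge> 0" for n a
  proof (induction n arbitrary: a)
    case (Suc n)
    then show ?case by (auto simp: surv_Suc kill_def intro!: integral_nonneg)
  qed (simp add: surv_def)
  have summable: "summable (\<lambda>n. fp n a)" for a
    by (rule bounded_imp_summable[where B=1])
      (use fp_nonneg surv_nonneg[of "Suc _" a] in \<open>auto simp: surv_def lessThan_Suc_atMost\<close>)
  define l where "l a = 1 - (\<Sum>n. fp n a)" for a
  have lim: "(\<lambda>n. surv n a) \<longlonglongrightarrow> l a" for a
    unfolding surv_def l_def using summable_LIMSEQ[OF summable[of a]] by (intro tendsto_intros)
  have l_eq: "l a = expct (T a) (kill l)" for a
  proof (rule LIMSEQ_unique)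
    show "(\<lambda>n. surv (Suc n) a) \<longlonglongrightarrow> l a" using lim LIMSEQ_Suc by blast
    show "(\<lambda>n. surv (Suc n) a) \<longlonglongrightarrow> expct (T a) (kill l)"
      unfolding surv_Suc kill_sum by (intro tendsto_intros lim)
  qed
  have l_nonneg: "l a \<ge> 0" for a
    using lim surv_nonneg by (intro LIMSEQ_le_const[OF lim]) auto
  have "l a0 = 0"
  proof (rule ccontr)
    assume ne: "l a0 \<noteq> 0"
    define m where "m = Max (l ` C)"
    have le_m: "l a \<le> m" if "a \<in> C" for a unfolding m_def using that by auto
    have "m > 0" using le_m[OF \<open>a0 \<in> C\<close>] l_nonneg[of a0] ne by linarith
    \<comment> \<open>An average of values that are at most \<open>m\<close> equals \<open>m\<close>
      only if all of them do; as \<open>m > 0\<close>, the discarded state \<open>b\<close> cannot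
      be among the successors.\<close>
    have succ: "c \<noteq> b \<and> l c = m \<and> c \<in> C" if "a \<in> C" "l a = m" "c \<in> set_pmf (T a)" for a c
    proof -
      have "kill l c' \<le> m" if "c' \<in> set_pmf (T a)" for c'
        using le_m that closed[OF \<open>a \<in> C\<close>] \<open>m > 0\<close> by (auto simp: kill_def)
      then have "kill l c = m"
        using expct_max_attained[of "T a" "kill l" m c] l_eq[of a] that by simp
      then show ?thesis using \<open>m > 0\<close> closed that by (auto simp: kill_def split: if_splits)
    qed
    have "m \<in> l ` C" unfolding m_def using \<open>a0 \<in> C\<close> by (intro Max_in) auto
    then obtain a1 where a1: "a1 \<in> C" "l a1 = m" by auto
    obtain c1 where "c1 \<in> set_pmf (T a1)" using set_pmf_not_empty[of "T a1"] by blast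
    from succ[OF a1 this] have c1: "c1 \<in> C" "l c1 = m" "c1 \<noteq> b" by auto
    have "(c1, d) \<in> (step_rel T)\<^sup>* \<Longrightarrow> d \<in> C \<and> l d = m \<and> d \<noteq> b" for d
    proof (induction rule: rtrancl_induct)
      case (step d d')
      then have "d' \<in> set_pmf (T d)" by simp
      from succ[OF _ _ this] step.IH show ?case by blast
    qed (use c1 in blast)
    then show False using acc c1 by blast
  qed
  then have "(\<Sum>n. fp n a0) = 1" by (simp add: l_def)
  then show ?thesis using summable_sums[OF summable[of a0]] by (simp add: fp_def)
qed

text \<open>Take a state of \<open>D\<close> whose set of reachable states has least cardinality.
  Every state in this set reaches exactly the same states, so the set is closed and communicating,
  and each of its states is revisited with certainty.\<close>

lemma closed_set_recurrent_class:
  fixes T :: "'s::finite \<Rightarrow> 's pmf"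
  assumes "D \<noteq> {}" and closed: "\<And>a. a \<in> D \<Longrightarrow> set_pmf (T a) \<subseteq> D"
  shows "\<exists>C\<subseteq>D. recurrent_class T C"
proof -
  define R where "R a = {b. (a, b) \<in> (step_rel T)\<^sup>*}" for a
  obtain a where a: "a \<in> D" "\<And>b. b \<in> D \<Longrightarrow> card (R a) \<le> card (R b)"
    using ex_has_least_nat[of "\<lambda>a. a \<in> D" _ "\<lambda>a. card (R a)"] \<open>D \<noteq> {}\<close> by blast
  have RD: "R a \<subseteq> D"
  proof
    fix b assume "b \<in> R a"
    then have "(a, b) \<in> (step_rel T)\<^sup>*" by (simp add: R_def)
    then show "b \<in> D" by (induction rule: rtrancl_induct) (use a closed in auto)
  qed
  have R_eq: "R b = R a" if "b \<in> R a" for b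
  proof (rule card_seteq)
    show "R b \<subseteq> R a" using that by (auto simp: R_def)
    show "card (R a) \<le> card (R b)" using a that RD by blast
  qed auto
  have "a \<in> R a" by (simp add: R_def)
  have "recurrent_class T (R a)"
    unfolding recurrent_class_def communicating_class_def recurrent_def accessible_iff_rtrancl
  proof (intro conjI ballI exI[of _ a])
    show "R a = {b. (a, b) \<in> (step_rel T)\<^sup>* \<and> (b, a) \<in> (step_rel T)\<^sup>*}"
    proof (intro equalityI subsetI)
      fix b assume "b \<in> R a"
      with R_eq[OF this] \<open>a \<in> R a\<close> show "b \<in> {b. (a, b) \<in> (step_rel T)\<^sup>* \<and> (b, a) \<in> (step_rel T)\<^sup>*}"
        unfolding R_def by blast
    qed (simp add: R_def)
    fix b assume b: "b \<in> R a"
    show "(\<lambda>n. first_passage T b n b) sums 1"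
    proof (rule first_passage_sums_1[of "R a"])
      show "set_pmf (T c) \<subseteq> R a" if "c \<in> R a" for c
        using that by (auto simp: R_def intro: rtrancl_into_rtrancl)
      show "(c, b) \<in> (step_rel T)\<^sup>*" if "c \<in> R a" for c
        using R_eq[OF that] b by (auto simp: R_def)
    qed (rule b)
  qed
  then show ?thesis using RD by blast
qed

text \<open>The states where \<open>h\<close> is maximal form a closed set, and so do those where it
  is minimal. Each contains a recurrent class; as these classes coincide, the maximum equals the
  minimum.\<close>

lemma harmonic_const:
  fixes T :: "'s::finite \<Rightarrow> 's pmf"
  assumes uniq: "\<And>C D. recurrent_class T C \<Longrightarrow> recurrent_class T D \<Longrightarrow> C = D"
    and harm: "\<And>a. expct (T a) h = h a"
  shows "h a = h b"
proof -
  have *: "\<exists>C. recurrent_class T C \<and> (\<forall>c\<in>C. g c = Max (range g))"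
    if g: "\<And>a. expct (T a) g = g a" for g :: "'s \<Rightarrow> real"
  proof -
    define D where "D = {c. g c = Max (range g)}"
    have "Max (range g) \<in> range g" by (rule Max_in) auto
    then have "D \<noteq> {}" unfolding D_def by (metis (mono_tags) empty_Collect_eq rangeE)
    moreover have "set_pmf (T a) \<subseteq> D" if "a \<in> D" for a
      using expct_max_attained[of "T a" g "Max (range g)"] g[of a] that
      unfolding D_def by (metis (mono_tags, lifting) Max_ge finite finite_imageI mem_Collect_eq rangeI subsetI)
    ultimately show ?thesis using closed_set_recurrent_class[of D T] unfolding D_def by blast
  qed
  obtain C where C: "recurrent_class T C" "\<And>c. c \<in> C \<Longrightarrow> h c = Max (range h)"
    using *[of h] harm by blast
  obtain C' where C': "recurrent_class T C'" "\<And>c. c \<in> C' \<Longrightarrow> - h c = Max (range (\<lambda>c. - h c))"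
    using *[of "\<lambda>c. - h c"] harm by auto
  have "C \<noteq> {}"
    using C(1) by (auto simp: recurrent_class_def communicating_class_def accessible_iff_rtrancl)
  moreover have "C' = C" using uniq C(1) C'(1) by blast
  ultimately obtain c where "h c = Max (range h)" "- h c = Max (range (\<lambda>c. - h c))"
    using C C' by blast
  moreover have "h d \<le> Max (range h)" "- h d \<le> Max (range (\<lambda>c. - h c))" for d by auto
  ultimately have "h d = h c" for d by (metis antisym neg_le_iff_le)
  then show ?thesis by metis
qed

text \<open>The rank-one perturbation \<open>h - T h + \<pi> h\<close> of \<open>h - T h\<close> is injective, hence surjective.\<close>

lemma poisson_equation:
  fixes T :: "'s::finite \<Rightarrow> 's pmf"
  assumes uniq: "\<And>C D. recurrent_class T C \<Longrightarrow> recurrent_class T D \<Longrightarrow> C = D"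
    and inv: "bind_pmf \<pi> T = \<pi>" and zero: "expct \<pi> g = 0"
  obtains h where "\<And>a. g a = h a - expct (T a) h"
proof -
  have inv': "expct \<pi> (\<lambda>a. expct (T a) f) = expct \<pi> f" for f :: "'s \<Rightarrow> real"
    using expct_bind[of \<pi> T f] inv by simp
  define L :: "real^'s \<Rightarrow> real^'s"
    where "L h = (\<chi> a. h $ a - expct (T a) (\<lambda>b. h $ b) + expct \<pi> (\<lambda>b. h $ b))" for h
  have L: "expct \<pi> (\<lambda>a. L h $ a) = expct \<pi> (\<lambda>b. h $ b)" for h
    using inv'[of "\<lambda>b. h $ b"] by (simp add: L_def integrable_measure_pmf_finite)
  have lin: "linear L"
    by (rule linearI) (auto simp: L_def vec_eq_iff integrable_measure_pmf_finite algebra_simps)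
  have "inj L"
    unfolding linear_injective_0[OF lin]
  proof (intro allI impI)
    fix h assume "L h = 0"
    then have \<pi>h: "expct \<pi> (\<lambda>b. h $ b) = 0" using L[of h] by simp
    have "expct (T a) (\<lambda>b. h $ b) = h $ a" for a
      using arg_cong[OF \<open>L h = 0\<close>, of "\<lambda>v. v $ a"] \<pi>h by (simp add: L_def)
    from harmonic_const[OF uniq this] have const: "h $ a = h $ b" for a b .
    have "h $ a = 0" for a
      using \<pi>h expct_cong[of \<pi> "\<lambda>b. h $ b" "\<lambda>b. h $ a"] const by simp
    then show "h = 0" by (simp add: vec_eq_iff)
  qed
  then have "surj L" using linear_injective_imp_surjective[OF lin] by simp
  then obtain h where h: "L h = (\<chi> a. g a)" by (metis surjD)
  \<comment> \<open>Averaging \<open>L h = g\<close> over the invariant law cancels h - T h and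
    leaves \<pi> h = \<pi> g = 0, so the rank-one term is gone and \<open>h\<close> solves the
    equation.\<close>
  then have "expct \<pi> (\<lambda>b. h $ b) = 0" using L[of h] zero by simp
  then have "g a = h $ a - expct (T a) (\<lambda>b. h $ b)" for a
    using arg_cong[OF h, of "\<lambda>v. v $ a"] by (simp add: L_def)
  then show ?thesis by (rule that)
qed

section \<open>Law of large numbers along trajectories\<close>

text \<open>The state is a function \<open>out\<close> of the last letter. A letter may carry more
  than the state, so that sums over letters can involve inputs and auxiliary values.\<close>

primrec trajectory :: "('s \<Rightarrow> 'a pmf) \<Rightarrow> ('a \<Rightarrow> 's) \<Rightarrow> nat \<Rightarrow> 's \<Rightarrow> 'a list pmf" where
  "trajectory J out 0 y = return_pmf []"
| "trajectory J out (Suc n) y =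
     bind_pmf (J y) (\<lambda>a. map_pmf (Cons a) (trajectory J out n (out a)))"

primrec path_sum :: "('s \<Rightarrow> 'a \<Rightarrow> real) \<Rightarrow> ('a \<Rightarrow> 's) \<Rightarrow> 's \<Rightarrow> 'a list \<Rightarrow> real" where
  "path_sum g out y [] = 0"
| "path_sum g out y (a # as) = g y a + path_sum g out (out a) as"

lemma finite_set_trajectory [simp]:
  "finite (set_pmf (trajectory (J :: 's \<Rightarrow> 'a::finite pmf) out n y))"
  by (induction n arbitrary: y) auto

lemma length_trajectory: "zs \<in> set_pmf (trajectory J out n y) \<Longrightarrow> length zs = n"
  by (induction n arbitrary: y zs) auto

lemma expct_trajectory_Suc:
  "expct (trajectory J out (Suc n) y) F =
    expct (J y) (\<lambda>a. expct (trajectory J out n (out a)) (\<lambda>zs. F (a # zs)))"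
  for J :: "'s \<Rightarrow> 'a::finite pmf"
  by (simp add: expct_bind)

lemma path_sum_mean:
  fixes J :: "'s \<Rightarrow> 'a::finite pmf"
  assumes "\<And>y. expct (J y) (g y) = 0"
  shows "expct (trajectory J out n y) (path_sum g out y) = 0"
proof (induction n arbitrary: y)
  case (Suc n)
  then show ?case
    by (simp add: expct_trajectory_Suc expct_add assms del: trajectory.simps)
qed simp

text \<open>The terms are martingale differences: given the first letter the rest has mean 0, so the
  cross term vanishes and only the squares add up.\<close>

lemma path_sum_variance:
  fixes J :: "'s \<Rightarrow> 'a::finite pmf"
  assumes mean: "\<And>y. expct (J y) (g y) = 0" and K: "\<And>y a. \<bar>g y a\<bar> \<le> K"
  shows "expct (trajectory J out n y) (\<lambda>zs. (path_sum g out y zs)\<^sup>2) \<le> real n * K\<^sup>2"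
proof (induction n arbitrary: y)
  case (Suc n)
  have "expct (trajectory J out n (out a)) (\<lambda>zs. (path_sum g out y (a # zs))\<^sup>2) \<le> K\<^sup>2 + real n * K\<^sup>2" for a
  proof -
    have "expct (trajectory J out n (out a)) (\<lambda>zs. (path_sum g out y (a # zs))\<^sup>2)
      = expct (trajectory J out n (out a)) (\<lambda>zs. (g y a)\<^sup>2 + 2 * g y a * path_sum g out (out a) zs
          + (path_sum g out (out a) zs)\<^sup>2)"
      by (simp add: power2_sum algebra_simps)
    also have "\<dots> = (g y a)\<^sup>2 + expct (trajectory J out n (out a)) (\<lambda>zs. (path_sum g out (out a) zs)\<^sup>2)"
      by (simp add: expct_add path_sum_mean[OF mean])
    also have "(g y a)\<^sup>2 \<le> K\<^sup>2" using K[of y a] abs_le_square_iff[of "g y a" K] by linarith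
    finally show ?thesis using Suc[of "out a"] by simp
  qed
  then have "expct (trajectory J out (Suc n) y) (\<lambda>zs. (path_sum g out y zs)\<^sup>2)
      \<le> expct (J y) (\<lambda>a. K\<^sup>2 + real n * K\<^sup>2)"
    unfolding expct_trajectory_Suc by (intro expct_mono) auto
  then show ?case by (simp add: algebra_simps)
qed simp

lemma path_sum_abs:
  fixes J :: "'s \<Rightarrow> 'a::finite pmf"
  assumes mean: "\<And>y. expct (J y) (g y) = 0" and K: "\<And>y a. \<bar>g y a\<bar> \<le> K"
  shows "expct (trajectory J out n y) (\<lambda>zs. \<bar>path_sum g out y zs\<bar>) \<le> K * sqrt n"
proof (cases "n = 0 \<or> K = 0")
  case True
  have "path_sum g out y zs = 0" if "K = 0" for zs
    using that K by (induction zs arbitrary: y) auto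
  then show ?thesis using True by auto
next
  case False
  then have "K > 0" using K[of y undefined] by linarith
  \<comment> \<open>The scale \<open>s\<close> bounds the standard deviation; with it both terms of
    |t| \<le> t^2 / (2 s) + s / 2 contribute at most s / 2. It has to be positive, hence the case
    split above.\<close>
  define s where "s = K * sqrt n"
  have "s > 0" using False \<open>K > 0\<close> by (simp add: s_def)
  have amgm: "\<bar>t\<bar> \<le> t\<^sup>2 / (2 * s) + s / 2" for t
    using \<open>s > 0\<close> zero_le_power2[of "\<bar>t\<bar> - s"] by (simp add: field_simps power2_eq_square)
  have "expct (trajectory J out n y) (\<lambda>zs. \<bar>path_sum g out y zs\<bar>)
     \<le> expct (trajectory J out n y) (\<lambda>zs. (path_sum g out y zs)\<^sup>2 / (2 * s) + s / 2)"
    by (intro expct_mono amgm) auto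
  also have "\<dots> \<le> (real n * K\<^sup>2) / (2 * s) + s / 2"
    using path_sum_variance[OF mean K, where out=out and n=n and y=y] \<open>s > 0\<close>
    by (simp add: expct_add divide_right_mono)
  also have "real n * K\<^sup>2 = s\<^sup>2" by (simp add: s_def power_mult_distrib)
  also have "s\<^sup>2 / (2 * s) + s / 2 = s" using \<open>s > 0\<close> by (simp add: power2_eq_square field_simps)
  finally show ?thesis by (simp add: s_def)
qed

text \<open>Subtracting the solution of the Poisson equation turns the centred sum into a martingale.\<close>

lemma trajectory_lln:
  fixes J :: "'s::finite \<Rightarrow> 'a::finite pmf" and out :: "'a \<Rightarrow> 's" and f :: "'a \<Rightarrow> real"
  defines "T \<equiv> (\<lambda>y. map_pmf out (J y))"
  assumes uniq: "\<And>C D. recurrent_class T C \<Longrightarrow> recurrent_class T D \<Longrightarrow> C = D"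
    and inv: "bind_pmf \<pi> T = \<pi>"
  defines "\<mu> \<equiv> expct \<pi> (\<lambda>y. expct (J y) f)"
  obtains c where "\<And>n y. expct (trajectory J out n y) (\<lambda>zs. \<bar>sum_list (map f zs) - n * \<mu>\<bar>)
      \<le> c * (sqrt n + 1)"
proof -
  have "expct \<pi> (\<lambda>y. expct (J y) f - \<mu>) = 0" by (simp add: \<mu>_def integrable_measure_pmf_finite)
  from poisson_equation[OF uniq inv this]
  obtain h where h: "\<And>y. expct (J y) f - \<mu> = h y - expct (T y) h" by blast
  \<comment> \<open>The solution of the Poisson equation for the conditional mean of
    \<open>f\<close> makes \<open>g y\<close> centred under \<open>J y\<close> for every state
    \<open>y\<close>.\<close>
  define g where "g y a = f a - \<mu> + h (out a) - h y" for y a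
  have mean: "expct (J y) (g y) = 0" for y
    using h[of y] by (simp add: g_def[abs_def] T_def integrable_measure_pmf_finite)
  define K where "K = Max (range (\<lambda>(y, a). \<bar>g y a\<bar>))"
  have K: "\<bar>g y a\<bar> \<le> K" for y a
    unfolding K_def by (rule Max_ge) (auto intro: rev_image_eqI[of "(y, a)"])
  define H where "H = Max (range (\<lambda>y. \<bar>h y\<bar>))"
  have H: "\<bar>h y\<bar> \<le> H" for y unfolding H_def by (rule Max_ge) auto
  \<comment> \<open>The corrections telescope to a difference of two values of \<open>h\<close>,
    whence a constant 2 \<open>H\<close> that is uniform in the start state.\<close>
  have tele: "\<exists>y'. path_sum g out y zs = sum_list (map f zs) - length zs * \<mu> + h y' - h y" for y zs
  proof (induction zs arbitrary: y)
    case (Cons a zs)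
    obtain y' where "path_sum g out (out a) zs = sum_list (map f zs) - length zs * \<mu> + h y' - h (out a)"
      using Cons by blast
    then show ?case by (intro exI[of _ y']) (simp add: g_def[of y a] algebra_simps)
  qed auto
  have "expct (trajectory J out n y) (\<lambda>zs. \<bar>sum_list (map f zs) - n * \<mu>\<bar>) \<le> (K + 2 * H) * (sqrt n + 1)" for n y
  proof -
    have "\<bar>sum_list (map f zs) - n * \<mu>\<bar> \<le> \<bar>path_sum g out y zs\<bar> + 2 * H"
      if "zs \<in> set_pmf (trajectory J out n y)" for zs
    proof -
      obtain y' where "path_sum g out y zs = sum_list (map f zs) - length zs * \<mu> + h y' - h y"
        using tele by blast
      then show ?thesis using H[of y] H[of y'] length_trajectory[OF that] by simp
    qed
    then have "expct (trajectory J out n y) (\<lambda>zs. \<bar>sum_list (map f zs) - n * \<mu>\<bar>)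
        \<le> expct (trajectory J out n y) (\<lambda>zs. \<bar>path_sum g out y zs\<bar> + 2 * H)"
      by (intro expct_mono) auto
    also have "\<dots> \<le> K * sqrt n + 2 * H"
      using path_sum_abs[OF mean K, where out=out and n=n and y=y] by (simp add: expct_add)
    also have "\<dots> \<le> (K + 2 * H) * (sqrt n + 1)"
      using K[of y undefined] H[of y] by (simp add: algebra_simps)
    finally show ?thesis .
  qed
  then show ?thesis by (rule that)
qed

primrec prod_kernel :: "('a \<Rightarrow> 'b pmf) \<Rightarrow> 'a list \<Rightarrow> 'b list pmf" where
  "prod_kernel k [] = return_pmf []"
| "prod_kernel k (a # as) = bind_pmf (k a) (\<lambda>b. map_pmf (Cons b) (prod_kernel k as))"

text \<open>The previous state is part of the letter because the target distribution records it. The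
  value \<open>s\<close> is drawn from (u, x) alone, before the channel acts.\<close>

definition letter_law ::
  "'u pmf \<Rightarrow> 'x pmf \<Rightarrow> ('u \<Rightarrow> 'x \<Rightarrow> 's pmf) \<Rightarrow> ('x \<Rightarrow> 'y \<Rightarrow> 'y pmf) \<Rightarrow> 'y \<Rightarrow> ('u \<times> 'x \<times> 's \<times> 'y \<times> 'y) pmf" where
  "letter_law PU PX PS Wch y' = bind_pmf PU (\<lambda>u. bind_pmf PX (\<lambda>x. bind_pmf (PS u x) (\<lambda>s.
     map_pmf (\<lambda>y. (u, x, s, y', y)) (Wch x y'))))"

abbreviation last_state :: "'u \<times> 'x \<times> 's \<times> 'y \<times> 'y \<Rightarrow> 'y" where
  "last_state \<equiv> (\<lambda>(u, x, s, y', y). y)"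

abbreviation zip5 :: "'u list \<Rightarrow> 'x list \<Rightarrow> 's list \<Rightarrow> 'y \<Rightarrow> 'y list \<Rightarrow> ('u \<times> 'x \<times> 's \<times> 'y \<times> 'y) list" where
  "zip5 us xs ss y ys \<equiv> zip us (zip xs (zip ss (zip (y # ys) ys)))"

lemma bind_pmf_cong_UNIV: "(\<And>x. f x = g x) \<Longrightarrow> bind_pmf p f = bind_pmf p g"
  by (rule bind_pmf_cong) auto

text \<open>The law of large numbers concerns sampling letter by letter, random coding concerns
  sampling whole words: source and inputs, then auxiliary values, then outputs. The proof only
  commutes independent draws.\<close>

lemma trajectory_letter_law:
  "trajectory (letter_law PU PX PS Wch) last_state n y =
     bind_pmf (replicate_pmf n PU) (\<lambda>us. bind_pmf (replicate_pmf n PX) (\<lambda>xs.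
       bind_pmf (prod_kernel (\<lambda>(u, x). PS u x) (zip us xs)) (\<lambda>ss.
         map_pmf (\<lambda>ys. zip5 us xs ss y ys) (channel_outputs Wch xs y))))"
proof (induction n arbitrary: y)
  case (Suc n)
  let ?k = "prod_kernel (\<lambda>(u, x). PS u x)"
  let ?G = "\<lambda>u us x xs s ss y1 ys. return_pmf ((u, x, s, y, y1) # zip5 us xs ss y1 ys)"
  have "trajectory (letter_law PU PX PS Wch) last_state (Suc n) y =
    bind_pmf PU (\<lambda>u. bind_pmf PX (\<lambda>x. bind_pmf (PS u x) (\<lambda>s. bind_pmf (Wch x y) (\<lambda>y1.
      bind_pmf (replicate_pmf n PU) (\<lambda>us. bind_pmf (replicate_pmf n PX) (\<lambda>xs.
        bind_pmf (?k (zip us xs)) (\<lambda>ss. bind_pmf (channel_outputs Wch xs y1) (\<lambda>ys.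
          ?G u us x xs s ss y1 ys))))))))"
    by (simp add: letter_law_def Suc bind_assoc_pmf bind_return_pmf bind_map_pmf map_bind_pmf map_pmf_def)
  also have "\<dots> = bind_pmf PU (\<lambda>u. bind_pmf PX (\<lambda>x.
      bind_pmf (replicate_pmf n PU) (\<lambda>us. bind_pmf (replicate_pmf n PX) (\<lambda>xs. bind_pmf (PS u x) (\<lambda>s.
        bind_pmf (?k (zip us xs)) (\<lambda>ss. bind_pmf (Wch x y) (\<lambda>y1. bind_pmf (channel_outputs Wch xs y1) (\<lambda>ys.
          ?G u us x xs s ss y1 ys))))))))"
    apply (intro bind_pmf_cong_UNIV)
    apply (subst (2) bind_commute_pmf)
    apply (subst bind_commute_pmf)
    apply (intro bind_pmf_cong_UNIV)
    apply (subst (2) bind_commute_pmf)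
    apply (subst bind_commute_pmf)
    apply (intro bind_pmf_cong_UNIV)
    apply (subst bind_commute_pmf)
    apply (rule refl)
    done
  also have "\<dots> = bind_pmf PU (\<lambda>u. bind_pmf (replicate_pmf n PU) (\<lambda>us. bind_pmf PX (\<lambda>x.
      bind_pmf (replicate_pmf n PX) (\<lambda>xs. bind_pmf (PS u x) (\<lambda>s.
        bind_pmf (?k (zip us xs)) (\<lambda>ss. bind_pmf (Wch x y) (\<lambda>y1. bind_pmf (channel_outputs Wch xs y1) (\<lambda>ys.
          ?G u us x xs s ss y1 ys))))))))"
    by (intro bind_pmf_cong_UNIV) (rule bind_commute_pmf)
  finally show ?case
    by (simp add: replicate_pmf_def[symmetric] bind_assoc_pmf bind_return_pmf bind_map_pmf map_bind_pmf map_pmf_def)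
qed (simp add: map_pmf_def bind_return_pmf)

lemma finite_set_replicate_pmf [simp]: "finite (set_pmf (replicate_pmf n (p :: 'a::finite pmf)))"
  by (induction n) auto

lemma finite_set_prod_kernel [simp]: "finite (set_pmf (prod_kernel (k :: _ \<Rightarrow> 'a::finite pmf) as))"
  by (induction as) auto

lemma finite_set_channel_outputs [simp]:
  "finite (set_pmf (channel_outputs (Wch :: _ \<Rightarrow> _ \<Rightarrow> 'a::finite pmf) xs y))"
  by (induction xs arbitrary: y) auto

section \<open>Covering and packing\<close>

lemma prob_le_of_density_le:
  fixes q r :: "'c pmf"
  assumes "\<theta> > 0" "finite (set_pmf r)"
    and "\<And>y. y \<in> A \<Longrightarrow> pmf r y \<le> \<theta> * pmf q y"
  shows "prob r A \<le> \<theta> * prob q A"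
proof -
  have "prob r A = prob r (A \<inter> set_pmf r)"
    by (simp add: measure_Int_set_pmf)
  also have "\<dots> = (\<Sum>y\<in>A \<inter> set_pmf r. pmf r y)"
    using assms by (intro measure_measure_pmf_finite) auto
  also have "\<dots> \<le> (\<Sum>y\<in>A \<inter> set_pmf r. \<theta> * pmf q y)"
    using assms by (intro sum_mono) auto
  also have "\<dots> = \<theta> * prob q (A \<inter> set_pmf r)"
    using assms by (simp add: measure_measure_pmf_finite sum_distrib_left)
  also have "\<dots> \<le> \<theta> * prob q A"
    using assms by (intro mult_left_mono measure_pmf.finite_measure_mono) auto
  finally show ?thesis .
qed

lemma finite_set_Pi_pmf [simp]:
  "finite A \<Longrightarrow> finite (set_pmf p) \<Longrightarrow> finite (set_pmf (Pi_pmf A d (\<lambda>_. p)))"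
  by (rule finite_subset[OF set_Pi_pmf_subset']) auto

text \<open>The covering estimate (1 - x y)^M \<le> 1 - x + exp (- M y) with x = \<open>g\<close>
  and y = 1 / \<open>t\<close>. It uses 1 - r \<le> exp (- g / t) and the convexity of exp between 0
  and - M / t at weight \<open>g\<close>.\<close>

lemma power_one_minus_le:
  fixes g t :: real
  assumes "0 \<le> g" "g \<le> 1" "t > 0" "g / t \<le> r" "r \<le> 1"
  shows "(1 - r) ^ M \<le> 1 - g + exp (- real M / t)"
proof -
  have "(1 - r) ^ M \<le> exp (- g / t) ^ M"
    using assms exp_ge_add_one_self[of "- g / t"] by (intro power_mono) auto
  also have "\<dots> = exp (- (real M * g / t))"
    by (simp flip: exp_of_nat_mult)
  also have "\<dots> = exp ((1 - g) *\<^sub>R 0 + g *\<^sub>R (- real M / t))" by (simp add: mult.commute)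
  also have "\<dots> \<le> (1 - g) * exp 0 + g * exp (- real M / t)"
    using assms by (intro convex_onD[OF exp_convex]) auto
  also have "\<dots> \<le> 1 - g + exp (- real M / t)"
    using assms by (simp add: mult_left_le_one_le)
  finally show ?thesis .
qed

text \<open>Among \<open>M\<close> independent samples of \<open>R\<close>, one is good for \<open>a\<close> except with probability
  \<open>(1 - R G) ^ M\<close>, where the good set \<open>G\<close> has \<open>R\<close>-probability at least a \<open>\<tau>\<close>-th of its probability
  under \<open>Ru a\<close>.\<close>

lemma covering:
  fixes pU :: "'a pmf" and R :: "'z pmf" and Ru :: "'a \<Rightarrow> 'z pmf" and C :: "'a \<Rightarrow> 'z \<Rightarrow> real"
  assumes fin: "finite (set_pmf pU)" "finite (set_pmf R)" "\<And>a. finite (set_pmf (Ru a))"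
    and C: "\<And>a z. 0 \<le> C a z" "\<And>a z. C a z \<le> K" and "\<tau> > 0" "\<kappa> \<ge> 0" "M > 0"
  obtains z :: "nat \<Rightarrow> 'z" and e :: "'a \<Rightarrow> nat"
  where "\<And>a. e a < M" "\<And>m. m < M \<Longrightarrow> z m \<in> set_pmf R"
    "expct pU (\<lambda>a. C a (z (e a))) \<le>
      \<kappa> + K * (expct pU (\<lambda>a. prob (Ru a) {z. \<not> (C a z \<le> \<kappa> \<and> pmf (Ru a) z \<le> \<tau> * pmf R z)})
        + exp (- real M / \<tau>))"
proof -
  define Z where "Z = Pi_pmf {..<M} undefined (\<lambda>_. R)"
  define G where "G a = {z. C a z \<le> \<kappa> \<and> pmf (Ru a) z \<le> \<tau> * pmf R z}" for a
  \<comment> \<open>If no sample is good the index 0 is returned, a valid message because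
    \<open>M > 0\<close>; the cost is then bounded only by \<open>K\<close>.\<close>
  define e where "e zz a = (if \<exists>m<M. zz m \<in> G a then SOME m. m < M \<and> zz m \<in> G a else 0)" for zz a
  have K: "K \<ge> 0" using C order_trans by blast
  have finZ: "finite (set_pmf Z)" unfolding Z_def using fin by simp
  have e: "e zz a < M" for zz a
    unfolding e_def using \<open>M > 0\<close> by (auto intro: someI2_ex)
  have cost: "C a (zz (e zz a)) \<le> \<kappa> + K * of_bool (zz \<in> ({..<M} \<rightarrow> - G a))" for a zz
  proof (cases "\<exists>m<M. zz m \<in> G a")
    case True
    then have "zz (e zz a) \<in> G a" unfolding e_def by (auto intro: someI2_ex)
    then show ?thesis using K by (auto simp: G_def intro: add_increasing2)
  next
    case False
    then have "zz \<in> ({..<M} \<rightarrow> - G a)" by auto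
    then show ?thesis using C \<open>\<kappa> \<ge> 0\<close> by (simp add: add_increasing)
  qed
  define B where "B = \<kappa> + K * (expct pU (\<lambda>a. prob (Ru a) (- G a)) + exp (- real M / \<tau>))"
  have "expct Z (\<lambda>zz. expct pU (\<lambda>a. C a (zz (e zz a))))
      \<le> expct Z (\<lambda>zz. expct pU (\<lambda>a. \<kappa> + K * of_bool (zz \<in> ({..<M} \<rightarrow> - G a))))"
    using cost fin finZ by (intro expct_mono) auto
  also have "\<dots> = expct pU (\<lambda>a. expct Z (\<lambda>zz. \<kappa> + K * of_bool (zz \<in> ({..<M} \<rightarrow> - G a))))"
    by (rule expct_swap[OF finZ fin(1)])
  also have "\<dots> \<le> expct pU (\<lambda>a. \<kappa> + K * (prob (Ru a) (- G a) + exp (- real M / \<tau>)))"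
  proof (rule expct_mono[OF fin(1)])
    fix a
    define g where "g = prob (Ru a) (G a)"
    \<comment> \<open>Change of measure: on the good set the density of \<open>Ru a\<close> relative
      to \<open>R\<close> is at most \<tau>.\<close>
    have "g \<le> \<tau> * prob R (G a)"
      unfolding g_def using fin \<open>\<tau> > 0\<close> by (intro prob_le_of_density_le) (auto simp: G_def)
    then have g: "g / \<tau> \<le> prob R (G a)" using \<open>\<tau> > 0\<close> by (simp add: field_simps)
    have "expct Z (\<lambda>zz. of_bool (zz \<in> ({..<M} \<rightarrow> - G a))) = prob Z ({..<M} \<rightarrow> - G a)"
      by (rule expct_prob)
    also have "\<dots> = prob R (- G a) ^ M"
      unfolding Z_def by (subst measure_Pi_pmf_Pi) auto
    also have "\<dots> = (1 - prob R (G a)) ^ M"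
      using measure_pmf.prob_compl[of "G a" R] by (simp add: Compl_eq_Diff_UNIV)
    also have "\<dots> \<le> 1 - g + exp (- real M / \<tau>)"
      using g \<open>\<tau> > 0\<close> by (intro power_one_minus_le) (auto simp: g_def)
    also have "1 - g = prob (Ru a) (- G a)"
      using measure_pmf.prob_compl[of "G a" "Ru a"] by (simp add: Compl_eq_Diff_UNIV g_def)
    finally show "expct Z (\<lambda>zz. \<kappa> + K * of_bool (zz \<in> ({..<M} \<rightarrow> - G a)))
        \<le> \<kappa> + K * (prob (Ru a) (- G a) + exp (- real M / \<tau>))"
      using K finZ by (simp add: expct_add mult_left_mono)
  qed
  also have "\<dots> = B"
    using fin by (simp add: B_def expct_add)
  finally obtain zz where "zz \<in> set_pmf Z" "expct pU (\<lambda>a. C a (zz (e zz a))) \<le> B"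
    using expct_le_imp_ex[OF finZ] by blast
  moreover have "zz m \<in> set_pmf R" if "m < M" for m
    using \<open>zz \<in> set_pmf Z\<close> that unfolding Z_def by (auto simp: set_Pi_pmf PiE_dflt_def)
  moreover have "- G a = {z. \<not> (C a z \<le> \<kappa> \<and> pmf (Ru a) z \<le> \<tau> * pmf R z)}" for a by (auto simp: G_def)
  ultimately show ?thesis
    using that[of "e zz" zz] e by (simp add: B_def)
qed

lemma expct_Pi_pmf_component:
  assumes "finite A" "m \<in> A"
  shows "expct (Pi_pmf A d (\<lambda>_. p)) (\<lambda>f. H (f m)) = expct p H"
proof -
  have "expct p H = expct (map_pmf (\<lambda>f. f m) (Pi_pmf A d (\<lambda>_. p))) H"
    using assms by (simp add: Pi_pmf_component)
  then show ?thesis by simp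
qed

lemma expct_Pi_pmf_pair:
  assumes "finite A" "m \<in> A" "m' \<in> A" "m \<noteq> m'" "finite (set_pmf p)"
  shows "expct (Pi_pmf A d (\<lambda>_. p)) (\<lambda>f. H (f m) (f m')) = expct p (\<lambda>x. expct p (H x))"
proof -
  define A' where "A' = A - {m}"
  have A': "A = insert m A'" "m \<notin> A'" "finite A'" "m' \<in> A'" using assms by (auto simp: A'_def)
  have "expct (Pi_pmf A d (\<lambda>_. p)) (\<lambda>f. H (f m) (f m'))
      = expct p (\<lambda>x. expct (Pi_pmf A' d (\<lambda>_. p)) (\<lambda>f. H x (f m')))"
    using A' assms by (simp add: Pi_pmf_insert' expct_bind)
  also have "\<dots> = expct p (\<lambda>x. expct p (H x))"
    using A' by (simp add: expct_Pi_pmf_component)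
  finally show ?thesis .
qed

text \<open>Markov's inequality for the likelihood ratio of \<open>r\<close> to \<open>q\<close>,
  whose mean under \<open>q\<close> is at most 1.\<close>

lemma prob_large_ratio_le:
  fixes q r :: "'c pmf"
  assumes "\<theta> > 0" "finite (set_pmf q)"
  shows "prob q {y. pmf r y > \<theta> * pmf q y} \<le> 1 / \<theta>"
proof -
  have "prob q {y. pmf r y > \<theta> * pmf q y} \<le> 1 / \<theta> * prob r {y. pmf r y > \<theta> * pmf q y}"
    using assms by (intro prob_le_of_density_le) (auto simp: field_simps less_imp_le)
  also have "\<dots> \<le> 1 / \<theta> * 1"
    using assms by (intro mult_left_mono) auto
  finally show ?thesis by simp
qed

text \<open>The decoder accepts a message whose codeword has a likelihood ratio above \<theta>. It
  errs only if the sent codeword fails this test or another one passes it, which has probability at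
  most 1 / \<theta> for each by independence. One codebook has to serve all channel states
  \<open>i\<close> and also keep \<open>F\<close> small, so all these terms are averaged together;
  the law \<open>p\<close> of the message is arbitrary.\<close>

lemma packing:
  fixes pX :: "'b pmf" and ch :: "'b \<Rightarrow> 'i::finite \<Rightarrow> 'c pmf" and p :: "nat pmf" and F :: "'b \<Rightarrow> real"
  defines "q \<equiv> (\<lambda>i. bind_pmf pX (\<lambda>x. ch x i))"
  assumes fin: "finite (set_pmf pX)" "\<And>x i. finite (set_pmf (ch x i))"
    and p: "set_pmf p \<subseteq> {..<M}" and "\<theta> > 0" and "a \<ge> 0"
  obtains x :: "nat \<Rightarrow> 'b" and d :: "'i \<Rightarrow> 'c \<Rightarrow> nat"
  where "\<And>m. m < M \<Longrightarrow> x m \<in> set_pmf pX"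
    "expct p (\<lambda>m. F (x m) + a * (\<Sum>i\<in>UNIV. prob (ch (x m) i) {y. d i y \<noteq> m})) \<le>
      expct pX F + a * (\<Sum>i\<in>UNIV. expct pX (\<lambda>x. prob (ch x i) {y. pmf (ch x i) y \<le> \<theta> * pmf (q i) y})
        + M / \<theta>)"
proof -
  define X where "X = Pi_pmf {..<M} undefined (\<lambda>_. pX)"
  define A where "A x i = {y. pmf (ch x i) y > \<theta> * pmf (q i) y}" for x i
  define d where "d x i y = (SOME m. m < M \<and> y \<in> A (x m) i)" for x :: "nat \<Rightarrow> 'b" and i y
  have finX: "finite (set_pmf X)" unfolding X_def using fin by simp
  have finp: "finite (set_pmf p)" using p finite_subset by blast
  define err where "err x i m = prob (ch (x m) i) (- A (x m) i)
      + (\<Sum>m'\<in>{..<M} - {m}. prob (ch (x m) i) (A (x m') i))" for x i m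
  have err: "prob (ch (x m) i) {y. d x i y \<noteq> m} \<le> err x i m" if "m < M" for x i m
  proof -
    have "{y. d x i y \<noteq> m} \<subseteq> - A (x m) i \<union> (\<Union>m'\<in>{..<M} - {m}. A (x m') i)"
    proof
      fix y assume "y \<in> {y. d x i y \<noteq> m}"
      then have "d x i y \<noteq> m" by simp
      show "y \<in> - A (x m) i \<union> (\<Union>m'\<in>{..<M} - {m}. A (x m') i)"
      proof (cases "y \<in> A (x m) i")
        case True
        then have "d x i y < M \<and> y \<in> A (x (d x i y)) i"
          using someI[of "\<lambda>m. m < M \<and> y \<in> A (x m) i" m] that by (simp add: d_def)
        then show ?thesis using \<open>d x i y \<noteq> m\<close> by blast
      qed simp
    qed
    then have "prob (ch (x m) i) {y. d x i y \<noteq> m}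
      \<le> prob (ch (x m) i) (- A (x m) i \<union> (\<Union>m'\<in>{..<M} - {m}. A (x m') i))"
      by (intro measure_pmf.finite_measure_mono) auto
    also have "\<dots> \<le> prob (ch (x m) i) (- A (x m) i)
        + prob (ch (x m) i) (\<Union>m'\<in>{..<M} - {m}. A (x m') i)"
      by (intro measure_Un_le) auto
    also have "prob (ch (x m) i) (\<Union>m'\<in>{..<M} - {m}. A (x m') i)
        \<le> (\<Sum>m'\<in>{..<M} - {m}. prob (ch (x m) i) (A (x m') i))"
      by (intro measure_UNION_le) auto
    finally show ?thesis by (simp add: err_def)
  qed
  define \<beta> where "\<beta> i = expct pX (\<lambda>x. prob (ch x i) (- A x i))" for i
  have err_mean: "expct X (\<lambda>x. err x i m) \<le> \<beta> i + M / \<theta>" if "m < M" for i m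
  proof -
    have "expct X (\<lambda>x. prob (ch (x m) i) (A (x m') i)) \<le> 1 / \<theta>" if m': "m' \<in> {..<M} - {m}" for m'
    proof -
      have "expct X (\<lambda>x. prob (ch (x m) i) (A (x m') i))
          = expct pX (\<lambda>x. expct pX (\<lambda>x'. prob (ch x i) (A x' i)))"
        unfolding X_def using m' \<open>m < M\<close> fin by (intro expct_Pi_pmf_pair) auto
      \<comment> \<open>With the wrong codeword fixed, averaging over the sent one gives the output
        the law \<open>q i\<close>.\<close>
      also have "\<dots> = expct pX (\<lambda>x'. expct pX (\<lambda>x. prob (ch x i) (A x' i)))"
        by (rule expct_swap) (use fin in auto)
      also have "\<dots> = expct pX (\<lambda>x'. prob (q i) (A x' i))"
        using fin by (simp add: q_def expct_bind flip: expct_prob)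
      also have "\<dots> \<le> expct pX (\<lambda>x'. 1 / \<theta>)"
        using fin \<open>\<theta> > 0\<close> unfolding A_def
        by (intro expct_mono prob_large_ratio_le) (auto simp: q_def)
      finally show ?thesis by simp
    qed
    then have "(\<Sum>m'\<in>{..<M} - {m}. expct X (\<lambda>x. prob (ch (x m) i) (A (x m') i)))
        \<le> real (card ({..<M} - {m})) * (1 / \<theta>)"
      by (rule sum_bounded_above)
    also have "\<dots> \<le> M / \<theta>"
      using \<open>\<theta> > 0\<close> card_mono[of "{..<M}" "{..<M} - {m}"] by (auto simp: field_simps)
    finally show ?thesis
      unfolding err_def using that finX
      by (simp add: expct_add expct_sum)
        (simp add: X_def \<beta>_def expct_Pi_pmf_component[where H = "\<lambda>x. prob (ch x i) (- A x i)"])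
  qed
  let ?cost = "\<lambda>x. expct p (\<lambda>m. F (x m) + a * (\<Sum>i\<in>UNIV. prob (ch (x m) i) {y. d x i y \<noteq> m}))"
  have "expct X ?cost \<le> expct X (\<lambda>x. expct p (\<lambda>m. F (x m) + a * (\<Sum>i\<in>UNIV. err x i m)))"
    using p finp finX \<open>a \<ge> 0\<close>
    by (intro expct_mono add_left_mono mult_left_mono sum_mono err) auto
  also have "\<dots> = expct p (\<lambda>m. expct X (\<lambda>x. F (x m) + a * (\<Sum>i\<in>UNIV. err x i m)))"
    by (rule expct_swap[OF finX finp])
  also have "\<dots> \<le> expct p (\<lambda>m. expct pX F + a * (\<Sum>i\<in>UNIV. \<beta> i + M / \<theta>))"
  proof (rule expct_mono[OF finp])
    fix m assume "m \<in> set_pmf p"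
    then have "m < M" using p by auto
    have "expct X (\<lambda>x. F (x m) + a * (\<Sum>i\<in>UNIV. err x i m))
        = expct pX F + a * (\<Sum>i\<in>UNIV. expct X (\<lambda>x. err x i m))"
      using \<open>m < M\<close> finX by (simp add: expct_add expct_sum) (simp add: X_def expct_Pi_pmf_component)
    also have "\<dots> \<le> expct pX F + a * (\<Sum>i\<in>UNIV. \<beta> i + M / \<theta>)"
      using \<open>m < M\<close> \<open>a \<ge> 0\<close> by (intro add_left_mono mult_left_mono sum_mono err_mean) auto
    finally show "expct X (\<lambda>x. F (x m) + a * (\<Sum>i\<in>UNIV. err x i m))
        \<le> expct pX F + a * (\<Sum>i\<in>UNIV. \<beta> i + M / \<theta>)" .
  qed
  also have "\<dots> = expct pX F + a * (\<Sum>i\<in>UNIV. \<beta> i + M / \<theta>)" by simp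
  finally obtain x where x: "x \<in> set_pmf X" "?cost x \<le> expct pX F + a * (\<Sum>i\<in>UNIV. \<beta> i + M / \<theta>)"
    using expct_le_imp_ex[OF finX] by blast
  show ?thesis
  proof (rule that[of x "d x"])
    show "x m \<in> set_pmf pX" if "m < M" for m
      using x(1) that unfolding X_def by (auto simp: set_Pi_pmf PiE_dflt_def)
    have "- A x i = {y. pmf (ch x i) y \<le> \<theta> * pmf (q i) y}" for x i by (auto simp: A_def)
    then show "?cost x \<le> expct pX F + a * (\<Sum>i\<in>UNIV. expct pX (\<lambda>x. prob (ch x i) {y. pmf (ch x i) y \<le> \<theta> * pmf (q i) y}) + M / \<theta>)"
      using x(2) by (simp add: \<beta>_def)
  qed
qed

section \<open>Concatenation of block codes\<close>

text \<open>The L1 distance times the length: without normalisation it is subadditive under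
  concatenation, so that block costs add up.\<close>

definition discrepancy :: "('a::finite \<Rightarrow> real) \<Rightarrow> 'a list \<Rightarrow> real" where
  "discrepancy f zs = (\<Sum>a\<in>UNIV. \<bar>real (count_list zs a) - real (length zs) * f a\<bar>)"

lemma discrepancy_nonneg [simp]: "discrepancy f zs \<ge> 0"
  by (simp add: discrepancy_def sum_nonneg)

lemma discrepancy_append: "discrepancy f (zs @ zs') \<le> discrepancy f zs + discrepancy f zs'"
  unfolding discrepancy_def sum.distrib[symmetric]
  by (rule sum_mono) (auto simp: algebra_simps)

lemma sum_count_list_UNIV: "(\<Sum>a\<in>UNIV. count_list zs a) = length zs" for zs :: "'a::finite list"
  by (rule sum_count_set) auto

text \<open>This trivial bound is what a wrong reconstruction of a whole block costs.\<close>

lemma discrepancy_le: "discrepancy (pmf P) zs \<le> 2 * length zs"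
proof -
  have "discrepancy (pmf P) zs \<le> (\<Sum>a\<in>UNIV. real (count_list zs a) + real (length zs) * pmf P a)"
    unfolding discrepancy_def
  proof (rule sum_mono)
    fix a
    have "0 \<le> real (length zs) * pmf P a" by simp
    then show "\<bar>real (count_list zs a) - real (length zs) * pmf P a\<bar>
        \<le> real (count_list zs a) + real (length zs) * pmf P a" by linarith
  qed
  also have "\<dots> = real (\<Sum>a\<in>UNIV. count_list zs a) + real (length zs) * (\<Sum>a\<in>UNIV. pmf P a)"
    by (simp add: sum.distrib sum_distrib_left)
  also have "\<dots> = 2 * length zs" by (simp add: sum_count_list_UNIV sum_pmf_eq_1)
  finally show ?thesis .
qed

abbreviation observed :: "'u list \<Rightarrow> 'x list \<Rightarrow> 'y \<Rightarrow> 'y list \<Rightarrow> 'v list \<Rightarrow> ('u \<times> 'x \<times> 'y \<times> 'y \<times> 'v) list" where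
  "observed us xs y ys vs \<equiv> zip us (zip xs (zip (y # ys) (zip ys vs)))"

lemma observed_append:
  assumes "length us = length xs" "length xs = length ys" "length ys = length vs"
  shows "observed (us @ us') (xs @ xs') y (ys @ ys') (vs @ vs') =
    observed us xs y ys vs @ observed us' xs' (last (y # ys)) ys' vs'"
  using assms by (induction us xs ys vs arbitrary: y rule: list_induct4) auto

lemma count_list_eq_sum: "real (count_list zs a) = (\<Sum>i<length zs. of_bool (zs ! i = a))"
  by (induction zs) (auto simp: sum.lessThan_Suc_shift simp del: sum.lessThan_Suc)

lemma l1_dist_empirical:
  assumes "length us = n" "length xs = n" "length ys = n" "length vs = n" "n > 0"
  shows "l1_dist (empirical y0 n (us, xs, ys, vs)) f = discrepancy f (observed us xs y0 ys vs) / n"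
proof -
  have "empirical y0 n (us, xs, ys, vs) a = count_list (observed us xs y0 ys vs) a / n" for a
  proof -
    obtain u x y' y v where a: "a = (u, x, y', y, v)" by (cases a)
    show ?thesis
      using assms unfolding empirical_def a count_list_eq_sum
      by (auto intro!: sum.cong)
  qed
  moreover have "\<bar>c / n - t\<bar> = \<bar>c - n * t\<bar> / n" for c t :: real
  proof -
    have "c / n - t = (c - n * t) / n" using \<open>n > 0\<close> by (simp add: diff_divide_distrib)
    then show ?thesis by simp
  qed
  ultimately show ?thesis
    using assms by (simp add: l1_dist_def discrepancy_def sum_divide_distrib)
qed

text \<open>The components are the codewords; the next message as a function of the current one and
  the source block; the message decoder, which also gets the channel state before the block; and the
  reconstruction from two consecutive messages and the output block.\<close>

type_synonym ('u, 'x, 'y, 'v) block_code =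
  "(nat \<Rightarrow> 'x list) \<times> (nat \<Rightarrow> 'u list \<Rightarrow> nat) \<times> ('y \<Rightarrow> 'y list \<Rightarrow> nat) \<times> (nat \<Rightarrow> nat \<Rightarrow> 'y list \<Rightarrow> 'v list)"

text \<open>In each block the codeword of a message \<open>m\<close> is sent; the source symbols seen during the block
  determine the message of the next block. The reconstruction of a block depends on both messages,
  so the decoder also looks at the next block.\<close>

definition valid_block :: "nat \<Rightarrow> nat \<Rightarrow> ('u, 'x, 'y, 'v) block_code \<Rightarrow> bool" where
  "valid_block n M = (\<lambda>(x, e, d, v). (\<forall>m<M. length (x m) = n) \<and> (\<forall>m us. e m us < M) \<and>
     (\<forall>m m' ys. length ys = n \<longrightarrow> length (v m m' ys) = n))"

primrec chain_encode :: "nat \<Rightarrow> ('u, 'x, 'y, 'v) block_code list \<Rightarrow> nat \<Rightarrow> 'u list \<Rightarrow> 'x list" where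
  "chain_encode n [] m us = map (\<lambda>_. undefined) us"
| "chain_encode n (C # Cs) m us = (case C of (x, e, d, v) \<Rightarrow>
     x m @ chain_encode n Cs (e m (take n us)) (drop n us))"

text \<open>After the last block nothing more is sent, and 0 is an arbitrary guess of the message
  that would describe it.\<close>

primrec first_message :: "nat \<Rightarrow> ('u, 'x, 'y, 'v) block_code list \<Rightarrow> 'y \<Rightarrow> 'y list \<Rightarrow> nat" where
  "first_message n [] y ys = 0"
| "first_message n (C # Cs) y ys = (case C of (x, e, d, v) \<Rightarrow> d y (take n ys))"

primrec chain_decode :: "nat \<Rightarrow> ('u, 'x, 'y, 'v) block_code list \<Rightarrow> 'y \<Rightarrow> 'y list \<Rightarrow> 'v list" where
  "chain_decode n [] y ys = map (\<lambda>_. undefined) ys"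
| "chain_decode n (C # Cs) y ys = (case C of (x, e, d, v) \<Rightarrow>
     let y' = last (y # take n ys) in
     v (d y (take n ys)) (first_message n Cs y' (drop n ys)) (take n ys) @
       chain_decode n Cs y' (drop n ys))"

lemma length_chain_encode:
  assumes "\<forall>C\<in>set Cs. valid_block n M C" "m < M" "length us = length Cs * n + r"
  shows "length (chain_encode n Cs m us) = length us"
  using assms
proof (induction Cs arbitrary: m us)
  case (Cons C Cs)
  obtain x e d v where C: "C = (x, e, d, v)" by (cases C)
  have "length (chain_encode n Cs (e m (take n us)) (drop n us)) = length (drop n us)"
    using Cons.prems by (intro Cons.IH) (auto simp: C valid_block_def)
  then show ?case using Cons.prems by (auto simp: C valid_block_def)
qed simp

lemma length_chain_decode:
  assumes "\<forall>C\<in>set Cs. valid_block n M C" "length ys = length Cs * n + r"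
  shows "length (chain_decode n Cs y ys) = length ys"
  using assms
proof (induction Cs arbitrary: y ys)
  case (Cons C Cs)
  obtain x e d v where C: "C = (x, e, d, v)" by (cases C)
  have "length (chain_decode n Cs (last (y # take n ys)) (drop n ys)) = length (drop n ys)"
    using Cons.prems by (intro Cons.IH) (auto simp: C valid_block_def)
  moreover have "length (take n ys) = n" using Cons.prems by simp
  ultimately show ?case using Cons.prems by (auto simp: C valid_block_def Let_def)
qed simp

text \<open>Within a block the input is read off a codeword fixed at its start, and the message
  depends on complete earlier blocks only.\<close>

lemma chain_encode_causal:
  assumes "\<forall>C\<in>set Cs. valid_block n M C" "m < M"
    and "length us = length us'" "t < length us" "take t us = take t us'"
  shows "chain_encode n Cs m us ! t = chain_encode n Cs m us' ! t"
  using assms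
proof (induction Cs arbitrary: m us us' t)
  case (Cons C Cs)
  obtain x e d v where C: "C = (x, e, d, v)" by (cases C)
  have len: "length (x m) = n" using Cons.prems by (auto simp: C valid_block_def)
  show ?case
  proof (cases "t < n")
    case True
    then show ?thesis by (simp add: C nth_append len)
  next
    case False
    have "take n (take t us) = take n (take t us')" using Cons.prems by simp
    then have tk: "take n us = take n us'" using False by (simp add: min_def split: if_splits)
    have "take (t - n) (drop n us) = take (t - n) (drop n us')"
      using Cons.prems(5) by (simp add: take_drop[of "t - n"] False le_add_diff_inverse2 not_less[symmetric] del: not_less)
    moreover have "e m (take n us) < M" using Cons.prems by (auto simp: C valid_block_def)
    ultimately have "chain_encode n Cs (e m (take n us)) (drop n us) ! (t - n)
        = chain_encode n Cs (e m (take n us)) (drop n us') ! (t - n)"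
      using Cons.prems False by (intro Cons.IH) auto
    then show ?thesis using False by (simp add: C nth_append len tk)
  qed
qed simp

text \<open>The past is padded to length \<open>N\<close> in order to apply the encoder for whole
  words; by causality the symbol at position \<open>t - 1\<close> does not see the padding. The
  first message is 0, as there is no earlier block to describe.\<close>

definition chain_code :: "nat \<Rightarrow> nat \<Rightarrow> 'y \<Rightarrow> ('u, 'x, 'y, 'v) block_code list \<Rightarrow> ('u, 'x, 'y, 'v) code" where
  "chain_code N n y0 Cs =
     ((\<lambda>t us. chain_encode n Cs 0 (us @ replicate (N - length us) undefined) ! (t - 1)),
      chain_decode n Cs y0)"

lemma channel_inputs_chain_code:
  assumes "\<forall>C\<in>set Cs. valid_block n M C" "M > 0" "length us = N" "N = length Cs * n + r"
  shows "channel_inputs (fst (chain_code N n y0 Cs)) us = chain_encode n Cs 0 us"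
proof (rule nth_equalityI)
  have len: "length (chain_encode n Cs 0 us) = N"
    using length_chain_encode[of Cs n M 0 us r] assms by simp
  then show "length (channel_inputs (fst (chain_code N n y0 Cs)) us) = length (chain_encode n Cs 0 us)"
    using assms by (simp add: channel_inputs_def del: upt_Suc)
  fix t assume "t < length (channel_inputs (fst (chain_code N n y0 Cs)) us)"
  then have t: "t < N" using assms by (simp add: channel_inputs_def del: upt_Suc)
  have "channel_inputs (fst (chain_code N n y0 Cs)) us ! t
      = chain_encode n Cs 0 (take t us @ replicate (N - t) undefined) ! t"
    using assms t by (simp add: channel_inputs_def chain_code_def nth_map del: upt_Suc)
  also have "\<dots> = chain_encode n Cs 0 us ! t"
    using assms t by (intro chain_encode_causal[of _ _ M]) auto
  finally show "channel_inputs (fst (chain_code N n y0 Cs)) us ! t = chain_encode n Cs 0 us ! t" .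
qed

lemma channel_outputs_append:
  fixes Wch :: "'x \<Rightarrow> 'y \<Rightarrow> 'y pmf"
  shows "channel_outputs Wch (xs @ xs') y = bind_pmf (channel_outputs Wch xs y) (\<lambda>ys.
     map_pmf (append ys) (channel_outputs Wch xs' (last (y # ys))))"
proof (induction xs arbitrary: y)
  case (Cons x xs)
  have *: "map_pmf (Cons y1) (map_pmf (append ys) q) = map_pmf (append (y1 # ys)) q"
    for y1 :: 'y and ys q
    unfolding pmf.map_comp by (rule arg_cong[of _ _ "\<lambda>f. map_pmf f q"]) auto
  have last: "last (y # y1 # ys) = last (y1 # ys)" for y1 ys by simp
  show ?case
    by (simp only: append_Cons channel_outputs.simps Cons bind_assoc_pmf bind_map_pmf map_bind_pmf * last)
next
  case Nil
  have id: "map_pmf ((@) []) q = q" for q :: "'y list pmf"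
    by (rule trans[OF arg_cong[of _ _ "\<lambda>f. map_pmf f q"] pmf.map_ident]) auto
  show ?case by (simp add: bind_return_pmf id)
qed

lemma length_channel_outputs: "ys \<in> set_pmf (channel_outputs Wch xs y) \<Longrightarrow> length ys = length xs"
  by (induction xs arbitrary: y ys) auto

text \<open>A wrongly decoded message spoils two reconstructions, that of its own block and that of
  the block before, which it describes. Each costs at most 2 n, whence 4 n.\<close>

definition block_cost ::
  "'u::finite pmf \<Rightarrow> ('x::finite \<Rightarrow> 'y::finite \<Rightarrow> 'y pmf) \<Rightarrow> ('u \<times> 'x \<times> 'y \<times> 'y \<times> 'v::finite) pmf \<Rightarrow> nat
    \<Rightarrow> ('u, 'x, 'y, 'v) block_code \<Rightarrow> nat \<Rightarrow> 'y \<Rightarrow> real" where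
  "block_cost PU Wch P n = (\<lambda>(x, e, d, v) m y.
     expct (replicate_pmf n PU) (\<lambda>us. expct (channel_outputs Wch (x m) y) (\<lambda>ys.
       discrepancy (pmf P) (observed us (x m) y ys (v m (e m us) ys)) + 4 * n * of_bool (d y ys \<noteq> m))))"

text \<open>The last term is what a wrong first message costs the preceding block; carrying it along
  makes the cost recursive.\<close>

definition chain_cost ::
  "'u::finite pmf \<Rightarrow> ('x::finite \<Rightarrow> 'y::finite \<Rightarrow> 'y pmf) \<Rightarrow> ('u \<times> 'x \<times> 'y \<times> 'y \<times> 'v::finite) pmf \<Rightarrow> nat \<Rightarrow> nat
    \<Rightarrow> ('u, 'x, 'y, 'v) block_code list \<Rightarrow> nat \<Rightarrow> 'y \<Rightarrow> real" where
  "chain_cost PU Wch P n r Cs m y =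
     expct (replicate_pmf (length Cs * n + r) PU) (\<lambda>us. expct (channel_outputs Wch (chain_encode n Cs m us) y) (\<lambda>ys.
       discrepancy (pmf P) (observed us (chain_encode n Cs m us) y ys (chain_decode n Cs y ys)) +
       2 * n * of_bool (first_message n Cs y ys \<noteq> m)))"

text \<open>The order of the quantifiers matters: the code may depend on the law of message and
  state at the start of the block.\<close>

definition block_codable ::
  "'u::finite pmf \<Rightarrow> ('x::finite \<Rightarrow> 'y::finite \<Rightarrow> 'y pmf) \<Rightarrow> ('u \<times> 'x \<times> 'y \<times> 'y \<times> 'v::finite) pmf
    \<Rightarrow> nat \<Rightarrow> nat \<Rightarrow> real \<Rightarrow> bool" where
  "block_codable PU Wch P n M b \<longleftrightarrow> (\<forall>\<mu>. set_pmf \<mu> \<subseteq> {..<M} \<times> UNIV \<longrightarrow>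
     (\<exists>C. valid_block n M C \<and> expct \<mu> (\<lambda>(m, y). block_cost PU Wch P n C m y) \<le> b))"

lemma expct_mono_state:
  fixes \<mu> :: "(nat \<times> 'y::finite) pmf"
  assumes \<mu>: "set_pmf \<mu> \<subseteq> {..<M} \<times> UNIV" and le: "\<And>m y. m < M \<Longrightarrow> F m y \<le> G m y"
  shows "expct \<mu> (\<lambda>(m, y). F m y) \<le> expct \<mu> (\<lambda>(m, y). G m y)"
  using finite_subset[OF \<mu>] \<mu> by (intro expct_mono) (auto intro!: le)

lemma length_replicate_pmf: "us \<in> set_pmf (replicate_pmf n p) \<Longrightarrow> length us = n"
  by (simp add: set_replicate_pmf)

lemma chain_cost_Cons:
  fixes PU :: "'u::finite pmf" and Wch :: "'x::finite \<Rightarrow> 'y::finite \<Rightarrow> 'y pmf"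
    and P :: "('u \<times> 'x \<times> 'y \<times> 'y \<times> 'v::finite) pmf"
  assumes C: "valid_block n M (x, e, d, v)" and Cs: "\<forall>C\<in>set Cs. valid_block n M C" and m: "m < M"
  shows "chain_cost PU Wch P n r ((x, e, d, v) # Cs) m y \<le> block_cost PU Wch P n (x, e, d, v) m y +
    expct (replicate_pmf n PU) (\<lambda>us. expct (channel_outputs Wch (x m) y) (\<lambda>ys.
      chain_cost PU Wch P n r Cs (e m us) (last (y # ys))))"
proof -
  define k where "k = length Cs * n + r"
  let ?enc = "\<lambda>us us'. chain_encode n Cs (e m us) us'"
  let ?A = "\<lambda>us ys. discrepancy (pmf P) (observed us (x m) y ys (v m (e m us) ys)) + 4 * n * of_bool (d y ys \<noteq> m)"
  let ?B = "\<lambda>us ys us' ys'. discrepancy (pmf P) (observed us' (?enc us us') (last (y # ys)) ys' (chain_decode n Cs (last (y # ys)) ys')) +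
       2 * n * of_bool (first_message n Cs (last (y # ys)) ys' \<noteq> e m us)"
  let ?F = "\<lambda>us ys us' ys'.
       discrepancy (pmf P) (observed (us @ us') (x m @ ?enc us us') y (ys @ ys') (chain_decode n ((x,e,d,v) # Cs) y (ys @ ys'))) +
       2 * n * of_bool (first_message n ((x,e,d,v) # Cs) y (ys @ ys') \<noteq> m)"
  have lx: "length (x m) = n" using C m by (auto simp: valid_block_def)
  have "chain_cost PU Wch P n r ((x, e, d, v) # Cs) m y =
    expct (replicate_pmf n PU) (\<lambda>us. expct (replicate_pmf k PU) (\<lambda>us'.
      expct (channel_outputs Wch (x m) y) (\<lambda>ys. expct (channel_outputs Wch (?enc us us') (last (y # ys))) (\<lambda>ys'.
        ?F us ys us' ys'))))"
  proof -
    have "length ((x, e, d, v) # Cs) * n + r = n + k" by (simp add: k_def)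
    then show ?thesis
      unfolding chain_cost_def
      by (simp only: replicate_pmf_distrib)
        (auto simp: expct_bind channel_outputs_append length_replicate_pmf intro!: expct_cong)
  qed
  also have "\<dots> \<le> expct (replicate_pmf n PU) (\<lambda>us. expct (replicate_pmf k PU) (\<lambda>us'.
      expct (channel_outputs Wch (x m) y) (\<lambda>ys. expct (channel_outputs Wch (?enc us us') (last (y # ys))) (\<lambda>ys'.
        ?A us ys + ?B us ys us' ys'))))"
  proof (intro expct_mono finite_set_replicate_pmf finite_set_channel_outputs)
    fix us us' ys ys'
    assume "us \<in> set_pmf (replicate_pmf n PU)" "us' \<in> set_pmf (replicate_pmf k PU)"
      and ys: "ys \<in> set_pmf (channel_outputs Wch (x m) y)"
      and ys': "ys' \<in> set_pmf (channel_outputs Wch (?enc us us') (last (y # ys)))"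
    then have len: "length us = n" "length us' = k" "length ys = n"
      by (auto simp: length_replicate_pmf lx length_channel_outputs)
    have lenc: "length (?enc us us') = k"
      using length_chain_encode[OF Cs, of "e m us" us' r] C len by (auto simp: valid_block_def k_def)
    have len': "length ys' = k" using length_channel_outputs[OF ys'] lenc by simp
    define m1 where "m1 = d y ys"
    define y1 where "y1 = last (y # ys)"
    define m2 where "m2 = first_message n Cs y1 ys'"
    have lv: "length (v a b ys) = n" for a b using C len by (auto simp: valid_block_def)
    have "discrepancy (pmf P) (observed (us @ us') (x m @ ?enc us us') y (ys @ ys') (v m1 m2 ys @ chain_decode n Cs y1 ys'))
        \<le> discrepancy (pmf P) (observed us (x m) y ys (v m1 m2 ys))
          + discrepancy (pmf P) (observed us' (?enc us us') y1 ys' (chain_decode n Cs y1 ys'))"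
      using len lv lx by (subst observed_append) (auto simp: y1_def intro!: discrepancy_append)
    \<comment> \<open>If both messages are decoded correctly the reconstruction is the intended one;
      otherwise the trivial bound 2 n applies. The error of the second message is charged to the
      remaining chain.\<close>
    moreover have "discrepancy (pmf P) (observed us (x m) y ys (v m1 m2 ys)) \<le>
        discrepancy (pmf P) (observed us (x m) y ys (v m (e m us) ys)) +
        2 * n * of_bool (m1 \<noteq> m) + 2 * n * of_bool (m2 \<noteq> e m us)"
    proof (cases "m1 = m \<and> m2 = e m us")
      case False
      have "discrepancy (pmf P) (observed us (x m) y ys (v m1 m2 ys)) \<le> 2 * n"
        using discrepancy_le[of P "observed us (x m) y ys (v m1 m2 ys)"] len lx lv by simp
      then show ?thesis using False discrepancy_nonneg[of "pmf P" "observed us (x m) y ys (v m (e m us) ys)"]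
        by (auto simp: add_increasing)
    qed simp
    ultimately show "?F us ys us' ys' \<le> ?A us ys + ?B us ys us' ys'"
      using len by (simp add: Let_def m1_def m2_def y1_def)
  qed
  also have "\<dots> = expct (replicate_pmf n PU) (\<lambda>us. expct (channel_outputs Wch (x m) y) (\<lambda>ys.
      expct (replicate_pmf k PU) (\<lambda>us'. expct (channel_outputs Wch (?enc us us') (last (y # ys))) (\<lambda>ys'.
        ?A us ys + ?B us ys us' ys'))))"
    by (intro expct_cong expct_swap) auto
  also have "\<dots> = expct (replicate_pmf n PU) (\<lambda>us. expct (channel_outputs Wch (x m) y) (\<lambda>ys.
      ?A us ys + chain_cost PU Wch P n r Cs (e m us) (last (y # ys))))"
    by (simp only: expct_add finite_set_replicate_pmf finite_set_channel_outputs chain_cost_def k_def) simp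
  also have "\<dots> = block_cost PU Wch P n (x, e, d, v) m y +
    expct (replicate_pmf n PU) (\<lambda>us. expct (channel_outputs Wch (x m) y) (\<lambda>ys.
      chain_cost PU Wch P n r Cs (e m us) (last (y # ys))))"
    by (simp only: expct_add[of "channel_outputs Wch (x m) y" "?A _"] expct_add[of "replicate_pmf n PU"]
          finite_set_replicate_pmf finite_set_channel_outputs block_cost_def prod.case)
  finally show ?thesis .
qed

text \<open>The block codes are chosen one after the other: the codes chosen so far determine the law of
  the message and of the channel state at the start of the next block.\<close>

lemma chain_exists:
  fixes PU :: "'u::finite pmf" and Wch :: "'x::finite \<Rightarrow> 'y::finite \<Rightarrow> 'y pmf"
    and P :: "('u \<times> 'x \<times> 'y \<times> 'y \<times> 'v::finite) pmf"
  assumes block: "block_codable PU Wch P n M (real n * \<kappa>)"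
    and \<mu>: "set_pmf \<mu> \<subseteq> {..<M} \<times> UNIV"
  shows "\<exists>Cs. length Cs = B \<and> (\<forall>C\<in>set Cs. valid_block n M C) \<and>
    expct \<mu> (\<lambda>(m, y). chain_cost PU Wch P n r Cs m y) \<le> real B * (real n * \<kappa>) + 2 * real r + 2 * real n"
  using \<mu>
proof (induction B arbitrary: \<mu>)
  case 0
  \<comment> \<open>What remains are the \<open>r\<close> left-over symbols, at most 2 r, and the
    guessed message of the last block, at most 2 n.\<close>
  have "chain_cost PU Wch P n r [] m y \<le> 2 * r + 2 * n" for m y
  proof -
    have "chain_cost PU Wch P n r [] m y = expct (replicate_pmf r PU) (\<lambda>us.
        expct (channel_outputs Wch (map (\<lambda>_. undefined) us) y) (\<lambda>ys.
          discrepancy (pmf P) (observed us (map (\<lambda>_. undefined) us) y ys (map (\<lambda>_. undefined) ys)) +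
          real (2 * n * of_bool (0 \<noteq> m))))"
      by (simp add: chain_cost_def)
    also have "\<dots> \<le> expct (replicate_pmf r PU) (\<lambda>us.
        expct (channel_outputs Wch (map (\<lambda>_. undefined) us) y) (\<lambda>ys. real (2 * r) + real (2 * n)))"
    proof (intro expct_mono finite_set_replicate_pmf finite_set_channel_outputs add_mono)
      fix us ys
      assume "us \<in> set_pmf (replicate_pmf r PU)"
      then have "length us = r" by (simp add: length_replicate_pmf)
      then show "discrepancy (pmf P) (observed us (map (\<lambda>_. undefined) us) y ys (map (\<lambda>_. undefined) ys)) \<le> real (2 * r)"
        using discrepancy_le[of P "observed us (map (\<lambda>_. undefined) us) y ys (map (\<lambda>_. undefined) ys)"]
        by (elim order_trans) auto
    qed auto
    finally show ?thesis by simp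
  qed
  then have "expct \<mu> (\<lambda>(m, y). chain_cost PU Wch P n r [] m y) \<le> expct \<mu> (\<lambda>_. 2 * r + 2 * n)"
    using finite_subset[OF 0] by (intro expct_mono) auto
  then show ?case by (intro exI[of _ "[]"]) auto
next
  case (Suc B)
  have fin: "finite (set_pmf \<mu>)" using finite_subset[OF Suc.prems] by simp
  obtain C where C: "valid_block n M C" "expct \<mu> (\<lambda>(m, y). block_cost PU Wch P n C m y) \<le> real n * \<kappa>"
    using block Suc.prems unfolding block_codable_def by blast
  obtain x e d v where Ceq: "C = (x, e, d, v)" by (cases C)
  define \<mu>' where "\<mu>' = bind_pmf \<mu> (\<lambda>(m, y). bind_pmf (replicate_pmf n PU) (\<lambda>us.
      map_pmf (\<lambda>ys. (e m us, last (y # ys))) (channel_outputs Wch (x m) y)))"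
  have "set_pmf \<mu>' \<subseteq> {..<M} \<times> UNIV" using C(1) by (auto simp: \<mu>'_def Ceq valid_block_def)
  from Suc.IH[OF this] obtain Cs where Cs: "length Cs = B" "\<forall>C\<in>set Cs. valid_block n M C"
    "expct \<mu>' (\<lambda>(m, y). chain_cost PU Wch P n r Cs m y) \<le> real B * (real n * \<kappa>) + 2 * real r + 2 * real n" by blast
  have "expct \<mu>' (\<lambda>(m, y). chain_cost PU Wch P n r Cs m y) = expct \<mu> (\<lambda>(m, y).
      expct (replicate_pmf n PU) (\<lambda>us. expct (channel_outputs Wch (x m) y) (\<lambda>ys.
      chain_cost PU Wch P n r Cs (e m us) (last (y # ys)))))"
    unfolding \<mu>'_def using fin
    by (subst expct_bind) (auto simp: expct_bind case_prod_unfold)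
  moreover have "expct \<mu> (\<lambda>(m, y). chain_cost PU Wch P n r (C # Cs) m y) \<le>
     expct \<mu> (\<lambda>(m, y). block_cost PU Wch P n C m y + expct (replicate_pmf n PU) (\<lambda>us.
      expct (channel_outputs Wch (x m) y) (\<lambda>ys. chain_cost PU Wch P n r Cs (e m us) (last (y # ys)))))"
    unfolding Ceq by (rule expct_mono_state[OF Suc.prems chain_cost_Cons[OF C(1)[unfolded Ceq] Cs(2)]])
  ultimately have "expct \<mu> (\<lambda>(m, y). chain_cost PU Wch P n r (C # Cs) m y)
      \<le> n * \<kappa> + (B * (n * \<kappa>) + 2 * r + 2 * n)"
    using C(2) Cs(3) fin by (simp add: case_prod_unfold expct_add)
  then show ?case
    using C(1) Cs(1,2) by (intro exI[of _ "C # Cs"]) (auto simp: algebra_simps)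
qed

lemma expct_markov:
  assumes "finite (set_pmf p)" "\<And>a. a \<in> set_pmf p \<Longrightarrow> f a \<ge> 0" "\<epsilon> > 0"
  shows "prob p {a. f a \<ge> \<epsilon>} \<le> expct p f / \<epsilon>"
proof -
  have "prob p {a. f a \<ge> \<epsilon>} = expct p (\<lambda>a. of_bool (f a \<ge> \<epsilon>))"
    by (simp add: expct_of_bool)
  also have "\<dots> \<le> expct p (\<lambda>a. f a / \<epsilon>)"
    using assms by (intro expct_mono) auto
  finally show ?thesis by simp
qed

lemma achievable_by_blocks:
  fixes PU :: "'u::finite pmf" and Wch :: "'x::finite \<Rightarrow> 'y::finite \<Rightarrow> 'y pmf"
    and P :: "('u \<times> 'x \<times> 'y \<times> 'y \<times> 'v::finite) pmf"
  assumes block: "\<And>\<kappa>. \<kappa> > 0 \<Longrightarrow> \<exists>n>0. \<exists>M>0. block_codable PU Wch P n M (real n * \<kappa>)"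
  shows "achievable PU Wch y0 P"
  unfolding achievable_def
proof (intro allI impI)
  fix \<epsilon> :: real assume "\<epsilon> > 0"
  \<comment> \<open>The expected distance will be at most 2 \<kappa> = \<epsilon>^2, so that
    Markov's inequality leaves \<epsilon>.\<close>
  define \<kappa> where "\<kappa> = \<epsilon>\<^sup>2 / 2"
  have "\<kappa> > 0" using \<open>\<epsilon> > 0\<close> by (simp add: \<kappa>_def)
  from block[OF this] obtain n M where n: "n > 0" and M: "M > (0::nat)"
    and blk: "block_codable PU Wch P n M (real n * \<kappa>)" by blast
  \<comment> \<open>Left-over symbols and the last block cost at most 4 n in all, which is at most
    \<kappa> N from \<open>N0\<close> on.\<close>
  define N0 where "N0 = Suc (nat \<lceil>4 * n / \<kappa>\<rceil>)"
  show "\<exists>N0. \<forall>N\<ge>N0. \<exists>c\<in>codes N. prob (induced_pmf PU Wch y0 N c)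
      {s. \<epsilon> \<le> l1_dist (empirical y0 N s) (pmf P)} \<le> \<epsilon>"
  proof (intro exI[of _ N0] allI impI)
    fix N assume "N \<ge> N0"
    then have N: "N > 0" "4 * n / \<kappa> \<le> N" unfolding N0_def by linarith+
    define B where "B = N div n"
    define r where "r = N mod n"
    have Nr: "N = B * n + r" "r < n" using n by (auto simp: B_def r_def)
    obtain Cs where Cs: "length Cs = B" "\<forall>C\<in>set Cs. valid_block n M C"
      "expct (return_pmf (0, y0)) (\<lambda>(m, y). chain_cost PU Wch P n r Cs m y) \<le> real B * (real n * \<kappa>) + 2 * real r + 2 * real n"
      using chain_exists[OF blk, of "return_pmf (0, y0)" B r] M by auto
    define c where "c = chain_code N n y0 Cs"
    have inputs: "channel_inputs (fst c) us = chain_encode n Cs 0 us" if "length us = N" for us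
      unfolding c_def using that Cs(1) Nr by (intro channel_inputs_chain_code[OF Cs(2) M]) auto
    have g: "snd c = chain_decode n Cs y0" by (simp add: c_def chain_code_def)
    let ?cost = "\<lambda>us ys. discrepancy (pmf P) (observed us (chain_encode n Cs 0 us) y0 ys (chain_decode n Cs y0 ys)) +
         2 * n * of_bool (first_message n Cs y0 ys \<noteq> 0)"
    have fin: "finite (set_pmf (induced_pmf PU Wch y0 N c))"
      by (simp add: induced_pmf_def case_prod_unfold)
    have "expct (induced_pmf PU Wch y0 N c) (\<lambda>s. l1_dist (empirical y0 N s) (pmf P))
      = expct (replicate_pmf N PU) (\<lambda>us. expct (channel_outputs Wch (channel_inputs (fst c) us) y0) (\<lambda>ys.
          l1_dist (empirical y0 N (us, channel_inputs (fst c) us, ys, snd c ys)) (pmf P)))"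
      by (simp add: induced_pmf_def case_prod_unfold expct_bind)
    also have "\<dots> \<le> expct (replicate_pmf N PU) (\<lambda>us. expct (channel_outputs Wch (chain_encode n Cs 0 us) y0) (\<lambda>ys.
        ?cost us ys / N))"
    proof (rule expct_mono)
      fix us assume "us \<in> set_pmf (replicate_pmf N PU)"
      then have lus: "length us = N" by (simp add: length_replicate_pmf)
      have lxs: "length (chain_encode n Cs 0 us) = N"
        using length_chain_encode[OF Cs(2) M, of us r] lus Cs(1) Nr by simp
      show "expct (channel_outputs Wch (channel_inputs (fst c) us) y0) (\<lambda>ys.
          l1_dist (empirical y0 N (us, channel_inputs (fst c) us, ys, snd c ys)) (pmf P)) \<le>
        expct (channel_outputs Wch (chain_encode n Cs 0 us) y0) (\<lambda>ys.
        ?cost us ys / N)"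
        unfolding inputs[OF lus] g
      proof (rule expct_mono)
        fix ys assume "ys \<in> set_pmf (channel_outputs Wch (chain_encode n Cs 0 us) y0)"
        then have lys: "length ys = N" using lxs by (simp add: length_channel_outputs)
        then have "length (chain_decode n Cs y0 ys) = N"
          using length_chain_decode[OF Cs(2), of ys r y0] Cs(1) Nr by simp
        then show "l1_dist (empirical y0 N (us, chain_encode n Cs 0 us, ys, chain_decode n Cs y0 ys)) (pmf P)
           \<le> ?cost us ys / N"
          using lus lxs lys N by (subst l1_dist_empirical) (auto simp: divide_right_mono)
      qed simp
    qed simp
    also have "\<dots> = chain_cost PU Wch P n r Cs 0 y0 / N"
      by (simp add: chain_cost_def Cs(1) flip: Nr(1))
    also have "\<dots> \<le> (N * \<kappa> + 4 * n) / N"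
    proof -
      have "real (B * n) * \<kappa> \<le> N * \<kappa>" using Nr \<open>\<kappa> > 0\<close> by (intro mult_right_mono) auto
      then have "B * (n * \<kappa>) + 2 * r + 2 * n \<le> N * \<kappa> + 4 * n" using Nr(2) by (simp add: mult.assoc)
      then show ?thesis using Cs(3) by (intro divide_right_mono) auto
    qed
    also have "\<dots> = \<kappa> + 4 * n / N" using N by (simp add: field_simps)
    also have "4 * n / N \<le> \<kappa>" using N \<open>\<kappa> > 0\<close> by (simp add: field_simps)
    finally have "expct (induced_pmf PU Wch y0 N c) (\<lambda>s. l1_dist (empirical y0 N s) (pmf P)) \<le> \<epsilon>\<^sup>2"
      by (simp add: \<kappa>_def)
    then have "expct (induced_pmf PU Wch y0 N c) (\<lambda>s. l1_dist (empirical y0 N s) (pmf P)) / \<epsilon> \<le> \<epsilon>\<^sup>2 / \<epsilon>"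
      using \<open>\<epsilon> > 0\<close> by (intro divide_right_mono) auto
    moreover have "prob (induced_pmf PU Wch y0 N c) {s. \<epsilon> \<le> l1_dist (empirical y0 N s) (pmf P)}
        \<le> expct (induced_pmf PU Wch y0 N c) (\<lambda>s. l1_dist (empirical y0 N s) (pmf P)) / \<epsilon>"
      using \<open>\<epsilon> > 0\<close> by (intro expct_markov fin) (auto simp: l1_dist_def sum_nonneg)
    ultimately have "prob (induced_pmf PU Wch y0 N c) {s. \<epsilon> \<le> l1_dist (empirical y0 N s) (pmf P)} \<le> \<epsilon>\<^sup>2 / \<epsilon>"
      by linarith
    moreover have "c \<in> codes N"
      using length_chain_decode[OF Cs(2), where r = r] Cs(1) Nr by (auto simp: codes_def c_def chain_code_def)
    ultimately show "\<exists>c\<in>codes N. prob (induced_pmf PU Wch y0 N c)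
      {s. \<epsilon> \<le> l1_dist (empirical y0 N s) (pmf P)} \<le> \<epsilon>"
      using \<open>\<epsilon> > 0\<close> by (intro bexI[of _ c]) (auto simp: power2_eq_square)
  qed
qed

section \<open>Random block codes\<close>

text \<open>With t = q / p the divergence is the mean of t - 1 - ln t, which is nonnegative and
  vanishes only at t = 1, plus the mass that \<open>q\<close> puts outside the support of
  \<open>p\<close>. The second part is the equality case.\<close>

lemma gibbs_inequality:
  assumes fin: "finite (set_pmf p)" and sub: "set_pmf p \<subseteq> set_pmf q"
  shows "expct p (\<lambda>a. ln (pmf p a / pmf q a)) \<ge> 0"
    and "expct p (\<lambda>a. ln (pmf p a / pmf q a)) \<le> 0 \<Longrightarrow> p = q"
proof -
  let ?D = "expct p (\<lambda>a. ln (pmf p a / pmf q a))"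
  let ?t = "\<lambda>a. pmf q a / pmf p a"
  have pos: "pmf p a > 0" "pmf q a > 0" if "a \<in> set_pmf p" for a
    using that sub by (auto simp: pmf_positive_iff)
  have "?D = (\<Sum>a\<in>set_pmf p. - ln (?t a) * pmf p a)"
    using fin pos by (subst integral_measure_pmf_real[where A="set_pmf p"])
      (auto simp: ln_div algebra_simps intro!: sum.cong)
  moreover have "(\<Sum>a\<in>set_pmf p. (?t a - 1) * pmf p a) = (\<Sum>a\<in>set_pmf p. pmf q a) - 1"
  proof -
    have "(\<Sum>a\<in>set_pmf p. (?t a - 1) * pmf p a) = (\<Sum>a\<in>set_pmf p. pmf q a - pmf p a)"
    proof (intro sum.cong refl)
      fix a assume "a \<in> set_pmf p"
      then have "pmf p a \<noteq> 0" using pos by force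
      then show "(?t a - 1) * pmf p a = pmf q a - pmf p a" by (simp add: left_diff_distrib)
    qed
    then show ?thesis using fin sum_pmf_eq_1[of "set_pmf p" p] by (simp add: sum_subtractf)
  qed
  ultimately have D: "?D = (\<Sum>a\<in>set_pmf p. (?t a - 1 - ln (?t a)) * pmf p a) + (1 - (\<Sum>a\<in>set_pmf p. pmf q a))"
    by (simp add: left_diff_distrib sum_subtractf sum_negf)
  have nn: "(?t a - 1 - ln (?t a)) * pmf p a \<ge> 0" if "a \<in> set_pmf p" for a
    using pos[OF that] ln_le_minus_one[of "?t a"] by (intro mult_nonneg_nonneg) auto
  have q: "(\<Sum>a\<in>set_pmf p. pmf q a) \<le> 1"
    using measure_pmf.prob_le_1[of q "set_pmf p"] fin by (simp add: measure_measure_pmf_finite)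
  have nns: "(\<Sum>a\<in>set_pmf p. (?t a - 1 - ln (?t a)) * pmf p a) \<ge> 0" using nn by (rule sum_nonneg)
  then show "?D \<ge> 0" using D q by linarith
  assume "?D \<le> 0"
  then have zero: "(\<Sum>a\<in>set_pmf p. (?t a - 1 - ln (?t a)) * pmf p a) = 0"
    and q1: "(\<Sum>a\<in>set_pmf p. pmf q a) = 1" using D q nns by linarith+
  show "p = q"
  proof (rule pmf_eqI)
    fix a
    show "pmf p a = pmf q a"
    proof (cases "a \<in> set_pmf p")
      case True
      then have "(?t a - 1 - ln (?t a)) * pmf p a = 0"
        using zero nn fin by (subst (asm) sum_nonneg_eq_0_iff) auto
      then have "ln (?t a) = ?t a - 1" using pos[OF True] by simp
      then have "?t a = 1" using pos[OF True] by (intro ln_eq_minus_one) auto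
      then show ?thesis using pos[OF True] by simp
    next
      case False
      have "(\<Sum>b\<in>insert a (set_pmf p). pmf q b) \<le> 1"
        using measure_pmf.prob_le_1[of q "insert a (set_pmf p)"] fin by (simp add: measure_measure_pmf_finite)
      then have "pmf q a \<le> 0" using False fin q1 by simp
      then show ?thesis using False by (simp add: set_pmf_iff)
    qed
  qed
qed

lemma pmf_bind_map_Cons:
  "pmf (bind_pmf p (\<lambda>b. map_pmf (Cons b) (q b))) (b # bs) = pmf p b * pmf (q b) bs"
proof -
  have "pmf (map_pmf (Cons c) (q c)) (b # bs) = indicator {b} c * pmf (q b) bs" for c
    by (cases "c = b") (auto simp: pmf_map_inj' pmf_eq_0_set_pmf)
  then show ?thesis
    by (simp add: pmf_bind measure_pmf_single)
qed

primrec path_law :: "('s \<Rightarrow> 's pmf) \<Rightarrow> nat \<Rightarrow> 's \<Rightarrow> 's list pmf" where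
  "path_law T 0 y = return_pmf []"
| "path_law T (Suc n) y = bind_pmf (T y) (\<lambda>y1. map_pmf (Cons y1) (path_law T n y1))"

text \<open>The output law in the packing bound is thus again a product of one-step probabilities,
  and its likelihood ratio to the channel a product over letters.\<close>

lemma channel_output_law:
  "bind_pmf (replicate_pmf n PX) (\<lambda>xs. channel_outputs Wch xs y) = path_law (averaged_chain Wch PX) n y"
proof (induction n arbitrary: y)
  case (Suc n)
  have "bind_pmf (replicate_pmf (Suc n) PX) (\<lambda>xs. channel_outputs Wch xs y)
    = bind_pmf PX (\<lambda>x. bind_pmf (replicate_pmf n PX) (\<lambda>xs. bind_pmf (Wch x y) (\<lambda>y1.
        map_pmf (Cons y1) (channel_outputs Wch xs y1))))"
    by (simp add: bind_assoc_pmf bind_return_pmf)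
  also have "\<dots> = bind_pmf PX (\<lambda>x. bind_pmf (Wch x y) (\<lambda>y1. bind_pmf (replicate_pmf n PX) (\<lambda>xs.
        map_pmf (Cons y1) (channel_outputs Wch xs y1))))"
    by (intro bind_pmf_cong_UNIV) (rule bind_commute_pmf)
  also have "\<dots> = path_law (averaged_chain Wch PX) (Suc n) y"
    by (simp add: averaged_chain_def bind_assoc_pmf flip: map_bind_pmf Suc)
  finally show ?case .
qed (simp add: bind_return_pmf)

definition observe :: "'u \<times> 'x \<times> ('y \<Rightarrow> 'v) \<times> 'y \<times> 'y \<Rightarrow> 'u \<times> 'x \<times> 'y \<times> 'y \<times> 'v" where
  "observe = (\<lambda>(u, x, s, y', y). (u, x, y', y, s y))"

lemma observed_eq_map_observe:
  assumes "length us = length xs" "length xs = length ss" "length ss = length ys"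
  shows "observed us xs y ys (map2 (\<lambda>s. s) ss ys) = map observe (zip5 us xs ss y ys)"
  using assms by (induction us xs ss ys arbitrary: y rule: list_induct4) (auto simp: observe_def)

lemma count_list_map: "real (count_list (map f zs) a) = sum_list (map (\<lambda>z. of_bool (f z = a)) zs)"
  by (induction zs) auto

locale coding_setup =
  fixes PU :: "'u::finite pmf" and PX :: "'x::finite pmf" and PS :: "'u \<Rightarrow> 'x \<Rightarrow> ('y::finite \<Rightarrow> 'v::finite) pmf"
    and Wch :: "'x \<Rightarrow> 'y \<Rightarrow> 'y pmf" and \<pi> :: "'y pmf"
  assumes unique_class: "\<And>C D. recurrent_class (averaged_chain Wch PX) C \<Longrightarrow>
      recurrent_class (averaged_chain Wch PX) D \<Longrightarrow> C = D"
    and invariant: "bind_pmf \<pi> (averaged_chain Wch PX) = \<pi>"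
begin

abbreviation J where "J \<equiv> letter_law PU PX PS Wch"
abbreviation T where "T \<equiv> averaged_chain Wch PX"
abbreviation traj where "traj \<equiv> trajectory J last_state"
abbreviation chan where "chan \<equiv> channel_outputs Wch"
abbreviation avg_XU where
  "avg_XU n F \<equiv> expct (replicate_pmf n PX) (\<lambda>xs. expct (replicate_pmf n PU) (F xs))"
abbreviation cost where "cost \<equiv> block_cost PU Wch"

definition stat_mean :: "('u \<times> 'x \<times> ('y \<Rightarrow> 'v) \<times> 'y \<times> 'y \<Rightarrow> real) \<Rightarrow> real" where
  "stat_mean f = expct \<pi> (\<lambda>y. expct (J y) f)"

definition target where "target = bind_pmf \<pi> (\<lambda>y. map_pmf observe (J y))"

text \<open>As U and X are independent, this is the law of S given X = x.\<close>

definition PSX where "PSX x = bind_pmf PU (\<lambda>u. PS u x)"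

definition cover_density where
  "cover_density = (\<lambda>(u, x, s, y' :: 'y, y :: 'y). ln (pmf (PS u x) s / pmf (PSX x) s))"

definition channel_density where
  "channel_density = (\<lambda>(u :: 'u, x, s :: 'y \<Rightarrow> 'v, y', y). ln (pmf (Wch x y') y / pmf (T y') y))"

text \<open>In nats, \<open>Ic\<close> is I(U;S|X) and \<open>Im\<close> is I(X;Y|Y') under the
  stationary letter law.\<close>

definition Ic where "Ic = stat_mean cover_density"
definition Im where "Im = stat_mean channel_density"

lemma map_last_state: "map_pmf last_state (J y) = T y"
  by (simp add: letter_law_def averaged_chain_def map_bind_pmf pmf.map_comp o_def pmf.map_ident)

section \<open>Laws of large numbers for the costs and information densities of a block\<close>

lemma lln:
  obtains c where "c \<ge> 0" "\<And>n y. expct (traj n y)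
     (\<lambda>zs. \<bar>sum_list (map f zs) - n * stat_mean f\<bar>) \<le> c * (sqrt n + 1)"
proof -
  have inv: "bind_pmf \<pi> (\<lambda>y. map_pmf last_state (J y)) = \<pi>"
    unfolding map_last_state by (rule invariant)
  have uniq: "\<And>C D. recurrent_class (\<lambda>y. map_pmf last_state (J y)) C \<Longrightarrow>
    recurrent_class (\<lambda>y. map_pmf last_state (J y)) D \<Longrightarrow> C = D"
    unfolding map_last_state by (rule unique_class)
  have "\<exists>c. \<forall>n y. expct (traj n y)
     (\<lambda>zs. \<bar>sum_list (map f zs) - n * stat_mean f\<bar>) \<le> c * (sqrt n + 1)"
    unfolding stat_mean_def
  proof (rule trajectory_lln[OF uniq inv, of f])
    fix c
    assume *: "\<And>n y. expct (traj n y)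
      (\<lambda>zs. \<bar>sum_list (map f zs) - n * expct \<pi> (\<lambda>y. expct (J y) f)\<bar>) \<le> c * (sqrt n + 1)"
    show "\<exists>c. \<forall>n y. expct (traj n y)
      (\<lambda>zs. \<bar>sum_list (map f zs) - n * expct \<pi> (\<lambda>y. expct (J y) f)\<bar>) \<le> c * (sqrt n + 1)"
      by (intro exI allI) (rule *)
  qed
  then obtain c where c: "\<And>n y. expct (traj n y)
     (\<lambda>zs. \<bar>sum_list (map f zs) - n * stat_mean f\<bar>) \<le> c * (sqrt n + 1)" by blast
  show ?thesis
  proof (rule that[of "max c 0"])
    show "expct (traj n y)
     (\<lambda>zs. \<bar>sum_list (map f zs) - n * stat_mean f\<bar>) \<le> max c 0 * (sqrt n + 1)" for n y
      by (rule order_trans[OF c mult_right_mono]) auto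
  qed simp
qed

lemma lln_discrepancy:
  obtains c where "c \<ge> 0" "\<And>n y. expct (traj n y)
     (\<lambda>zs. discrepancy (pmf target) (map observe zs)) \<le> c * (sqrt n + 1)"
proof -
  have "\<exists>c\<ge>0. \<forall>n y. expct (traj n y)
     (\<lambda>zs. \<bar>real (count_list (map observe zs) a) - n * pmf target a\<bar>) \<le> c * (sqrt n + 1)" for a
  proof -
    have "stat_mean (\<lambda>z. of_bool (observe z = a)) = pmf target a"
      by (simp add: stat_mean_def target_def pmf_bind pmf_map vimage_def expct_of_bool)
    then show ?thesis
      unfolding count_list_map by (metis lln[of "\<lambda>z. of_bool (observe z = a)"])
  qed
  then obtain c where c: "\<And>a. c a \<ge> 0" "\<And>a n y. expct (traj n y)
     (\<lambda>zs. \<bar>real (count_list (map observe zs) a) - n * pmf target a\<bar>) \<le> c a * (sqrt n + 1)"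
    by metis
  show ?thesis
  proof (rule that[of "\<Sum>a\<in>UNIV. c a"])
    show "(\<Sum>a\<in>UNIV. c a) \<ge> 0" using c by (simp add: sum_nonneg)
    fix n y
    have "expct (traj n y) (\<lambda>zs. discrepancy (pmf target) (map observe zs))
      = expct (traj n y) (\<lambda>zs. \<Sum>a\<in>UNIV. \<bar>real (count_list (map observe zs) a) - n * pmf target a\<bar>)"
      by (intro expct_cong) (simp add: discrepancy_def length_trajectory)
    also have "\<dots> \<le> (\<Sum>a\<in>UNIV. c a * (sqrt n + 1))"
      unfolding expct_sum[OF finite_set_trajectory] by (intro sum_mono c)
    finally show "expct (traj n y) (\<lambda>zs. discrepancy (pmf target) (map observe zs))
        \<le> (\<Sum>a\<in>UNIV. c a) * (sqrt n + 1)" by (simp add: sum_distrib_right)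
  qed
qed

abbreviation cover_law where "cover_law us xs \<equiv> prod_kernel (\<lambda>(u, x). PS u x) (zip us xs)"
abbreviation codebook_law where "codebook_law xs \<equiv> prod_kernel PSX xs"

lemma expct_trajectory:
  "expct (traj n y) G = avg_XU n (\<lambda>xs us.
     expct (cover_law us xs) (\<lambda>ss. expct (chan xs y) (\<lambda>ys. G (zip5 us xs ss y ys))))"
  unfolding trajectory_letter_law
  by (simp add: expct_bind expct_swap[of "replicate_pmf n PX" "replicate_pmf n PU"])

lemma length_prod_kernel: "bs \<in> set_pmf (prod_kernel k as) \<Longrightarrow> length bs = length as"
  by (induction as arbitrary: bs) auto

text \<open>Both word laws are products, so the log-likelihood ratio is a sum over letters. The
  outputs complete the letters, because the law of large numbers speaks of complete ones.\<close>

lemma cover_log_ratio: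
  assumes "length us = length xs" "length xs = length ss" "length ss = length ys"
    and "set us \<subseteq> set_pmf PU" "ss \<in> set_pmf (cover_law us xs)"
  shows "pmf (cover_law us xs) ss > 0 \<and> pmf (codebook_law xs) ss > 0 \<and>
    ln (pmf (cover_law us xs) ss) - ln (pmf (codebook_law xs) ss) = sum_list (map cover_density (zip5 us xs ss y ys))"
  using assms
proof (induction us xs ss ys arbitrary: y rule: list_induct4)
  case (Cons u us x xs s ss y1 ys)
  have s: "pmf (PS u x) s > 0" "ss \<in> set_pmf (cover_law us xs)"
    using Cons.prems by (auto simp: pmf_positive_iff)
  then have "pmf (PSX x) s > 0" using Cons.prems by (force simp: pmf_positive_iff PSX_def)
  then show ?case using Cons.IH[of y1] Cons.prems s
    by (simp add: pmf_bind_map_Cons cover_density_def ln_mult ln_div del: prod_kernel.simps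
      add: prod_kernel.simps(2)[of _ "(u, x)"] prod_kernel.simps(2)[of _ x])
qed simp

lemma channel_log_ratio:
  assumes "length us = length xs" "length xs = length ss" "length ss = length ys"
    and "set xs \<subseteq> set_pmf PX" "ys \<in> set_pmf (chan xs y)"
  shows "pmf (chan xs y) ys > 0 \<and> pmf (path_law T (length xs) y) ys > 0 \<and>
    ln (pmf (chan xs y) ys) - ln (pmf (path_law T (length xs) y) ys)
      = sum_list (map channel_density (zip5 us xs ss y ys))"
  using assms
proof (induction us xs ss ys arbitrary: y rule: list_induct4)
  case (Cons u us x xs s ss y1 ys)
  have y1: "pmf (Wch x y) y1 > 0" "ys \<in> set_pmf (chan xs y1)"
    using Cons.prems by (auto simp: pmf_positive_iff)
  then have "pmf (T y) y1 > 0"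
    using Cons.prems by (force simp: pmf_positive_iff averaged_chain_def)
  then show ?case using Cons.IH[of y1] Cons.prems y1
    by (simp add: pmf_bind_map_Cons channel_density_def ln_mult ln_div)
qed simp

text \<open>On this event the sum of the densities exceeds n \<open>Ic\<close> by at least n
  \<delta>; the law of large numbers in mean and Markov's inequality make that rare.\<close>

lemma cover_deviation:
  assumes "\<delta> > 0"
  obtains c where "c \<ge> 0" "\<And>n. n > 0 \<Longrightarrow> avg_XU n (\<lambda>xs us.
     prob (cover_law us xs) {ss. pmf (cover_law us xs) ss > exp (n * (Ic + \<delta>)) * pmf (codebook_law xs) ss})
    \<le> c * ((sqrt n + 1) / n)"
proof -
  obtain c where c: "c \<ge> 0" "\<And>n y. expct (traj n y)
     (\<lambda>zs. \<bar>sum_list (map cover_density zs) - n * Ic\<bar>) \<le> c * (sqrt n + 1)"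
    unfolding Ic_def by (rule lln[where f = cover_density]) blast
  show ?thesis
  proof (rule that[of "c / \<delta>"])
    fix n :: nat assume "n > 0"
    fix y :: 'y
    have "avg_XU n (\<lambda>xs us.
       prob (cover_law us xs) {ss. pmf (cover_law us xs) ss > exp (n * (Ic + \<delta>)) * pmf (codebook_law xs) ss})
      \<le> avg_XU n (\<lambda>xs us.
     expct (cover_law us xs) (\<lambda>ss. expct (chan xs undefined) (\<lambda>ys.
      \<bar>sum_list (map cover_density (zip5 us xs ss undefined ys)) - n * Ic\<bar> / (n * \<delta>))))"
      unfolding expct_of_bool[symmetric]
    proof (intro expct_mono finite_set_replicate_pmf finite_set_prod_kernel)
      fix xs us ss
      assume xs: "xs \<in> set_pmf (replicate_pmf n PX)" and us: "us \<in> set_pmf (replicate_pmf n PU)"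
        and ss: "ss \<in> set_pmf (cover_law us xs)"
      let ?P = "pmf (cover_law us xs) ss" and ?Q = "pmf (codebook_law xs) ss"
      \<comment> \<open>The outputs are averaged in artificially, from an arbitrary start state, in
        order to obtain complete letters.\<close>
      have "expct (chan xs undefined) (\<lambda>ys. of_bool (?P > exp (n * (Ic + \<delta>)) * ?Q))
        \<le> expct (chan xs undefined) (\<lambda>ys.
           \<bar>sum_list (map cover_density (zip5 us xs ss undefined ys)) - n * Ic\<bar> / (n * \<delta>))"
      proof (rule expct_mono)
        fix ys assume "ys \<in> set_pmf (chan xs undefined)"
        then have len: "length us = length xs" "length xs = length ss" "length ss = length ys"
          using xs us length_prod_kernel[OF ss] by (auto simp: length_replicate_pmf length_channel_outputs)
        have "set us \<subseteq> set_pmf PU" using us by (auto simp: set_replicate_pmf)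
        note ratio = cover_log_ratio[OF len this ss, of undefined]
        show "of_bool (?P > exp (n * (Ic + \<delta>)) * ?Q)
          \<le> \<bar>sum_list (map cover_density (zip5 us xs ss undefined ys)) - n * Ic\<bar> / (n * \<delta>)"
        proof (cases "?P > exp (n * (Ic + \<delta>)) * ?Q")
          case True
          then have "ln (exp (n * (Ic + \<delta>)) * ?Q) < ln ?P" using ratio by (subst ln_less_cancel_iff) auto
          then have "n * (Ic + \<delta>) < ln ?P - ln ?Q" using ratio by (simp add: ln_mult)
          then have "n * \<delta> \<le> \<bar>sum_list (map cover_density (zip5 us xs ss undefined ys)) - n * Ic\<bar>"
            using ratio by (simp add: algebra_simps)
          then show ?thesis using \<open>n > 0\<close> \<open>\<delta> > 0\<close> by (simp add: True)
        qed (use \<open>\<delta> > 0\<close> in auto)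
      qed simp
      then show "of_bool (?P > exp (n * (Ic + \<delta>)) * ?Q) \<le> expct (chan xs undefined) (\<lambda>ys.
           \<bar>sum_list (map cover_density (zip5 us xs ss undefined ys)) - n * Ic\<bar> / (n * \<delta>))" by simp
    qed
    also have "\<dots> = expct (traj n undefined) (\<lambda>zs. \<bar>sum_list (map cover_density zs) - n * Ic\<bar> / (n * \<delta>))"
      by (rule expct_trajectory[symmetric])
    also have "\<dots> \<le> (c * (sqrt n + 1)) / (n * \<delta>)"
      using c(2)[of n undefined] \<open>\<delta> > 0\<close> by (simp add: divide_right_mono)
    finally show "avg_XU n (\<lambda>xs us.
       prob (cover_law us xs) {ss. pmf (cover_law us xs) ss > exp (n * (Ic + \<delta>)) * pmf (codebook_law xs) ss})
       \<le> c / \<delta> * ((sqrt n + 1) / n)" by (simp add: field_simps)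
  qed (use c \<open>\<delta> > 0\<close> in auto)
qed

text \<open>The mirror image of \<open>cover_deviation\<close>: here the sum of the densities falls
  short of n \<open>Im\<close> by at least n \<delta>. The constant is uniform in the start
  state.\<close>

lemma channel_deviation:
  assumes "\<delta> > 0"
  obtains c where "c \<ge> 0" "\<And>n y. n > 0 \<Longrightarrow> expct (replicate_pmf n PX) (\<lambda>xs.
     prob (chan xs y) {ys. pmf (chan xs y) ys \<le>
       exp (n * (Im - \<delta>)) * pmf (path_law T n y) ys})
    \<le> c * ((sqrt n + 1) / n)"
proof -
  obtain c where c: "c \<ge> 0" "\<And>n y. expct (traj n y)
     (\<lambda>zs. \<bar>sum_list (map channel_density zs) - n * Im\<bar>) \<le> c * (sqrt n + 1)"
    unfolding Im_def by (rule lln[where f = channel_density]) blast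
  show ?thesis
  proof (rule that[of "c / \<delta>"])
    fix n :: nat and y assume "n > 0"
    let ?Q = "\<lambda>ys. pmf (path_law T n y) ys"
    let ?B = "\<lambda>xs ys. of_bool (pmf (chan xs y) ys \<le> exp (n * (Im - \<delta>)) * ?Q ys) :: real"
    have "expct (replicate_pmf n PX) (\<lambda>xs. expct (chan xs y) (?B xs))
      = avg_XU n (\<lambda>xs us.
     expct (cover_law us xs) (\<lambda>ss. expct (chan xs y) (?B xs)))" by simp
    also have "\<dots> \<le> avg_XU n (\<lambda>xs us.
     expct (cover_law us xs) (\<lambda>ss. expct (chan xs y) (\<lambda>ys.
      \<bar>sum_list (map channel_density (zip5 us xs ss y ys)) - n * Im\<bar> / (n * \<delta>))))"
    proof (intro expct_mono finite_set_replicate_pmf finite_set_prod_kernel finite_set_channel_outputs)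
      fix xs us ss ys
      assume xs: "xs \<in> set_pmf (replicate_pmf n PX)" and us: "us \<in> set_pmf (replicate_pmf n PU)"
        and ss: "ss \<in> set_pmf (cover_law us xs)" and ys: "ys \<in> set_pmf (chan xs y)"
      let ?P = "pmf (chan xs y) ys"
      have len: "length us = length xs" "length xs = length ss" "length ss = length ys"
        using xs us ys length_prod_kernel[OF ss] by (auto simp: length_replicate_pmf length_channel_outputs)
      have lx: "length xs = n" using xs by (simp add: length_replicate_pmf)
      have "set xs \<subseteq> set_pmf PX" using xs by (auto simp: set_replicate_pmf)
      note ratio = channel_log_ratio[OF len this ys, unfolded lx]
      show "?B xs ys \<le> \<bar>sum_list (map channel_density (zip5 us xs ss y ys)) - n * Im\<bar> / (n * \<delta>)"
      proof (cases "?P \<le> exp (n * (Im - \<delta>)) * ?Q ys")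
        case True
        then have "ln ?P \<le> ln (exp (n * (Im - \<delta>)) * ?Q ys)" using ratio by (subst ln_le_cancel_iff) auto
        then have "ln ?P - ln (?Q ys) \<le> n * (Im - \<delta>)" using ratio by (simp add: ln_mult)
        then have "n * \<delta> \<le> \<bar>sum_list (map channel_density (zip5 us xs ss y ys)) - n * Im\<bar>"
          using ratio by (simp add: algebra_simps)
        then show ?thesis using \<open>n > 0\<close> \<open>\<delta> > 0\<close> by (simp add: True)
      qed (use \<open>\<delta> > 0\<close> in auto)
    qed
    also have "\<dots> = expct (traj n y) (\<lambda>zs. \<bar>sum_list (map channel_density zs) - n * Im\<bar> / (n * \<delta>))"
      by (rule expct_trajectory[symmetric])
    also have "\<dots> \<le> (c * (sqrt n + 1)) / (n * \<delta>)"
      using c(2)[of n y] \<open>\<delta> > 0\<close> by (simp add: divide_right_mono)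
    finally show "expct (replicate_pmf n PX) (\<lambda>xs. prob (chan xs y)
        {ys. pmf (chan xs y) ys \<le> exp (n * (Im - \<delta>)) * ?Q ys}) \<le> c / \<delta> * ((sqrt n + 1) / n)"
      by (simp add: expct_of_bool field_simps)
  qed (use c \<open>\<delta> > 0\<close> in auto)
qed

text \<open>The encoder does not observe the channel, so a description has to serve every possible
  state at the start of the block; the sum over \<open>i\<close> gives a single cost to
  control.\<close>

definition row_cost where
  "row_cost xs us ss = (\<Sum>i\<in>UNIV. expct (chan xs i) (\<lambda>ys.
     discrepancy (pmf target) (observed us xs i ys (map2 (\<lambda>s. s) ss ys))))"

lemma row_cost_nonneg: "row_cost xs us ss \<ge> 0"
  by (simp add: row_cost_def sum_nonneg)

lemma row_cost_le: "row_cost xs us ss \<le> 2 * length xs * CARD('y)"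
proof -
  have "row_cost xs us ss \<le> (\<Sum>i\<in>(UNIV :: 'y set). real (2 * length xs))"
    unfolding row_cost_def
  proof (rule sum_mono)
    fix i :: 'y
    have "expct (chan xs i) (\<lambda>ys. discrepancy (pmf target) (observed us xs i ys (map2 (\<lambda>s. s) ss ys)))
      \<le> expct (chan xs i) (\<lambda>ys. real (2 * length xs))"
      by (intro expct_mono finite_set_channel_outputs order_trans[OF discrepancy_le]) auto
    then show "expct (chan xs i) (\<lambda>ys. discrepancy (pmf target) (observed us xs i ys (map2 (\<lambda>s. s) ss ys)))
      \<le> real (2 * length xs)" by simp
  qed
  then show ?thesis by (simp add: mult_ac)
qed

lemma row_cost_mean:
  obtains c where "c \<ge> 0" "\<And>n. avg_XU n (\<lambda>xs us. expct (cover_law us xs) (row_cost xs us)) \<le> c * (sqrt n + 1)"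
proof -
  obtain c where c: "c \<ge> 0" "\<And>n y. expct (traj n y)
     (\<lambda>zs. discrepancy (pmf target) (map observe zs)) \<le> c * (sqrt n + 1)"
    by (rule lln_discrepancy) blast
  show ?thesis
  proof (rule that[of "CARD('y) * c"])
    fix n :: nat
    have "avg_XU n (\<lambda>xs us. expct (cover_law us xs) (row_cost xs us))
      = (\<Sum>i\<in>UNIV. avg_XU n (\<lambda>xs us. expct (cover_law us xs) (\<lambda>ss.
          expct (chan xs i) (\<lambda>ys.
            discrepancy (pmf target) (observed us xs i ys (map2 (\<lambda>s. s) ss ys))))))"
      unfolding row_cost_def
      by (simp only: expct_sum finite_set_replicate_pmf finite_set_prod_kernel)
    also have "\<dots> = (\<Sum>i\<in>UNIV. expct (traj n i) (\<lambda>zs. discrepancy (pmf target) (map observe zs)))"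
      unfolding expct_trajectory
    proof (intro sum.cong expct_cong refl)
      fix i xs us ss ys
      assume "xs \<in> set_pmf (replicate_pmf n PX)" "us \<in> set_pmf (replicate_pmf n PU)"
        "ss \<in> set_pmf (cover_law us xs)" "ys \<in> set_pmf (chan xs i)"
      then have "length us = length xs" "length xs = length ss" "length ss = length ys"
        by (auto simp: length_replicate_pmf length_channel_outputs dest!: length_prod_kernel)
      then show "discrepancy (pmf target) (observed us xs i ys (map2 (\<lambda>s. s) ss ys))
        = discrepancy (pmf target) (map observe (zip5 us xs ss i ys))"
        by (simp only: observed_eq_map_observe)
    qed
    also have "\<dots> \<le> (\<Sum>i\<in>(UNIV :: 'y set). c * (sqrt n + 1))" by (intro sum_mono c)
    finally show "avg_XU n (\<lambda>xs us. expct (cover_law us xs) (row_cost xs us))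
        \<le> CARD('y) * c * (sqrt n + 1)" by simp
  qed (use c in auto)
qed

section \<open>Existence of block codes: descriptions for every codeword, then the choice of
  codewords\<close>

lemma sqrt_rate_tendsto_0: "(\<lambda>n. (sqrt (real n) + 1) / real n) \<longlonglongrightarrow> 0"
proof (rule tendsto_sandwich[where f = "\<lambda>_. 0" and h = "\<lambda>n. 2 * inverse (sqrt (real n))"])
  show "eventually (\<lambda>n. (sqrt (real n) + 1) / real n \<le> 2 * inverse (sqrt (real n))) sequentially"
    using eventually_gt_at_top[of 0]
  proof eventually_elim
    case (elim n)
    have "(sqrt n + 1) / n \<le> (2 * sqrt n) / n" using elim by (intro divide_right_mono) auto
    also have "\<dots> = 2 * inverse (sqrt n)" using elim by (simp add: field_simps)
    finally show ?case .
  qed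
  have "filterlim (\<lambda>n. sqrt (real n)) at_top sequentially"
    by (rule filterlim_compose[OF sqrt_at_top filterlim_real_sequentially])
  then have "(\<lambda>n. inverse (sqrt (real n))) \<longlonglongrightarrow> 0" by (rule tendsto_inverse_0_at_top)
  then show "(\<lambda>n. 2 * inverse (sqrt (real n))) \<longlonglongrightarrow> 0" by (rule tendsto_mult_right_zero)
qed (auto intro: always_eventually)

lemma exp_rate_tendsto_0: "(\<delta> :: real) > 0 \<Longrightarrow> (\<lambda>n. exp (- (real n * \<delta>))) \<longlonglongrightarrow> 0"
proof -
  assume "\<delta> > 0"
  have "(\<lambda>n. exp (- \<delta>) ^ n) \<longlonglongrightarrow> 0" using \<open>\<delta> > 0\<close> by (intro LIMSEQ_power_zero) auto
  then show ?thesis by (simp flip: exp_of_nat_mult)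
qed

text \<open>For every input word, covering supplies a codebook of descriptions whose cost is at most
  \<open>F\<close>. Packing then selects codewords for which \<open>F\<close> and the decoding
  errors are small on average. The bounds \<open>b1\<close>, \<open>b2\<close>, \<open>b3\<close>
  are for the distance to the target, the covering deviation and the channel deviation; \<tau> and
  \<theta> are the thresholds of covering and packing.\<close>

lemma block_exists_finite_length:
  fixes n M :: nat and \<kappa> \<tau> \<theta> b1 b2 b3 :: real
  assumes "M > 0" "n > 0" "\<kappa> > 0" "\<tau> > 0" "\<theta> > 0"
    and c1: "avg_XU n (\<lambda>xs us. expct (cover_law us xs) (row_cost xs us)) \<le> n * b1"
    and c2: "avg_XU n (\<lambda>xs us.
      prob (cover_law us xs) {ss. pmf (cover_law us xs) ss > \<tau> * pmf (codebook_law xs) ss}) \<le> b2"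
    and c3: "\<And>y. expct (replicate_pmf n PX) (\<lambda>xs. prob (chan xs y)
      {ys. pmf (chan xs y) ys \<le> \<theta> * pmf (path_law T n y) ys}) \<le> b3"
  shows "block_codable PU Wch target n M
    (n * (\<kappa> + 2 * CARD('y) * (b1 / \<kappa> + b2 + exp (- real M / \<tau>)) + 4 * CARD('y) * (b3 + M / \<theta>)))"
  unfolding block_codable_def
proof (intro allI impI)
  fix \<mu> :: "(nat \<times> 'y) pmf"
  assume \<mu>: "set_pmf \<mu> \<subseteq> {..<M} \<times> UNIV"
  define bad where "bad xs us = {ss. \<not> (row_cost xs us ss \<le> n * \<kappa> \<and>
      pmf (cover_law us xs) ss \<le> \<tau> * pmf (codebook_law xs) ss)}" for xs us
  define K where "K = real (2 * n * CARD('y))"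
  define F where "F xs = n * \<kappa> + K * (expct (replicate_pmf n PU) (\<lambda>us.
      prob (cover_law us xs) (bad xs us)) + exp (- real M / \<tau>))" for xs
  define good where "good xs z e \<longleftrightarrow> (\<forall>us. e us < M) \<and> (\<forall>m<M. length (z m) = n) \<and>
      expct (replicate_pmf n PU) (\<lambda>us. row_cost xs us (z (e us))) \<le> F xs" for xs z e
  have "\<exists>z e. good xs z e" if len: "length xs = n" for xs
  proof -
    have K: "row_cost xs us ss \<le> K" for us ss using row_cost_le[of xs us ss] len by (simp add: K_def)
    have "n * \<kappa> \<ge> 0" using \<open>\<kappa> > 0\<close> by simp
    have "\<exists>z e. (\<forall>us. e us < M) \<and> (\<forall>m<M. z m \<in> set_pmf (codebook_law xs)) \<and>
      expct (replicate_pmf n PU) (\<lambda>us. row_cost xs us (z (e us))) \<le> n * \<kappa> + K * (expct (replicate_pmf n PU) (\<lambda>us.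
        prob (cover_law us xs) {ss. \<not> (row_cost xs us ss \<le> n * \<kappa> \<and>
          pmf (cover_law us xs) ss \<le> \<tau> * pmf (codebook_law xs) ss)}) + exp (- real M / \<tau>))"
      by (rule covering[of "replicate_pmf n PU" "codebook_law xs" "\<lambda>us. cover_law us xs" "row_cost xs",
            OF finite_set_replicate_pmf finite_set_prod_kernel finite_set_prod_kernel
            row_cost_nonneg K \<open>\<tau> > 0\<close> \<open>n * \<kappa> \<ge> 0\<close> \<open>M > 0\<close>]) blast
    then obtain z e where ze: "\<forall>us. e us < M" "\<forall>m<M. z m \<in> set_pmf (codebook_law xs)"
      "expct (replicate_pmf n PU) (\<lambda>us. row_cost xs us (z (e us))) \<le> n * \<kappa> + K * (expct (replicate_pmf n PU) (\<lambda>us.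
        prob (cover_law us xs) {ss. \<not> (row_cost xs us ss \<le> n * \<kappa> \<and>
          pmf (cover_law us xs) ss \<le> \<tau> * pmf (codebook_law xs) ss)}) + exp (- real M / \<tau>))"
      by blast
    moreover have "\<forall>m<M. length (z m) = n" using ze(2) len by (auto dest!: length_prod_kernel)
    ultimately show ?thesis unfolding good_def F_def bad_def by blast
  qed
  then obtain z e where good: "\<And>xs. length xs = n \<Longrightarrow> good xs (z xs) (e xs)" by metis
  have ze: "\<And>xs us. length xs = n \<Longrightarrow> e xs us < M"
    "\<And>xs m. length xs = n \<Longrightarrow> m < M \<Longrightarrow> length (z xs m) = n"
    "\<And>xs. length xs = n \<Longrightarrow> expct (replicate_pmf n PU) (\<lambda>us. row_cost xs us (z xs (e xs us))) \<le> F xs"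
    using good unfolding good_def by auto
  have "expct (replicate_pmf n PX) F \<le> n * \<kappa> + K * (b1 / \<kappa> + b2 + exp (- real M / \<tau>))"
  proof -
    \<comment> \<open>A description is bad if its cost is large, which Markov's inequality controls,
      or if its likelihood ratio is large.\<close>
    have "prob (cover_law us xs) (bad xs us) \<le> expct (cover_law us xs) (row_cost xs us) / (n * \<kappa>) +
        prob (cover_law us xs) {ss. pmf (cover_law us xs) ss > \<tau> * pmf (codebook_law xs) ss}" for xs us
    proof -
      have "prob (cover_law us xs) (bad xs us) = expct (cover_law us xs) (\<lambda>ss. of_bool (ss \<in> bad xs us))"
        by (simp only: expct_prob)
      also have "\<dots> \<le> expct (cover_law us xs) (\<lambda>ss. row_cost xs us ss / (n * \<kappa>) +
          of_bool (pmf (cover_law us xs) ss > \<tau> * pmf (codebook_law xs) ss))"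
        using \<open>n > 0\<close> \<open>\<kappa> > 0\<close> row_cost_nonneg[of xs us]
        by (intro expct_mono finite_set_prod_kernel) (auto simp: bad_def field_simps not_le add_increasing)
      finally show ?thesis by (simp add: expct_add expct_of_bool)
    qed
    then have "expct (replicate_pmf n PX) F \<le> expct (replicate_pmf n PX) (\<lambda>xs. n * \<kappa> + K * (expct (replicate_pmf n PU) (\<lambda>us.
        expct (cover_law us xs) (row_cost xs us) / (n * \<kappa>) +
        prob (cover_law us xs) {ss. pmf (cover_law us xs) ss > \<tau> * pmf (codebook_law xs) ss}) + exp (- real M / \<tau>)))"
      unfolding F_def by (intro expct_mono add_mono mult_left_mono order_refl finite_set_replicate_pmf) (auto simp: K_def)
    also have "\<dots> = n * \<kappa> + K * (avg_XU n (\<lambda>xs us.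
        expct (cover_law us xs) (row_cost xs us)) / (n * \<kappa>) + avg_XU n (\<lambda>xs us.
        prob (cover_law us xs) {ss. pmf (cover_law us xs) ss > \<tau> * pmf (codebook_law xs) ss}) + exp (- real M / \<tau>))"
      by (simp add: expct_add)
    also have "\<dots> \<le> n * \<kappa> + K * ((n * b1) / (n * \<kappa>) + b2 + exp (- real M / \<tau>))"
      using \<open>\<kappa> > 0\<close> by (intro add_mono mult_left_mono divide_right_mono c1 c2 order_refl) (auto simp: K_def)
    finally show ?thesis using \<open>n > 0\<close> by simp
  qed
  \<comment> \<open>Packing needs only the law of the message; the start state is absorbed by the
    sums over \<open>i\<close>.\<close>
  define p where "p = map_pmf fst \<mu>"
  have p: "set_pmf p \<subseteq> {..<M}" using \<mu> by (auto simp: p_def)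
  obtain x d where x: "\<And>m. m < M \<Longrightarrow> x m \<in> set_pmf (replicate_pmf n PX)"
    and xd: "expct p (\<lambda>m. F (x m) + 4 * n * (\<Sum>i\<in>UNIV. prob (chan (x m) i) {y. d i y \<noteq> m})) \<le>
      expct (replicate_pmf n PX) F + 4 * n * (\<Sum>i\<in>UNIV. expct (replicate_pmf n PX) (\<lambda>xs. prob (chan xs i)
        {ys. pmf (chan xs i) ys \<le> \<theta> * pmf (bind_pmf (replicate_pmf n PX) (\<lambda>xs. chan xs i)) ys})
        + M / \<theta>)"
    using p \<open>\<theta> > 0\<close>
    by (rule_tac packing[of "replicate_pmf n PX" chan p M \<theta> "4 * n" F]) auto
  have lx: "length (x m) = n" if "m < M" for m using x[OF that] by (simp add: length_replicate_pmf)
  \<comment> \<open>The message \<open>m\<close> selects the codeword and with it a codebook of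
    descriptions, the message \<open>m'\<close> of the next block selects the description in it. The
    defaults serve decoded values out of range, for which validity still demands a word of the right
    length.\<close>
  define C where "C = (x, (\<lambda>m us. if m < M then e (x m) us else 0), d,
    (\<lambda>m m' ys. if m < M \<and> m' < M then map2 (\<lambda>s. s) (z (x m) m') ys else map (\<lambda>_. undefined) ys))"
  have valid: "valid_block n M C"
    using lx ze \<open>M > 0\<close> by (auto simp: C_def valid_block_def)
  have cost: "cost target n C m y \<le>
      F (x m) + 4 * n * (\<Sum>i\<in>UNIV. prob (chan (x m) i) {y. d i y \<noteq> m})" if "m < M" for m y
  proof -
    let ?cost = "\<lambda>us i. expct (chan (x m) i) (\<lambda>ys.
        discrepancy (pmf target) (observed us (x m) i ys (map2 (\<lambda>s. s) (z (x m) (e (x m) us)) ys)) + 4 * n * of_bool (d i ys \<noteq> m))"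
    have "cost target n C m y = expct (replicate_pmf n PU) (\<lambda>us. ?cost us y)"
      using that ze(1) lx by (simp add: block_cost_def C_def)
    also have "\<dots> \<le> expct (replicate_pmf n PU) (\<lambda>us. \<Sum>i\<in>UNIV. ?cost us i)"
      by (intro expct_mono member_le_sum finite_set_replicate_pmf) auto
    also have "\<dots> = expct (replicate_pmf n PU) (\<lambda>us. row_cost (x m) us (z (x m) (e (x m) us)) +
        4 * n * (\<Sum>i\<in>UNIV. prob (chan (x m) i) {y. d i y \<noteq> m}))"
      by (simp add: expct_add row_cost_def sum.distrib sum_distrib_left expct_of_bool)
    also have "\<dots> = expct (replicate_pmf n PU) (\<lambda>us. row_cost (x m) us (z (x m) (e (x m) us))) +
        4 * n * (\<Sum>i\<in>UNIV. prob (chan (x m) i) {y. d i y \<noteq> m})"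
      by (simp add: expct_add)
    finally show ?thesis using ze(3)[OF lx[OF that]] by simp
  qed
  have "expct \<mu> (\<lambda>(m, y). cost target n C m y) \<le> expct \<mu> (\<lambda>(m, y).
      F (x m) + 4 * n * (\<Sum>i\<in>UNIV. prob (chan (x m) i) {y. d i y \<noteq> m}))"
    by (rule expct_mono_state[OF \<mu> cost])
  also have "\<dots> = expct p (\<lambda>m. F (x m) + 4 * n * (\<Sum>i\<in>UNIV. prob (chan (x m) i) {y. d i y \<noteq> m}))"
    by (simp add: p_def case_prod_unfold)
  also note xd
  also have "expct (replicate_pmf n PX) F + 4 * n * (\<Sum>i\<in>UNIV. expct (replicate_pmf n PX) (\<lambda>xs. prob (chan xs i)
        {ys. pmf (chan xs i) ys \<le> \<theta> * pmf (bind_pmf (replicate_pmf n PX) (\<lambda>xs. chan xs i)) ys})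
        + M / \<theta>) \<le> (n * \<kappa> + K * (b1 / \<kappa> + b2 + exp (- real M / \<tau>))) + 4 * n * (\<Sum>i\<in>(UNIV :: 'y set). b3 + M / \<theta>)"
    unfolding channel_output_law
    by (intro add_mono mult_left_mono sum_mono c3 order_refl \<open>expct (replicate_pmf n PX) F \<le> _\<close>) auto
  also have "\<dots> = n * (\<kappa> + 2 * CARD('y) * (b1 / \<kappa> + b2 + exp (- real M / \<tau>)) + 4 * CARD('y) * (b3 + M / \<theta>))"
    by (simp add: K_def algebra_simps)
  finally show "\<exists>C. valid_block n M C \<and> expct \<mu> (\<lambda>(m, y). cost target n C m y) \<le>
      n * (\<kappa> + 2 * CARD('y) * (b1 / \<kappa> + b2 + exp (- real M / \<tau>)) + 4 * CARD('y) * (b3 + M / \<theta>))"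
    using valid by blast
qed

lemma block_exists_strict:
  assumes "0 \<le> Ic" "Ic < Im" "\<kappa> > 0"
  shows "\<exists>n>0. \<exists>M>0. block_codable PU Wch target n M (real n * \<kappa>)"
proof -
  \<comment> \<open>A quarter of the gap makes room for three separated exponents: Ic + \<delta> for
    covering, Ic + 2 \<delta> for the number of messages, Ic + 3 \<delta> = Im - \<delta> for
    packing.\<close>
  define \<delta> where "\<delta> = (Im - Ic) / 4"
  have \<delta>: "\<delta> > 0" "Im - \<delta> = Ic + 3 * \<delta>" using assms by (auto simp: \<delta>_def field_simps)
  obtain c1 where c1: "c1 \<ge> 0" "\<And>n. avg_XU n (\<lambda>xs us. expct (cover_law us xs) (row_cost xs us)) \<le> c1 * (sqrt n + 1)"
    by (rule row_cost_mean) blast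
  obtain c2 where c2: "c2 \<ge> 0" "\<And>n. n > 0 \<Longrightarrow> avg_XU n (\<lambda>xs us.
     prob (cover_law us xs) {ss. pmf (cover_law us xs) ss > exp (n * (Ic + \<delta>)) * pmf (codebook_law xs) ss})
    \<le> c2 * ((sqrt n + 1) / n)"
    by (rule cover_deviation[OF \<delta>(1)]) blast
  obtain c3 where c3: "c3 \<ge> 0" "\<And>n y. n > 0 \<Longrightarrow> expct (replicate_pmf n PX) (\<lambda>xs.
     prob (chan xs y) {ys. pmf (chan xs y) ys \<le>
       exp (n * (Im - \<delta>)) * pmf (path_law T n y) ys})
    \<le> c3 * ((sqrt n + 1) / n)"
    by (rule channel_deviation[OF \<delta>(1)]) blast
  define s where "s n = (sqrt (real n) + 1) / real n" for n
  define t where "t n = exp (- (real n * \<delta>))" for n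
  define G where "G n = \<kappa> / 2 + 2 * CARD('y) * (c1 * s n / (\<kappa> / 2) + c2 * s n + t n) + 4 * CARD('y) * (c3 * s n + 2 * t n)" for n
  have "G \<longlonglongrightarrow> \<kappa> / 2 + 2 * CARD('y) * (c1 * 0 / (\<kappa> / 2) + c2 * 0 + 0) + 4 * CARD('y) * (c3 * 0 + 2 * 0)"
    unfolding G_def s_def t_def
    by (intro tendsto_intros sqrt_rate_tendsto_0 exp_rate_tendsto_0 \<delta>(1)) (use \<open>\<kappa> > 0\<close> in auto)
  then have "G \<longlonglongrightarrow> \<kappa> / 2" by simp
  then have "eventually (\<lambda>n. G n < \<kappa>) sequentially"
    using \<open>\<kappa> > 0\<close> by (intro order_tendstoD(2)[of G "\<kappa> / 2"]) auto
  then have "eventually (\<lambda>n. G n < \<kappa> \<and> n > 0) sequentially"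
    using eventually_gt_at_top[of 0] by (rule eventually_conj)
  then obtain n where n: "G n < \<kappa>" "n > 0" using eventually_happens'[OF sequentially_bot] by blast
  define \<tau> where "\<tau> = exp (n * (Ic + \<delta>))"
  define \<theta> where "\<theta> = exp (n * (Im - \<delta>))"
  define E where "E = exp (n * (Ic + 2 * \<delta>))"
  define M where "M = nat \<lceil>E\<rceil>"
  \<comment> \<open>Since \<open>0 \<le> Ic\<close>, rounding \<open>E\<close> up to an integer at
    most doubles it.\<close>
  have "E \<ge> 1" using assms \<delta> by (simp add: E_def)
  then have M: "M > 0" "E \<le> M" "M \<le> 2 * E" unfolding M_def by linarith+
  \<comment> \<open>The covering error is at most exp (- exp (n \<delta>)); the weaker bound exp (-
    n \<delta>) is enough.\<close>
  have "E / \<tau> = exp (n * \<delta>)" by (simp add: E_def \<tau>_def exp_diff[symmetric] algebra_simps)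
  then have "exp (n * \<delta>) \<le> M / \<tau>" using M(2) by (simp add: \<tau>_def field_simps)
  then have "n * \<delta> \<le> M / \<tau>" using exp_ge_add_one_self[of "n * \<delta>"] by linarith
  then have expM: "exp (- real M / \<tau>) \<le> t n" by (simp add: t_def)
  have "E / \<theta> = t n" by (simp add: E_def \<theta>_def t_def \<delta>(2) exp_diff[symmetric] algebra_simps)
  then have M\<theta>: "M / \<theta> \<le> 2 * t n" using M(3) by (simp add: \<theta>_def field_simps)
  have c1': "avg_XU n (\<lambda>xs us. expct (cover_law us xs) (row_cost xs us)) \<le> n * (c1 * s n)"
    using c1(2)[of n] n(2) by (simp add: s_def)
  have "block_codable PU Wch target n M (n * (\<kappa> / 2 +
      2 * CARD('y) * (c1 * s n / (\<kappa> / 2) + c2 * s n + exp (- real M / \<tau>)) + 4 * CARD('y) * (c3 * s n + M / \<theta>)))"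
    using \<open>\<kappa> > 0\<close> by (intro block_exists_finite_length M(1) n(2) c1' c2(2)[OF n(2), folded \<tau>_def s_def]
        c3(2)[OF n(2), folded \<theta>_def s_def]) (auto simp: \<tau>_def \<theta>_def)
  moreover have "n * (\<kappa> / 2 + 2 * CARD('y) * (c1 * s n / (\<kappa> / 2) + c2 * s n + exp (- real M / \<tau>)) +
      4 * CARD('y) * (c3 * s n + M / \<theta>)) \<le> n * G n"
    unfolding G_def by (intro mult_left_mono add_mono order_refl expM M\<theta>) auto
  moreover have "n * G n \<le> n * \<kappa>" using n by (intro mult_left_mono) auto
  ultimately have "block_codable PU Wch target n M (n * \<kappa>)"
    unfolding block_codable_def by (meson order_trans)
  then show ?thesis using n(2) M(1) by blast
qed

lemma cover_density_mean:
  "Ic = expct PU (\<lambda>u. expct PX (\<lambda>x. expct (PS u x) (\<lambda>s. ln (pmf (PS u x) s / pmf (PSX x) s))))"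
  by (simp add: Ic_def stat_mean_def letter_law_def expct_bind cover_density_def)

lemma set_PS_subset: "u \<in> set_pmf PU \<Longrightarrow> set_pmf (PS u x) \<subseteq> set_pmf (PSX x)"
  by (auto simp: PSX_def)

lemma Ic_nonneg: "0 \<le> Ic"
proof -
  have "expct PU (\<lambda>u. expct PX (\<lambda>x. 0)) \<le> Ic"
    unfolding cover_density_mean
    by (intro expct_mono gibbs_inequality(1) finite set_PS_subset)
  then show ?thesis by simp
qed

text \<open>\<open>Ic\<close> is an average of nonnegative divergences of \<open>PS u x\<close> from
  \<open>PSX x\<close>; if it vanishes, so does each of them on the support.\<close>

lemma PS_eq_PSX:
  assumes "Ic \<le> 0" "u \<in> set_pmf PU" "x \<in> set_pmf PX"
  shows "PS u x = PSX x"
proof -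
  let ?D = "\<lambda>u x. expct (PS u x) (\<lambda>s. ln (pmf (PS u x) s / pmf (PSX x) s))"
  have D: "?D u x \<ge> 0" if "u \<in> set_pmf PU" for u x
    using that by (intro gibbs_inequality(1) set_PS_subset finite)
  have "Ic = 0" using assms(1) Ic_nonneg by simp
  then have "expct PU (\<lambda>u. - expct PX (?D u)) = 0" by (simp add: cover_density_mean)
  then have "- expct PX (?D u) = 0"
    using assms(2) D by (intro expct_max_attained[of PU "\<lambda>u. - expct PX (?D u)" 0 u]) (auto simp: integral_nonneg)
  then have "expct PX (\<lambda>x. - ?D u x) = 0" by simp
  then have "- ?D u x = 0"
    using assms D by (intro expct_max_attained[of PX "\<lambda>x. - ?D u x" 0 x]) auto
  then show ?thesis using assms by (intro gibbs_inequality(2) set_PS_subset finite) auto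
qed

text \<open>Here \<open>Im\<close> may vanish as well, so that no rate is available and a single message has to suffice.\<close>

lemma block_exists_uninformative:
  assumes "Ic \<le> 0" "\<kappa> > 0"
  shows "\<exists>n>0. \<exists>M>0. block_codable PU Wch target n M (real n * \<kappa>)"
proof -
  obtain c where c: "c \<ge> 0" "\<And>n. avg_XU n (\<lambda>xs us. expct (cover_law us xs) (row_cost xs us)) \<le> c * (sqrt n + 1)"
    by (rule row_cost_mean) blast
  have "(\<lambda>n. c * ((sqrt (real n) + 1) / real n)) \<longlonglongrightarrow> c * 0"
    by (intro tendsto_intros sqrt_rate_tendsto_0)
  then have "eventually (\<lambda>n. c * ((sqrt (real n) + 1) / real n) < \<kappa>) sequentially"
    using \<open>\<kappa> > 0\<close> by (intro order_tendstoD) auto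
  then have "eventually (\<lambda>n. c * ((sqrt (real n) + 1) / real n) < \<kappa> \<and> n > 0) sequentially"
    using eventually_gt_at_top[of 0] by (rule eventually_conj)
  then obtain n where n: "c * ((sqrt (real n) + 1) / real n) < \<kappa>" "n > 0"
    using eventually_happens'[OF sequentially_bot] by blast
  have law: "cover_law us xs = codebook_law xs"
    if "length us = length xs" "set us \<subseteq> set_pmf PU" "set xs \<subseteq> set_pmf PX" for us xs
    using that by (induction us xs rule: list_induct2) (auto simp: PS_eq_PSX[OF assms(1)])
  \<comment> \<open>The law of the descriptions does not involve the source word, so the source can
    be averaged innermost and one pair \<open>xs\<close>, \<open>ss\<close> is fixed for all source
    words.\<close>
  have "expct (replicate_pmf n PX) (\<lambda>xs. expct (codebook_law xs) (\<lambda>ss. expct (replicate_pmf n PU) (\<lambda>us. row_cost xs us ss)))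
    = avg_XU n (\<lambda>xs us. expct (codebook_law xs) (row_cost xs us))"
    by (intro expct_cong expct_swap) auto
  also have "\<dots> = avg_XU n (\<lambda>xs us. expct (cover_law us xs) (row_cost xs us))"
  proof (intro expct_cong)
    fix xs us assume "xs \<in> set_pmf (replicate_pmf n PX)" "us \<in> set_pmf (replicate_pmf n PU)"
    then have "cover_law us xs = codebook_law xs" by (intro law) (auto simp: set_replicate_pmf)
    then show "expct (codebook_law xs) (row_cost xs us) = expct (cover_law us xs) (row_cost xs us)" by simp
  qed
  also have "\<dots> \<le> n * \<kappa>"
    using c(2)[of n] n by (simp add: field_simps)
  finally obtain xs where xs: "xs \<in> set_pmf (replicate_pmf n PX)"
    "expct (codebook_law xs) (\<lambda>ss. expct (replicate_pmf n PU) (\<lambda>us. row_cost xs us ss)) \<le> n * \<kappa>"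
    using expct_le_imp_ex[OF finite_set_replicate_pmf] by blast
  then obtain ss where ss: "ss \<in> set_pmf (codebook_law xs)" "expct (replicate_pmf n PU) (\<lambda>us. row_cost xs us ss) \<le> n * \<kappa>"
    using expct_le_imp_ex[OF finite_set_prod_kernel] by blast
  have len: "length xs = n" "length ss = n"
    using xs(1) length_prod_kernel[OF ss(1)] by (auto simp: length_replicate_pmf)
  define C :: "('u, 'x, 'y, 'v) block_code"
    where "C = ((\<lambda>m. xs), (\<lambda>m us. 0), (\<lambda>y ys. 0), (\<lambda>m m' ys. map2 (\<lambda>s. s) ss ys))"
  have valid: "valid_block n 1 C" using len by (simp add: C_def valid_block_def)
  have cost: "cost target n C 0 y \<le> n * \<kappa>" for y
  proof -
    have "cost target n C 0 y \<le> expct (replicate_pmf n PU) (\<lambda>us. row_cost xs us ss)"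
      unfolding block_cost_def C_def row_cost_def prod.case
      by (intro expct_mono finite_set_replicate_pmf order_trans[OF _ member_le_sum[of y]]) auto
    then show ?thesis using ss(2) by simp
  qed
  have "expct \<mu> (\<lambda>(m, y). cost target n C m y) \<le> n * \<kappa>"
    if \<mu>: "set_pmf \<mu> \<subseteq> {..<1} \<times> UNIV" for \<mu>
    using expct_mono_state[OF \<mu>, of "cost target n C" "\<lambda>_ _. n * \<kappa>"] cost
    by (simp add: case_prod_unfold)
  then have "block_codable PU Wch target n 1 (n * \<kappa>)"
    using valid unfolding block_codable_def by blast
  then show ?thesis using n(2) zero_less_one by blast
qed

lemma block_exists:
  assumes "Ic < Im \<or> Ic \<le> 0" "\<kappa> > 0"
  shows "\<exists>n>0. \<exists>M>0. block_codable PU Wch target n M (real n * \<kappa>)"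
  using block_exists_strict block_exists_uninformative assms Ic_nonneg by blast

end

section \<open>Mutual information of finitely supported distributions\<close>

lemma mutual_information_pmf:
  fixes X :: "'a \<Rightarrow> 'b::countable" and Y :: "'a \<Rightarrow> 'c::countable"
  shows "prob_space.mutual_information (measure_pmf p) 2 (count_space UNIV) (count_space UNIV) X Y =
    expct p (\<lambda>\<omega>. log 2 (pmf (map_pmf (\<lambda>\<omega>. (X \<omega>, Y \<omega>)) p) (X \<omega>, Y \<omega>) /
      (pmf (map_pmf X p) (X \<omega>) * pmf (map_pmf Y p) (Y \<omega>))))"
proof -
  define A where "A = map_pmf X p"
  define B where "B = map_pmf Y p"
  define q where "q = map_pmf (\<lambda>\<omega>. (X \<omega>, Y \<omega>)) p"
  have distr: "distr (measure_pmf p) (count_space UNIV) h = measure_pmf (map_pmf h p)" for h :: "'a \<Rightarrow> 'z"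
    by (simp add: map_pmf_rep_eq)
  have pair: "count_space UNIV \<Otimes>\<^sub>M count_space UNIV = count_space (UNIV :: ('b \<times> 'c) set)"
    by (simp add: pair_measure_countable)
  interpret C: sigma_finite_measure "count_space (UNIV :: ('b \<times> 'c) set)"
    by (rule sigma_finite_measure_count_space)
  have "measure_pmf A \<Otimes>\<^sub>M measure_pmf B
      = density (count_space UNIV \<Otimes>\<^sub>M count_space UNIV) (\<lambda>(x, y). ennreal (pmf A x) * ennreal (pmf B y))"
    unfolding measure_pmf_eq_density
    by (rule pair_measure_density)
      (auto simp: sigma_finite_measure_count_space measure_pmf_eq_density[symmetric]
        intro!: prob_space_imp_sigma_finite measure_pmf.prob_space_axioms)
  also have "\<dots> = density (count_space UNIV) (\<lambda>z. ennreal (pmf A (fst z) * pmf B (snd z)))"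
    unfolding pair by (intro density_cong) (auto simp: ennreal_mult' split: prod.split)
  finally have prod: "measure_pmf A \<Otimes>\<^sub>M measure_pmf B
      = density (count_space UNIV) (\<lambda>z. ennreal (pmf A (fst z) * pmf B (snd z)))" .
  have "prob_space.mutual_information (measure_pmf p) 2 (count_space UNIV) (count_space UNIV) X Y
      = KL_divergence 2 (density (count_space UNIV) (\<lambda>z. ennreal (pmf A (fst z) * pmf B (snd z))))
          (density (count_space UNIV) (\<lambda>z. ennreal (pmf q z)))"
    by (simp add: prob_space.mutual_information_def[OF prob_space_measure_pmf] distr pair prod flip: A_def B_def q_def measure_pmf_eq_density)
  also have "\<dots> = (\<integral>z. pmf q z * log 2 (pmf q z / (pmf A (fst z) * pmf B (snd z))) \<partial>count_space UNIV)"
  proof (rule C.KL_density_density)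
    show "AE z in count_space UNIV. pmf A (fst z) * pmf B (snd z) = 0 \<longrightarrow> pmf q z = 0"
      by (auto simp: AE_count_space A_def B_def q_def pmf_eq_0_set_pmf)
  qed auto
  also have "\<dots> = expct q (\<lambda>z. log 2 (pmf q z / (pmf A (fst z) * pmf B (snd z))))"
    by (subst measure_pmf_eq_density) (simp add: integral_density)
  finally show ?thesis by (simp add: q_def A_def B_def)
qed

text \<open>The library's definition is I(X;(Y,Z)) - I(X;Z), and the marginals of X cancel. On the
  support all quotients are positive, so the logarithms may be combined.\<close>

lemma cond_mutual_info_eq:
  fixes X :: "'a \<Rightarrow> 'b::countable" and Y :: "'a \<Rightarrow> 'c::countable" and Z :: "'a \<Rightarrow> 'd::countable"
  assumes fin: "finite (set_pmf p)"
  shows "cond_mutual_info p X Y Z = expct p (\<lambda>\<omega>. ln (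
      (pmf (map_pmf (\<lambda>\<omega>. (X \<omega>, Y \<omega>, Z \<omega>)) p) (X \<omega>, Y \<omega>, Z \<omega>) * pmf (map_pmf Z p) (Z \<omega>)) /
      (pmf (map_pmf (\<lambda>\<omega>. (X \<omega>, Z \<omega>)) p) (X \<omega>, Z \<omega>) * pmf (map_pmf (\<lambda>\<omega>. (Y \<omega>, Z \<omega>)) p) (Y \<omega>, Z \<omega>)))) / ln 2"
    (is "_ = expct p (\<lambda>\<omega>. ln (?r \<omega>)) / ln 2")
proof -
  have pos: "pmf (map_pmf h p) (h \<omega>) > 0" if "\<omega> \<in> set_pmf p" for h :: "'a \<Rightarrow> 'z" and \<omega>
    using that by (auto simp: pmf_positive_iff)
  let ?a = "\<lambda>\<omega>. log 2 (pmf (map_pmf (\<lambda>\<omega>. (X \<omega>, Y \<omega>, Z \<omega>)) p) (X \<omega>, Y \<omega>, Z \<omega>) /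
      (pmf (map_pmf X p) (X \<omega>) * pmf (map_pmf (\<lambda>\<omega>. (Y \<omega>, Z \<omega>)) p) (Y \<omega>, Z \<omega>)))"
  let ?b = "\<lambda>\<omega>. log 2 (pmf (map_pmf (\<lambda>\<omega>. (X \<omega>, Z \<omega>)) p) (X \<omega>, Z \<omega>) /
      (pmf (map_pmf X p) (X \<omega>) * pmf (map_pmf Z p) (Z \<omega>)))"
  have "cond_mutual_info p X Y Z = expct p ?a - expct p ?b"
    unfolding cond_mutual_info_def prob_space.conditional_mutual_information_def[OF prob_space_measure_pmf]
    by (simp add: pair_measure_countable mutual_information_pmf)
  also have "\<dots> = expct p (\<lambda>\<omega>. ?a \<omega> - ?b \<omega>)"
    using fin by (simp add: integrable_measure_pmf_finite)
  also have "\<dots> = expct p (\<lambda>\<omega>. ln (?r \<omega>) / ln 2)"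
  proof (rule expct_cong)
    fix \<omega> assume \<omega>: "\<omega> \<in> set_pmf p"
    show "?a \<omega> - ?b \<omega> = ln (?r \<omega>) / ln 2"
      using pos[OF \<omega>, of "\<lambda>\<omega>. (X \<omega>, Y \<omega>, Z \<omega>)"] pos[OF \<omega>, of X] pos[OF \<omega>, of Z]
        pos[OF \<omega>, of "\<lambda>\<omega>. (X \<omega>, Z \<omega>)"] pos[OF \<omega>, of "\<lambda>\<omega>. (Y \<omega>, Z \<omega>)"]
      by (simp add: log_def ln_div ln_mult field_simps)
  qed
  finally show ?thesis by simp
qed

text \<open>It will show that passing from the erased auxiliary variable to the random function
  drawn from it does not increase the information about the source.\<close>

lemma kl_data_processing:
  fixes p q :: "'w pmf" and k :: "'w \<Rightarrow> 's pmf"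
  assumes fin: "finite (set_pmf q)" "\<And>w. finite (set_pmf (k w))" and sub: "set_pmf p \<subseteq> set_pmf q"
  shows "expct (bind_pmf p k) (\<lambda>s. ln (pmf (bind_pmf p k) s / pmf (bind_pmf q k) s)) \<le>
    expct p (\<lambda>w. ln (pmf p w / pmf q w))"
proof -
  have finp: "finite (set_pmf p)" using fin(1) sub by (rule finite_subset[rotated])
  let ?P = "bind_pmf p k" and ?Q = "bind_pmf q k"
  define S where "S = set_pmf ?P"
  have finS: "finite S" unfolding S_def using finp fin by simp
  have S: "set_pmf (k w) \<subseteq> S" if "w \<in> set_pmf p" for w unfolding S_def using that by auto
  have Qpos: "pmf ?Q s > 0" if "s \<in> S" for s using that sub by (auto simp: pmf_positive_iff S_def)
  have Ppos: "pmf ?P s > 0" if "s \<in> S" for s using that unfolding S_def by (simp add: pmf_positive_iff)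
  \<comment> \<open>The ratio of the posteriors of \<open>w\<close> given \<open>s\<close> under
    \<open>q\<close> and under \<open>p\<close>. Its mean is at most 1, and 1 - t \<le> - ln t turns
    this into the claim.\<close>
  let ?t = "\<lambda>w s. pmf q w * pmf ?P s / (pmf p w * pmf ?Q s)"
  have "expct p (\<lambda>w. expct (k w) (?t w)) \<le> 1"
  proof -
    have "expct p (\<lambda>w. expct (k w) (?t w)) = (\<Sum>w\<in>set_pmf p. expct (k w) (?t w) * pmf p w)"
      using finp by (intro integral_measure_pmf_real) auto
    also have "\<dots> = (\<Sum>w\<in>set_pmf p. (\<Sum>s\<in>S. ?t w s * pmf (k w) s) * pmf p w)"
    proof (intro sum.cong refl arg_cong2[of _ _ _ _ "(*)"])
      fix w assume "w \<in> set_pmf p"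
      then show "expct (k w) (?t w) = (\<Sum>s\<in>S. ?t w s * pmf (k w) s)"
        using finS S by (intro integral_measure_pmf_real) auto
    qed
    also have "\<dots> = (\<Sum>w\<in>set_pmf p. \<Sum>s\<in>S. pmf q w * pmf (k w) s * (pmf ?P s / pmf ?Q s))"
      by (auto simp: sum_distrib_right set_pmf_iff intro!: sum.cong)
    also have "\<dots> = (\<Sum>s\<in>S. (\<Sum>w\<in>set_pmf p. pmf q w * pmf (k w) s) * (pmf ?P s / pmf ?Q s))"
      by (subst sum.swap) (simp only: sum_distrib_right)
    also have "\<dots> \<le> (\<Sum>s\<in>S. pmf ?Q s * (pmf ?P s / pmf ?Q s))"
    proof (intro sum_mono mult_right_mono)
      fix s
      have "(\<Sum>w\<in>set_pmf p. pmf q w * pmf (k w) s) \<le> (\<Sum>w\<in>set_pmf q. pmf q w * pmf (k w) s)"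
        using fin sub by (intro sum_mono2) auto
      also have "\<dots> = pmf ?Q s"
        using fin by (simp add: pmf_bind integral_measure_pmf_real[where A="set_pmf q"] mult.commute)
      finally show "(\<Sum>w\<in>set_pmf p. pmf q w * pmf (k w) s) \<le> pmf ?Q s" .
    qed auto
    also have "\<dots> = (\<Sum>s\<in>S. pmf ?P s)"
    proof (intro sum.cong refl)
      fix s assume "s \<in> S"
      then show "pmf ?Q s * (pmf ?P s / pmf ?Q s) = pmf ?P s" using Qpos[of s] by simp
    qed
    also have "\<dots> = 1" using finS by (intro sum_pmf_eq_1) (auto simp: S_def)
    finally show ?thesis .
  qed
  then have "0 \<le> expct p (\<lambda>w. expct (k w) (\<lambda>s. 1 - ?t w s))"
    using finp fin by (simp add: integrable_measure_pmf_finite)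
  also have "\<dots> \<le> expct p (\<lambda>w. expct (k w) (\<lambda>s. ln (pmf p w / pmf q w) - ln (pmf ?P s / pmf ?Q s)))"
  proof (intro expct_mono finp fin)
    fix w s assume w: "w \<in> set_pmf p" and s: "s \<in> set_pmf (k w)"
    then have "s \<in> S" using S by auto
    have pos: "pmf p w > 0" "pmf q w > 0" using w sub by (auto simp: pmf_positive_iff)
    have "1 - ?t w s \<le> - ln (?t w s)"
      using ln_le_minus_one[of "?t w s"] pos Ppos[OF \<open>s \<in> S\<close>] Qpos[OF \<open>s \<in> S\<close>] by simp
    also have "\<dots> = ln (pmf p w / pmf q w) - ln (pmf ?P s / pmf ?Q s)"
      using pos Ppos[OF \<open>s \<in> S\<close>] Qpos[OF \<open>s \<in> S\<close>] by (simp add: ln_div ln_mult)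
    finally show "1 - ?t w s \<le> ln (pmf p w / pmf q w) - ln (pmf ?P s / pmf ?Q s)" .
  qed
  also have "\<dots> = expct p (\<lambda>w. ln (pmf p w / pmf q w)) - expct ?P (\<lambda>s. ln (pmf ?P s / pmf ?Q s))"
    using finp fin by (simp add: expct_bind integrable_measure_pmf_finite)
  finally show ?thesis by simp
qed

definition erased :: "real \<Rightarrow> 'w pmf \<Rightarrow> 'w option pmf" where
  "erased \<delta> p = bind_pmf (bernoulli_pmf \<delta>) (\<lambda>b. if b then return_pmf None else map_pmf Some p)"

lemma pmf_erased:
  assumes "0 \<le> \<delta>" "\<delta> \<le> 1"
  shows "pmf (erased \<delta> p) None = \<delta>" "pmf (erased \<delta> p) (Some w) = (1 - \<delta>) * pmf p w"
proof -
  have "pmf (map_pmf Some p) None = 0" by (auto simp: pmf_eq_0_set_pmf)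
  then show "pmf (erased \<delta> p) None = \<delta>"
    using assms by (simp add: erased_def pmf_bind)
  show "pmf (erased \<delta> p) (Some w) = (1 - \<delta>) * pmf p w"
    using assms by (simp add: erased_def pmf_bind pmf_map_inj')
qed

lemma expct_erased:
  assumes "0 \<le> \<delta>" "\<delta> \<le> 1" "finite (set_pmf p)"
  shows "expct (erased \<delta> p) f = \<delta> * f None + (1 - \<delta>) * expct p (\<lambda>w. f (Some w))"
  using assms by (simp add: erased_def expct_bind)

text \<open>The erasure has the same probability under both laws and contributes ln 1 = 0.\<close>

lemma kl_erased:
  assumes "0 < \<delta>" "\<delta> < 1" "finite (set_pmf p)"
  shows "expct (erased \<delta> p) (\<lambda>w. ln (pmf (erased \<delta> p) w / pmf (erased \<delta> q) w)) =
    (1 - \<delta>) * expct p (\<lambda>w. ln (pmf p w / pmf q w))"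
  using assms by (simp add: expct_erased pmf_erased)

lemma set_erased: "0 < \<delta> \<Longrightarrow> \<delta> < 1 \<Longrightarrow> set_pmf (erased \<delta> p) = insert None (Some ` set_pmf p)"
  by (auto simp: erased_def set_pmf_bernoulli split: if_splits)

lemma erased_bind: "bind_pmf p (\<lambda>u. erased \<delta> (k u)) = erased \<delta> (bind_pmf p k)"
  unfolding erased_def by (subst bind_commute_pmf) (auto intro!: bind_pmf_cong simp: map_bind_pmf)

lemma pmf_bind_map_Pair: "pmf (bind_pmf p (\<lambda>a. map_pmf (Pair a) (k a))) (a, b) = pmf p a * pmf (k a) b"
proof -
  have "pmf (map_pmf (Pair c) (k c)) (a, b) = indicator {a} c * pmf (k a) b" for c
    by (cases "c = a") (auto simp: pmf_map_inj' inj_on_def pmf_eq_0_set_pmf)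
  then show ?thesis by (simp add: pmf_bind measure_pmf_single)
qed

lemma discrepancy_change:
  fixes f g :: "'a::finite \<Rightarrow> real"
  shows "discrepancy f zs \<le> discrepancy g zs + length zs * (\<Sum>a\<in>UNIV. \<bar>g a - f a\<bar>)"
  unfolding discrepancy_def sum_distrib_left sum.distrib[symmetric]
proof (rule sum_mono)
  fix a
  have "real (count_list zs a) - real (length zs) * f a
      = (real (count_list zs a) - real (length zs) * g a) + real (length zs) * (g a - f a)"
    by (simp add: algebra_simps)
  then show "\<bar>real (count_list zs a) - real (length zs) * f a\<bar>
    \<le> \<bar>real (count_list zs a) - real (length zs) * g a\<bar> + real (length zs) * \<bar>g a - f a\<bar>"
    using abs_triangle_ineq[of "real (count_list zs a) - real (length zs) * g a" "real (length zs) * (g a - f a)"]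
    by (simp add: abs_mult)
qed

text \<open>It allows the erased target to be replaced by the desired one.\<close>

lemma block_cost_change:
  assumes "valid_block n M C" "m < M"
  shows "block_cost PU Wch P n C m y \<le> block_cost PU Wch P' n C m y + n * (\<Sum>a\<in>UNIV. \<bar>pmf P' a - pmf P a\<bar>)"
proof -
  obtain x e d v where C: "C = (x, e, d, v)" by (cases C)
  let ?D = "n * (\<Sum>a\<in>UNIV. \<bar>pmf P' a - pmf P a\<bar>)"
  have lx: "length (x m) = n" using assms by (auto simp: C valid_block_def)
  have "block_cost PU Wch P n C m y \<le> expct (replicate_pmf n PU) (\<lambda>us. expct (channel_outputs Wch (x m) y) (\<lambda>ys.
       (discrepancy (pmf P') (observed us (x m) y ys (v m (e m us) ys)) + 4 * n * of_bool (d y ys \<noteq> m)) + ?D))"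
    unfolding block_cost_def C prod.case
  proof (intro expct_mono finite_set_replicate_pmf finite_set_channel_outputs)
    fix us ys assume "us \<in> set_pmf (replicate_pmf n PU)" and ys: "ys \<in> set_pmf (channel_outputs Wch (x m) y)"
    let ?zs = "observed us (x m) y ys (v m (e m us) ys)"
    have "length ?zs \<le> n" using lx by simp
    then have "length ?zs * (\<Sum>a\<in>UNIV. \<bar>pmf P' a - pmf P a\<bar>) \<le> ?D"
      by (intro mult_right_mono) (auto simp: sum_nonneg)
    then show "discrepancy (pmf P) ?zs + 4 * n * of_bool (d y ys \<noteq> m)
      \<le> (discrepancy (pmf P') ?zs + 4 * n * of_bool (d y ys \<noteq> m)) + ?D"
      using discrepancy_change[of "pmf P" ?zs "pmf P'"] by simp
  qed
  also have "\<dots> = block_cost PU Wch P' n C m y + ?D"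
    by (simp only: expct_add finite_set_replicate_pmf finite_set_channel_outputs block_cost_def C prod.case) simp
  finally show ?thesis .
qed

lemma bind_averaged_chain:
  assumes "equilibrium Wch PX \<pi>"
  shows "bind_pmf \<pi> (averaged_chain Wch PX) = \<pi>"
proof (rule pmf_eqI)
  fix y
  have "pmf (bind_pmf \<pi> (averaged_chain Wch PX)) y = (\<Sum>y'\<in>UNIV. pmf \<pi> y' * (\<Sum>x\<in>UNIV. pmf PX x * pmf (Wch x y') y))"
    by (simp add: averaged_chain_def pmf_bind expct_finite_type)
  also have "\<dots> = (\<Sum>x\<in>UNIV. \<Sum>y'\<in>UNIV. pmf \<pi> y' * pmf PX x * pmf (Wch x y') y)"
    unfolding sum_distrib_left mult.assoc by (rule sum.swap)
  also have "\<dots> = pmf \<pi> y" using assms unfolding equilibrium_def by metis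
  finally show "pmf (bind_pmf \<pi> (averaged_chain Wch PX)) y = pmf \<pi> y" .
qed

section \<open>Inner bound\<close>

lemma inner_factorization_law:
  fixes Q :: "('u \<times> 'x \<times> 'w \<times> 'y \<times> 'y \<times> 'v) pmf"
  assumes "\<And>u x w y' y v. pmf Q (u, x, w, y', y, v) =
    pmf PU u * pmf PX x * pmf (PW u x) w * pmf \<pi> y' * pmf (Wch x y') y * pmf (PV y x w) v"
  shows "Q = bind_pmf PU (\<lambda>u. map_pmf (Pair u) (bind_pmf PX (\<lambda>x. map_pmf (Pair x) (bind_pmf (PW u x) (\<lambda>w.
    map_pmf (Pair w) (bind_pmf \<pi> (\<lambda>y'. map_pmf (Pair y') (bind_pmf (Wch x y') (\<lambda>y. map_pmf (Pair y) (PV y x w))))))))))"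
proof (rule pmf_eqI)
  fix a :: "'u \<times> 'x \<times> 'w \<times> 'y \<times> 'y \<times> 'v"
  obtain u x w y' y v where "a = (u, x, w, y', y, v)" by (cases a)
  then show "pmf Q a = pmf (bind_pmf PU (\<lambda>u. map_pmf (Pair u) (bind_pmf PX (\<lambda>x. map_pmf (Pair x) (bind_pmf (PW u x) (\<lambda>w.
    map_pmf (Pair w) (bind_pmf \<pi> (\<lambda>y'. map_pmf (Pair y') (bind_pmf (Wch x y') (\<lambda>y. map_pmf (Pair y) (PV y x w)))))))))) ) a"
    by (simp add: assms pmf_bind_map_Pair mult.assoc)
qed

lemma finite_set_bind_pmf:
  "finite (set_pmf p) \<Longrightarrow> (\<And>a. finite (set_pmf (k a))) \<Longrightarrow> finite (set_pmf (bind_pmf p k))"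
  by simp

lemma finite_set_map_pmf: "finite (set_pmf p) \<Longrightarrow> finite (set_pmf (map_pmf f p))"
  by simp

lemma bind_return_eq_map_pmf: "bind_pmf p (\<lambda>a. return_pmf (f a)) = map_pmf f p"
  by (simp add: map_pmf_def)

abbreviation jU :: "'u \<times> 'x \<times> 'w \<times> 'y \<times> 'y \<times> 'v \<Rightarrow> _" where "jU \<equiv> (\<lambda>(u, x, w, y', y, v). u)"
abbreviation jX :: "'u \<times> 'x \<times> 'w \<times> 'y \<times> 'y \<times> 'v \<Rightarrow> _" where "jX \<equiv> (\<lambda>(u, x, w, y', y, v). x)"
abbreviation jW :: "'u \<times> 'x \<times> 'w \<times> 'y \<times> 'y \<times> 'v \<Rightarrow> _" where "jW \<equiv> (\<lambda>(u, x, w, y', y, v). w)"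
abbreviation jY' :: "'u \<times> 'x \<times> 'w \<times> 'y \<times> 'y \<times> 'v \<Rightarrow> _" where "jY' \<equiv> (\<lambda>(u, x, w, y', y, v). y')"
abbreviation jY :: "'u \<times> 'x \<times> 'w \<times> 'y \<times> 'y \<times> 'v \<Rightarrow> _" where "jY \<equiv> (\<lambda>(u, x, w, y', y, v). y)"

context
  fixes PU :: "'u::finite pmf" and PX :: "'x::finite pmf" and PW :: "'u \<Rightarrow> 'x \<Rightarrow> nat pmf"
    and \<pi> :: "'y::finite pmf" and Wch :: "'x \<Rightarrow> 'y \<Rightarrow> 'y pmf" and PV :: "'y \<Rightarrow> 'x \<Rightarrow> nat \<Rightarrow> 'v::finite pmf"
    and Q :: "('u, 'x, 'y, 'v) joint" and A :: "nat set"
  assumes finA: "finite A" and PWA: "\<And>u x. set_pmf (PW u x) \<subseteq> A"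
    and Q: "Q = bind_pmf PU (\<lambda>u. map_pmf (Pair u) (bind_pmf PX (\<lambda>x. map_pmf (Pair x) (bind_pmf (PW u x) (\<lambda>w.
    map_pmf (Pair w) (bind_pmf \<pi> (\<lambda>y'. map_pmf (Pair y') (bind_pmf (Wch x y') (\<lambda>y. map_pmf (Pair y) (PV y x w))))))))))"
begin

lemma finite_PW [simp]: "finite (set_pmf (PW u x))"
  by (rule finite_subset[OF PWA finA])

lemma finite_Q: "finite (set_pmf Q)"
  unfolding Q by (intro finite_set_bind_pmf finite_set_map_pmf finite finite_PW)

lemma expct_Q: "expct Q f = expct PU (\<lambda>u. expct PX (\<lambda>x. expct (PW u x) (\<lambda>w. expct \<pi> (\<lambda>y'. expct (Wch x y') (\<lambda>y.
    expct (PV y x w) (\<lambda>v. f (u, x, w, y', y, v)))))))"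
  unfolding Q by (simp add: expct_bind finite_set_bind_pmf finite_set_map_pmf del: set_bind_pmf set_map_pmf)

lemma support_Q:
  assumes "(u, x, w, y', y, v) \<in> set_pmf Q"
  shows "pmf PU u > 0" "pmf PX x > 0" "pmf (PW u x) w > 0" "pmf \<pi> y' > 0" "pmf (Wch x y') y > 0"
proof -
  have "pmf Q (u, x, w, y', y, v) \<noteq> 0" using assms by (simp add: set_pmf_iff)
  then have "pmf PU u * (pmf PX x * (pmf (PW u x) w * (pmf \<pi> y' * (pmf (Wch x y') y * pmf (PV y x w) v)))) \<noteq> 0"
    unfolding Q by (simp only: pmf_bind_map_Pair not_False_eq_True)
  then show "pmf PU u > 0" "pmf PX x > 0" "pmf (PW u x) w > 0" "pmf \<pi> y' > 0" "pmf (Wch x y') y > 0"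
    by (auto simp: less_le)
qed

lemma marginal_UXW: "map_pmf (\<lambda>(u, x, w, y', y, v). (u, x, w)) Q =
    bind_pmf PU (\<lambda>u. map_pmf (Pair u) (bind_pmf PX (\<lambda>x. map_pmf (Pair x) (PW u x))))"
  unfolding Q by (simp add: map_bind_pmf pmf.map_comp o_def bind_return_eq_map_pmf)

lemma marginal_XYY: "map_pmf (\<lambda>(u, x, w, y', y, v). (x, y', y)) Q =
    bind_pmf PX (\<lambda>x. map_pmf (Pair x) (bind_pmf \<pi> (\<lambda>y'. map_pmf (Pair y') (Wch x y'))))"
  unfolding Q by (simp add: map_bind_pmf pmf.map_comp o_def bind_return_eq_map_pmf)

text \<open>This is I(U;W|X) in nats: as U and X are independent, the law of W given x is the
  mixture of \<open>PW u x\<close> over \<open>PU\<close>.\<close>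

definition aux_info where
  "aux_info = expct PU (\<lambda>u. expct PX (\<lambda>x. expct (PW u x) (\<lambda>w.
     ln (pmf (PW u x) w / pmf (bind_pmf PU (\<lambda>u. PW u x)) w))))"

lemma cond_mutual_info_UWX:
  "cond_mutual_info Q jU jW jX = aux_info / ln 2"
proof -
  have uwx: "pmf (map_pmf (\<lambda>(u, x, w, y', y, v). (u, w, x)) Q) (u, w, x) = pmf PU u * pmf PX x * pmf (PW u x) w" for u w x
  proof -
    have "map_pmf (\<lambda>(u, x, w, y', y, v). (u, w, x)) Q = map_pmf (\<lambda>(u, x, w). (u, w, x)) (map_pmf (\<lambda>(u, x, w, y', y, v). (u, x, w)) Q)"
      by (simp add: pmf.map_comp o_def case_prod_unfold)
    then show ?thesis
      using pmf_map_inj'[of "\<lambda>(u, x, w). (u, w, x)" "map_pmf (\<lambda>(u, x, w, y', y, v). (u, x, w)) Q" "(u, x, w)"]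
      by (auto simp: inj_on_def marginal_UXW pmf_bind_map_Pair)
  qed
  have x: "map_pmf jX Q = PX"
    unfolding Q by (simp add: map_bind_pmf pmf.map_comp o_def bind_return_eq_map_pmf)
  have ux: "map_pmf (\<lambda>(u, x, w, y', y, v). (u, x)) Q = bind_pmf PU (\<lambda>u. map_pmf (Pair u) PX)"
    unfolding Q by (simp add: map_bind_pmf pmf.map_comp o_def bind_return_eq_map_pmf)
  have wx: "pmf (map_pmf (\<lambda>(u, x, w, y', y, v). (w, x)) Q) (w, x) = pmf PX x * pmf (bind_pmf PU (\<lambda>u. PW u x)) w" for w x
  proof -
    have "map_pmf (\<lambda>(u, x, w, y', y, v). (w, x)) Q = map_pmf prod.swap (bind_pmf PU (\<lambda>u. bind_pmf PX (\<lambda>x. map_pmf (Pair x) (PW u x))))"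
      unfolding Q by (simp add: map_bind_pmf pmf.map_comp o_def bind_return_eq_map_pmf)
    also have "bind_pmf PU (\<lambda>u. bind_pmf PX (\<lambda>x. map_pmf (Pair x) (PW u x)))
      = bind_pmf PX (\<lambda>x. map_pmf (Pair x) (bind_pmf PU (\<lambda>u. PW u x)))"
      by (subst bind_commute_pmf) (simp add: map_bind_pmf)
    finally show ?thesis
      using pmf_map_inj'[of prod.swap "bind_pmf PX (\<lambda>x. map_pmf (Pair x) (bind_pmf PU (\<lambda>u. PW u x)))" "(x, w)"]
      by (simp add: pmf_bind_map_Pair case_prod_unfold)
  qed
  have "cond_mutual_info Q jU jW jX
    = expct Q (\<lambda>(u, x, w, y', y, v). ln (pmf (PW u x) w / pmf (bind_pmf PU (\<lambda>u. PW u x)) w)) / ln 2"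
    unfolding cond_mutual_info_eq[OF finite_Q]
    apply (rule arg_cong[of _ _ "\<lambda>t. t / ln 2"], rule expct_cong)
    subgoal premises \<omega> for \<omega>
    proof -
      obtain u x w y' y v where eq: "\<omega> = (u, x, w, y', y, v)" by (cases \<omega>)
      note pos = support_Q[OF \<omega>[unfolded eq]]
      show ?thesis
        using uwx[of u w x] wx[of w x] pos unfolding eq x
        by (simp add: case_prod_unfold ux[unfolded case_prod_unfold] pmf_bind_map_Pair)
    qed
    done
  then show ?thesis by (simp add: expct_Q aux_info_def)
qed

lemma cond_mutual_info_XYY:
  "cond_mutual_info Q jX jY jY' =
    expct \<pi> (\<lambda>y'. expct PX (\<lambda>x. expct (Wch x y') (\<lambda>y. ln (pmf (Wch x y') y / pmf (averaged_chain Wch PX y') y)))) / ln 2"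
proof -
  have xyy: "pmf (map_pmf (\<lambda>(u, x, w, y', y, v). (x, y, y')) Q) (x, y, y') = pmf PX x * pmf \<pi> y' * pmf (Wch x y') y" for x y y'
  proof -
    have "map_pmf (\<lambda>(u, x, w, y', y, v). (x, y, y')) Q = map_pmf (\<lambda>(u, x, w). (u, w, x)) (map_pmf (\<lambda>(u, x, w, y', y, v). (x, y', y)) Q)"
      by (simp add: pmf.map_comp o_def case_prod_unfold)
    then show ?thesis
      using pmf_map_inj'[of "\<lambda>(u, x, w). (u, w, x)" "map_pmf (\<lambda>(u, x, w, y', y, v). (x, y', y)) Q" "(x, y', y)"]
      by (auto simp: inj_on_def marginal_XYY pmf_bind_map_Pair)
  qed
  have y': "map_pmf jY' Q = \<pi>"
    unfolding Q by (simp add: map_bind_pmf pmf.map_comp o_def bind_return_eq_map_pmf)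
  have xy': "map_pmf (\<lambda>(u, x, w, y', y, v). (x, y')) Q = bind_pmf PX (\<lambda>x. map_pmf (Pair x) \<pi>)"
    unfolding Q by (simp add: map_bind_pmf pmf.map_comp o_def bind_return_eq_map_pmf)
  have yy: "pmf (map_pmf (\<lambda>(u, x, w, y', y, v). (y, y')) Q) (y, y') = pmf \<pi> y' * pmf (averaged_chain Wch PX y') y" for y y'
  proof -
    have "map_pmf (\<lambda>(u, x, w, y', y, v). (y, y')) Q = map_pmf prod.swap (bind_pmf PX (\<lambda>x. bind_pmf \<pi> (\<lambda>y'. map_pmf (Pair y') (Wch x y'))))"
      unfolding Q by (simp add: map_bind_pmf pmf.map_comp o_def bind_return_eq_map_pmf)
    also have "bind_pmf PX (\<lambda>x. bind_pmf \<pi> (\<lambda>y'. map_pmf (Pair y') (Wch x y')))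
      = bind_pmf \<pi> (\<lambda>y'. map_pmf (Pair y') (averaged_chain Wch PX y'))"
      by (subst bind_commute_pmf) (simp add: map_bind_pmf averaged_chain_def)
    finally show ?thesis
      using pmf_map_inj'[of prod.swap "bind_pmf \<pi> (\<lambda>y'. map_pmf (Pair y') (averaged_chain Wch PX y'))" "(y', y)"]
      by (simp add: pmf_bind_map_Pair)
  qed
  have "cond_mutual_info Q jX jY jY'
    = expct Q (\<lambda>(u, x, w, y', y, v). ln (pmf (Wch x y') y / pmf (averaged_chain Wch PX y') y)) / ln 2"
    unfolding cond_mutual_info_eq[OF finite_Q]
    apply (rule arg_cong[of _ _ "\<lambda>t. t / ln 2"], rule expct_cong)
    subgoal premises \<omega> for \<omega>
    proof -
      obtain u x w y' y v where eq: "\<omega> = (u, x, w, y', y, v)" by (cases \<omega>)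
      note pos = support_Q[OF \<omega>[unfolded eq]]
      show ?thesis
        using xyy[of x y y'] yy[of y y'] pos unfolding eq y'
        by (simp add: case_prod_unfold xy'[unfolded case_prod_unfold] pmf_bind_map_Pair)
    qed
    done
  also have "expct Q (\<lambda>(u, x, w, y', y, v). ln (pmf (Wch x y') y / pmf (averaged_chain Wch PX y') y))
     = expct PX (\<lambda>x. expct \<pi> (\<lambda>y'. expct (Wch x y') (\<lambda>y. ln (pmf (Wch x y') y / pmf (averaged_chain Wch PX y') y))))"
    by (simp add: expct_Q)
  also have "\<dots> = expct \<pi> (\<lambda>y'. expct PX (\<lambda>x. expct (Wch x y') (\<lambda>y. ln (pmf (Wch x y') y / pmf (averaged_chain Wch PX y') y))))"
    by (rule expct_swap) auto
  finally show ?thesis .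
qed

text \<open>The functional representation: given x and w the values s y are drawn independently for
  all y, and only the one at the actual output is read, so that V keeps the law
  \<open>PV y x w\<close>. An erasure yields an arbitrary fixed function.\<close>

definition reveal :: "'x \<Rightarrow> nat option \<Rightarrow> ('y \<Rightarrow> 'v) pmf" where
  "reveal x ow = (case ow of None \<Rightarrow> return_pmf undefined | Some w \<Rightarrow> Pi_pmf UNIV undefined (\<lambda>y. PV y x w))"

definition PS :: "real \<Rightarrow> 'u \<Rightarrow> 'x \<Rightarrow> ('y \<Rightarrow> 'v) pmf" where
  "PS \<delta> u x = bind_pmf (erased \<delta> (PW u x)) (reveal x)"

lemma inner_bound_aux:
  assumes erg: "ergodic_channel Wch" and eq: "equilibrium Wch PX \<pi>" and gap: "info_gap Q \<ge> 0"
  shows "achievable PU Wch y0 (marginal_UXYYV Q)"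
proof (rule achievable_by_blocks)
  fix \<kappa> :: real assume "\<kappa> > 0"
  define P where "P = marginal_UXYYV Q"
  \<comment> \<open>The erased target differs from \<open>P\<close> by at most 2 \<delta> \<le>
    \<kappa> / 2; the bound 1 / 2 keeps \<delta> below 1.\<close>
  define \<delta> where "\<delta> = min (\<kappa> / 4) (1 / 2)"
  have \<delta>: "0 < \<delta>" "\<delta> < 1" "2 * \<delta> \<le> \<kappa> / 2" using \<open>\<kappa> > 0\<close> by (auto simp: \<delta>_def)
  obtain C where C: "\<And>D. recurrent_class (averaged_chain Wch PX) D \<Longrightarrow> D = C"
    using erg unfolding ergodic_channel_def by blast
  interpret S: coding_setup PU PX "PS \<delta>" Wch \<pi>
  proof
    show "D = E" if "recurrent_class (averaged_chain Wch PX) D" "recurrent_class (averaged_chain Wch PX) E" for D E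
      using C that by blast
    show "bind_pmf \<pi> (averaged_chain Wch PX) = \<pi>" by (rule bind_averaged_chain[OF eq])
  qed
  define PWX where "PWX x = bind_pmf PU (\<lambda>u. PW u x)" for x
  have PSX: "S.PSX x = bind_pmf (erased \<delta> (PWX x)) (reveal x)" for x
    unfolding S.PSX_def PS_def PWX_def erased_bind[symmetric] by (simp add: bind_assoc_pmf)
  \<comment> \<open>Data processing from the erased variable to s, together with the factor 1 -
    \<delta> by which erasure shrinks each divergence.\<close>
  have Ic: "S.Ic \<le> (1 - \<delta>) * aux_info"
  proof -
    have "S.Ic \<le> expct PU (\<lambda>u. expct PX (\<lambda>x. (1 - \<delta>) * expct (PW u x) (\<lambda>w. ln (pmf (PW u x) w / pmf (PWX x) w))))"
      unfolding S.cover_density_mean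
    proof (intro expct_mono finite)
      fix u x assume u: "u \<in> set_pmf PU"
      have "set_pmf (erased \<delta> (PW u x)) \<subseteq> set_pmf (erased \<delta> (PWX x))"
        using u \<delta> by (auto simp: set_erased PWX_def)
      moreover have "finite (set_pmf (erased \<delta> (PWX x)))" using \<delta> by (simp add: set_erased PWX_def)
      ultimately have "expct (PS \<delta> u x) (\<lambda>s. ln (pmf (PS \<delta> u x) s / pmf (S.PSX x) s))
        \<le> expct (erased \<delta> (PW u x)) (\<lambda>w. ln (pmf (erased \<delta> (PW u x)) w / pmf (erased \<delta> (PWX x)) w))"
        unfolding PSX unfolding PS_def by (intro kl_data_processing) auto
      also have "\<dots> = (1 - \<delta>) * expct (PW u x) (\<lambda>w. ln (pmf (PW u x) w / pmf (PWX x) w))"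
        using \<delta> by (intro kl_erased) auto
      finally show "expct (PS \<delta> u x) (\<lambda>s. ln (pmf (PS \<delta> u x) s / pmf (S.PSX x) s))
        \<le> (1 - \<delta>) * expct (PW u x) (\<lambda>w. ln (pmf (PW u x) w / pmf (PWX x) w))" .
    qed
    then show ?thesis by (simp add: aux_info_def PWX_def)
  qed
  have Im: "S.Im = expct \<pi> (\<lambda>y'. expct PX (\<lambda>x. expct (Wch x y') (\<lambda>y. ln (pmf (Wch x y') y / pmf (averaged_chain Wch PX y') y))))"
    by (simp add: S.Im_def S.stat_mean_def letter_law_def expct_bind S.channel_density_def)
  have "info_gap Q = (S.Im - aux_info) / ln 2"
    unfolding info_gap_def cond_mutual_info_UWX cond_mutual_info_XYY Im by (simp add: diff_divide_distrib)
  then have "aux_info \<le> S.Im" using gap by (simp add: zero_le_divide_iff)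
  \<comment> \<open>A positive \<open>aux_info\<close> is strictly decreased by the factor 1 -
    \<delta>; otherwise \<open>S.Ic\<close> is not positive and the single-message construction
    applies.\<close>
  then have strict: "S.Ic < S.Im \<or> S.Ic \<le> 0"
  proof (cases "aux_info > 0")
    case True
    then have "(1 - \<delta>) * aux_info < aux_info" using \<delta> by simp
    then show ?thesis using Ic \<open>aux_info \<le> S.Im\<close> by linarith
  next
    case False
    then have "(1 - \<delta>) * aux_info \<le> 0" using \<delta> by (intro mult_nonneg_nonpos) auto
    then show ?thesis using Ic by linarith
  qed
  \<comment> \<open>\<open>G b\<close> is the law of the observed letter given that the auxiliary
    variable was erased or kept. The target mixes the two with weights \<delta> and 1 - \<delta>,
    and \<open>G False\<close> is the desired distribution.\<close>
  define G where "G b = bind_pmf \<pi> (\<lambda>y'. bind_pmf PU (\<lambda>u. bind_pmf PX (\<lambda>x.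
      bind_pmf (if b then return_pmf None else map_pmf Some (PW u x)) (\<lambda>ow. bind_pmf (reveal x ow) (\<lambda>s.
        map_pmf (\<lambda>y. (u, x, y', y, s y)) (Wch x y'))))))" for b
  have target: "S.target = bind_pmf (bernoulli_pmf \<delta>) G"
  proof -
    have "S.target = bind_pmf \<pi> (\<lambda>y'. bind_pmf PU (\<lambda>u. bind_pmf PX (\<lambda>x. bind_pmf (bernoulli_pmf \<delta>) (\<lambda>b.
      bind_pmf (if b then return_pmf None else map_pmf Some (PW u x)) (\<lambda>ow. bind_pmf (reveal x ow) (\<lambda>s.
        map_pmf (\<lambda>y. (u, x, y', y, s y)) (Wch x y')))))))"
      by (simp add: S.target_def letter_law_def map_bind_pmf pmf.map_comp o_def observe_def PS_def erased_def bind_assoc_pmf)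
    also have "\<dots> = bind_pmf \<pi> (\<lambda>y'. bind_pmf (bernoulli_pmf \<delta>) (\<lambda>b. bind_pmf PU (\<lambda>u. bind_pmf PX (\<lambda>x.
      bind_pmf (if b then return_pmf None else map_pmf Some (PW u x)) (\<lambda>ow. bind_pmf (reveal x ow) (\<lambda>s.
        map_pmf (\<lambda>y. (u, x, y', y, s y)) (Wch x y')))))))"
      apply (intro bind_pmf_cong_UNIV)
      apply (subst (2) bind_commute_pmf)
      apply (subst bind_commute_pmf)
      apply (rule refl)
      done
    also have "\<dots> = bind_pmf (bernoulli_pmf \<delta>) G"
      unfolding G_def by (rule bind_commute_pmf)
    finally show ?thesis .
  qed
  have GP: "G False = P"
  proof -
    have inner: "bind_pmf (reveal x (Some w)) (\<lambda>s. map_pmf (\<lambda>y. (u, x, y', y, s y)) (Wch x y'))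
      = bind_pmf (Wch x y') (\<lambda>y. map_pmf (\<lambda>v. (u, x, y', y, v)) (PV y x w))" for u x w y'
    proof -
      have "bind_pmf (reveal x (Some w)) (\<lambda>s. map_pmf (\<lambda>y. (u, x, y', y, s y)) (Wch x y'))
        = bind_pmf (Wch x y') (\<lambda>y. map_pmf (\<lambda>s. (u, x, y', y, s y)) (reveal x (Some w)))"
        unfolding map_pmf_def by (rule bind_commute_pmf)
      also have "\<dots> = bind_pmf (Wch x y') (\<lambda>y. map_pmf (\<lambda>v. (u, x, y', y, v)) (map_pmf (\<lambda>s. s y) (reveal x (Some w))))"
        by (simp add: pmf.map_comp o_def)
      also have "\<dots> = bind_pmf (Wch x y') (\<lambda>y. map_pmf (\<lambda>v. (u, x, y', y, v)) (PV y x w))"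
        by (simp add: reveal_def Pi_pmf_component)
      finally show ?thesis .
    qed
    have "G False = bind_pmf \<pi> (\<lambda>y'. bind_pmf PU (\<lambda>u. bind_pmf PX (\<lambda>x. bind_pmf (PW u x) (\<lambda>w.
       bind_pmf (Wch x y') (\<lambda>y. map_pmf (\<lambda>v. (u, x, y', y, v)) (PV y x w))))))"
      unfolding G_def by (simp add: bind_map_pmf inner)
    also have "\<dots> = bind_pmf PU (\<lambda>u. bind_pmf PX (\<lambda>x. bind_pmf (PW u x) (\<lambda>w. bind_pmf \<pi> (\<lambda>y'.
       bind_pmf (Wch x y') (\<lambda>y. map_pmf (\<lambda>v. (u, x, y', y, v)) (PV y x w))))))"
      apply (subst bind_commute_pmf)
      apply (intro bind_pmf_cong_UNIV)
      apply (subst bind_commute_pmf)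
      apply (intro bind_pmf_cong_UNIV)
      apply (subst bind_commute_pmf)
      apply (rule refl)
      done
    also have "\<dots> = P"
      unfolding P_def marginal_UXYYV_def Q by (simp add: map_bind_pmf pmf.map_comp o_def)
    finally show ?thesis .
  qed
  have "(\<Sum>a\<in>UNIV. \<bar>pmf S.target a - pmf P a\<bar>) \<le> (\<Sum>a\<in>UNIV. \<delta> * (pmf (G True) a + pmf P a))"
  proof (rule sum_mono)
    fix a
    have "pmf S.target a - pmf P a = \<delta> * (pmf (G True) a - pmf P a)"
      using \<delta> by (simp add: target pmf_bind GP algebra_simps)
    then have "\<bar>pmf S.target a - pmf P a\<bar> = \<delta> * \<bar>pmf (G True) a - pmf P a\<bar>"
      using \<delta> by (simp add: abs_mult)
    also have "\<dots> \<le> \<delta> * (pmf (G True) a + pmf P a)"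
    proof (intro mult_left_mono)
      show "\<bar>pmf (G True) a - pmf P a\<bar> \<le> pmf (G True) a + pmf P a"
        using pmf_nonneg[of "G True" a] pmf_nonneg[of P a] by linarith
    qed (use \<delta> in auto)
    finally show "\<bar>pmf S.target a - pmf P a\<bar> \<le> \<delta> * (pmf (G True) a + pmf P a)" .
  qed
  also have "\<dots> = 2 * \<delta>"
    by (simp add: sum_distrib_left[symmetric] sum.distrib sum_pmf_eq_1)
  finally have close: "(\<Sum>a\<in>UNIV. \<bar>pmf S.target a - pmf P a\<bar>) \<le> \<kappa> / 2" using \<delta>(3) by simp
  obtain n M where nM: "n > 0" "M > 0" and blk: "block_codable PU Wch S.target n M (real n * (\<kappa> / 2))"
    using S.block_exists[OF strict, of "\<kappa> / 2"] \<open>\<kappa> > 0\<close> by auto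
  have "block_codable PU Wch P n M (real n * \<kappa>)"
    unfolding block_codable_def
  proof (intro allI impI)
    fix \<mu> :: "(nat \<times> 'y) pmf"
    assume \<mu>: "set_pmf \<mu> \<subseteq> {..<M} \<times> UNIV"
    then obtain C where C: "valid_block n M C" "expct \<mu> (\<lambda>(m, y). block_cost PU Wch S.target n C m y) \<le> real n * (\<kappa> / 2)"
      using blk unfolding block_codable_def by blast
    have fin: "finite (set_pmf \<mu>)" by (rule finite_subset[OF \<mu>]) simp
    have "block_cost PU Wch P n C m y \<le> block_cost PU Wch S.target n C m y + n * (\<kappa> / 2)" if "m < M" for m y
      by (rule order_trans[OF block_cost_change[OF C(1) that, of _ _ _ _ S.target]]) (intro add_left_mono mult_left_mono close, simp)
    then have "expct \<mu> (\<lambda>(m, y). block_cost PU Wch P n C m y) \<le>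
        expct \<mu> (\<lambda>(m, y). block_cost PU Wch S.target n C m y + n * (\<kappa> / 2))"
      by (rule expct_mono_state[OF \<mu>])
    also have "\<dots> = expct \<mu> (\<lambda>(m, y). block_cost PU Wch S.target n C m y) + n * (\<kappa> / 2)"
      using fin by (simp add: case_prod_unfold expct_add)
    also have "\<dots> \<le> n * \<kappa>" using C(2) by simp
    finally show "\<exists>C. valid_block n M C \<and> expct \<mu> (\<lambda>(m, y). block_cost PU Wch P n C m y) \<le> real n * \<kappa>"
      using C(1) by blast
  qed
  then show "\<exists>n>0. \<exists>M>0. block_codable PU Wch (marginal_UXYYV Q) n M (real n * \<kappa>)"
    using nM unfolding P_def by blast
qed

end

theorem inner_bound:
  fixes PU :: "'u::finite pmf" and Wch :: "'x::finite \<Rightarrow> 'y::finite \<Rightarrow> 'y pmf"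
    and Q :: "('u, 'x, 'y, 'v::finite) joint"
  assumes "ergodic_channel Wch" "finite A" "inner_factorization PU Wch A Q" "info_gap Q \<ge> 0"
  shows "achievable PU Wch y0 (marginal_UXYYV Q)"
proof -
  obtain PX PW \<pi> PV where PW: "\<And>u x. set_pmf (PW u x) \<subseteq> A" and eq: "equilibrium Wch PX \<pi>"
    and Q: "\<And>u x w y' y v. pmf Q (u, x, w, y', y, v) =
           pmf PU u * pmf PX x * pmf (PW u x) w * pmf \<pi> y' * pmf (Wch x y') y * pmf (PV y x w) v"
    using assms(3) unfolding inner_factorization_def by blast
  show ?thesis
    by (rule inner_bound_aux[OF assms(2) PW inner_factorization_law[OF Q] assms(1) eq assms(4)])
qed

section \<open>Outer bound\<close>

primrec seq_law :: "('a list \<Rightarrow> 'a pmf) \<Rightarrow> nat \<Rightarrow> 'a list pmf" where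
  "seq_law k 0 = return_pmf []"
| "seq_law k (Suc n) = bind_pmf (seq_law k n) (\<lambda>as. map_pmf (\<lambda>a. as @ [a]) (k as))"

lemma length_seq_law: "as \<in> set_pmf (seq_law k n) \<Longrightarrow> length as = n"
  by (induction n arbitrary: as) auto

lemma finite_set_seq_law [simp]: "finite (set_pmf (seq_law (k :: _ \<Rightarrow> 'a::finite pmf) n))"
  by (induction n) auto

lemma pmf_seq_law:
  assumes "length as = n"
  shows "pmf (seq_law k n) as = (\<Prod>t<n. pmf (k (take t as)) (as ! t))"
  using assms
proof (induction n arbitrary: as)
  case (Suc n)
  then obtain bs b where as: "as = bs @ [b]" "length bs = n"
    by (metis length_Suc_conv_rev)
  have "pmf (map_pmf (\<lambda>a. cs @ [a]) (k cs)) (bs @ [b]) = indicator {bs} cs * pmf (k bs) b" for cs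
    by (cases "cs = bs") (auto simp: pmf_map vimage_def measure_pmf_single)
  then have "pmf (seq_law k (Suc n)) as = pmf (seq_law k n) bs * pmf (k bs) b"
    by (simp add: as pmf_bind measure_pmf_single)
  also have "\<dots> = (\<Prod>t<n. pmf (k (take t bs)) (bs ! t)) * pmf (k bs) b"
    using Suc.IH[OF as(2)] by simp
  also have "\<dots> = (\<Prod>t<Suc n. pmf (k (take t as)) (as ! t))"
    using as by (simp add: nth_append)
  finally show ?case .
qed simp

lemma take_seq_law: "t \<le> n \<Longrightarrow> map_pmf (take t) (seq_law k n) = seq_law k t"
proof (induction n)
  case (Suc n)
  show ?case
  proof (cases "t = Suc n")
    case True
    have "map_pmf (take t) (seq_law k (Suc n)) = map_pmf (\<lambda>x. x) (seq_law k (Suc n))"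
      by (intro map_pmf_cong) (auto simp: True dest: length_seq_law)
    then show ?thesis by (simp add: True pmf.map_ident)
  next
    case False
    then have "t \<le> n" using Suc.prems by simp
    have "map_pmf (take t) (seq_law k (Suc n)) = bind_pmf (seq_law k n) (\<lambda>as. return_pmf (take t as))"
      unfolding seq_law.simps map_bind_pmf pmf.map_comp o_def
      using \<open>t \<le> n\<close> by (intro bind_pmf_cong) (auto dest: length_seq_law)
    then show ?thesis using Suc.IH[OF \<open>t \<le> n\<close>] by (simp add: bind_return_eq_map_pmf)
  qed
qed simp

lemma pmf_map_inj_on_insert:
  assumes "inj_on h (set_pmf p \<union> {a})"
  shows "pmf (map_pmf h p) (h a) = pmf p a"
proof -
  have "prob p (h -` {h a}) = prob p (h -` {h a} \<inter> set_pmf p)"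
    by (simp add: measure_Int_set_pmf)
  also have "h -` {h a} \<inter> set_pmf p = {a} \<inter> set_pmf p"
    using assms by (auto simp: inj_on_def)
  also have "prob p ({a} \<inter> set_pmf p) = pmf p a"
    by (simp only: measure_Int_set_pmf measure_pmf_single)
  finally show ?thesis by (simp add: pmf_map)
qed

lemma pmf_bind_triple:
  "pmf (bind_pmf r (\<lambda>(x, y'). map_pmf (\<lambda>y. (x, y', y)) (k x y'))) (x, y', y) = pmf r (x, y') * pmf (k x y') y"
proof -
  have "pmf (map_pmf (\<lambda>y. (x0, y0, y)) (k x0 y0)) (x, y', y) = indicator {(x, y')} (x0, y0) * pmf (k x y') y" for x0 y0
    by (cases "(x0, y0) = (x, y')") (auto simp: pmf_map vimage_def measure_pmf_single)
  then show ?thesis by (simp add: pmf_bind case_prod_unfold measure_pmf_single)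
qed

definition cond_kernel :: "'w pmf \<Rightarrow> ('w \<Rightarrow> 'a) \<Rightarrow> ('w \<Rightarrow> 'b) \<Rightarrow> 'b \<Rightarrow> 'a pmf" where
  "cond_kernel q h k b = (if b \<in> k ` set_pmf q then map_pmf h (cond_pmf q {\<omega>. k \<omega> = b}) else return_pmf undefined)"

lemma pmf_cond_kernel:
  assumes "b \<in> k ` set_pmf q"
  shows "pmf (cond_kernel q h k b) a = pmf (map_pmf (\<lambda>\<omega>. (h \<omega>, k \<omega>)) q) (a, b) / pmf (map_pmf k q) b"
proof -
  have ne: "set_pmf q \<inter> {\<omega>. k \<omega> = b} \<noteq> {}" using assms by auto
  have "pmf (cond_kernel q h k b) a = prob (cond_pmf q {\<omega>. k \<omega> = b}) (h -` {a})"
    using assms by (simp add: cond_kernel_def pmf_map)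
  also have "\<dots> = prob q ({\<omega>. k \<omega> = b} \<inter> h -` {a}) / prob q {\<omega>. k \<omega> = b}"
    by (simp add: cond_pmf.rep_eq[OF ne] measure_uniform_measure[OF _ _] emeasure_measure_pmf_not_zero[OF ne])
  finally show ?thesis
    by (simp add: pmf_map vimage_def Int_def conj_commute)
qed

section \<open>Single-letter laws and their information gap\<close>

type_synonym ('u, 'x, 'y, 'v) letter = "'u \<times> 'x \<times> ('y \<Rightarrow> 'v) \<times> 'y \<times> 'y"

abbreviation pXYY :: "('u, 'x, 'y, 'v) letter \<Rightarrow> _" where "pXYY \<equiv> (\<lambda>(u, x, s, y', y). (x, y, y'))"
abbreviation pY' :: "('u, 'x, 'y, 'v) letter \<Rightarrow> _" where "pY' \<equiv> (\<lambda>(u, x, s, y', y). y')"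
abbreviation pXY' :: "('u, 'x, 'y, 'v) letter \<Rightarrow> _" where "pXY' \<equiv> (\<lambda>(u, x, s, y', y). (x, y'))"
abbreviation pYY' :: "('u, 'x, 'y, 'v) letter \<Rightarrow> _" where "pYY' \<equiv> (\<lambda>(u, x, s, y', y). (y, y'))"
abbreviation pUSX :: "('u, 'x, 'y, 'v) letter \<Rightarrow> _" where "pUSX \<equiv> (\<lambda>(u, x, s, y', y). (u, s, x))"
abbreviation pX :: "('u, 'x, 'y, 'v) letter \<Rightarrow> _" where "pX \<equiv> (\<lambda>(u, x, s, y', y). x)"
abbreviation pUX :: "('u, 'x, 'y, 'v) letter \<Rightarrow> _" where "pUX \<equiv> (\<lambda>(u, x, s, y', y). (u, x))"
abbreviation pSX :: "('u, 'x, 'y, 'v) letter \<Rightarrow> _" where "pSX \<equiv> (\<lambda>(u, x, s, y', y). (s, x))"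
abbreviation pUXYY :: "('u, 'x, 'y, 'v) letter \<Rightarrow> _" where "pUXYY \<equiv> (\<lambda>(u, x, s, y', y). (u, x, y', y))"

text \<open>The density of I(X;Y|Y') - I(U;S|X) in nats. Keeping the eight logarithms apart makes
  its mean a signed sum of entropies, which is continuous in \<open>q\<close>.\<close>

definition ratio_gap :: "('u, 'x, 'y, 'v) letter pmf \<Rightarrow> ('u, 'x, 'y, 'v) letter \<Rightarrow> real" where
  "ratio_gap q = (\<lambda>(u, x, s, y', y).
     ln (pmf (map_pmf pXYY q) (x, y, y'))
     + ln (pmf (map_pmf pY' q) y')
     - ln (pmf (map_pmf pXY' q) (x, y'))
     - ln (pmf (map_pmf pYY' q) (y, y'))
     - ln (pmf (map_pmf pUSX q) (u, s, x))
     - ln (pmf (map_pmf pX q) x)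
     + ln (pmf (map_pmf pUX q) (u, x))
     + ln (pmf (map_pmf pSX q) (s, x)))"

definition gap :: "('u, 'x, 'y, 'v) letter pmf \<Rightarrow> real" where
  "gap q = expct q (ratio_gap q)"

text \<open>Source and channel have the prescribed laws and U is independent of (X, Y'). In this
  form the condition is linear in \<open>q\<close>, so that averages over time and limits preserve
  it.\<close>

definition causal_law :: "'u pmf \<Rightarrow> ('x \<Rightarrow> 'y \<Rightarrow> 'y pmf) \<Rightarrow> ('u, 'x, 'y, 'v) letter pmf \<Rightarrow> bool" where
  "causal_law PU Wch q \<longleftrightarrow> (\<forall>u x y' y. pmf (map_pmf pUXYY q) (u, x, y', y) =
     pmf PU u * pmf (map_pmf pXY' q) (x, y') * pmf (Wch x y') y)"

lemma pmf_map_eq_sum: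
  fixes q :: "'a::finite pmf"
  shows "pmf (map_pmf h q) b = (\<Sum>a\<in>UNIV. of_bool (h a = b) * pmf q a)"
proof -
  have "pmf (map_pmf h q) b = expct q (\<lambda>a. of_bool (h a = b))"
    by (simp add: pmf_map vimage_def expct_of_bool)
  then show ?thesis by (simp add: expct_finite_type mult.commute)
qed

lemma causal_law_marginals:
  fixes PU :: "'u::finite pmf" and Wch :: "'x::finite \<Rightarrow> 'y::finite \<Rightarrow> 'y pmf"
  assumes "causal_law PU Wch q"
  shows "pmf (map_pmf pXYY q) (x, y, y') =
      pmf (map_pmf pXY' q) (x, y') * pmf (Wch x y') y"
    and "pmf (map_pmf pUX q) (u, x) =
      pmf PU u * pmf (map_pmf pX q) x"
proof -
  let ?m = "map_pmf pUXYY q"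
  let ?r = "map_pmf pXY' q"
  have m: "?m = bind_pmf PU (\<lambda>u. map_pmf (Pair u) (bind_pmf ?r (\<lambda>(x, y'). map_pmf (\<lambda>y. (x, y', y)) (Wch x y'))))"
  proof (rule pmf_eqI)
    fix a :: "'u \<times> 'x \<times> 'y \<times> 'y"
    obtain u x y' y where a: "a = (u, x, y', y)" by (cases a)
    show "pmf ?m a = pmf (bind_pmf PU (\<lambda>u. map_pmf (Pair u) (bind_pmf ?r (\<lambda>(x, y'). map_pmf (\<lambda>y. (x, y', y)) (Wch x y'))))) a"
      using assms by (simp add: a pmf_bind_map_Pair pmf_bind_triple causal_law_def)
  qed
  have "map_pmf (\<lambda>(u, x, s, y', y). (x, y', y)) q = map_pmf (\<lambda>(u, x, y', y). (x, y', y)) ?m"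
    by (simp add: pmf.map_comp o_def case_prod_unfold)
  also have "\<dots> = bind_pmf ?r (\<lambda>(x, y'). map_pmf (\<lambda>y. (x, y', y)) (Wch x y'))"
    unfolding m by (simp add: map_bind_pmf pmf.map_comp o_def case_prod_unfold)
  finally have xyy: "map_pmf (\<lambda>(u, x, s, y', y). (x, y', y)) q = bind_pmf ?r (\<lambda>(x, y'). map_pmf (\<lambda>y. (x, y', y)) (Wch x y'))" .
  have "pmf (map_pmf pXYY q) (x, y, y') = pmf (map_pmf (\<lambda>(u, x, s, y', y). (x, y', y)) q) (x, y', y)"
    unfolding pmf_map by (rule arg_cong[of _ _ "prob q"]) auto
  also have "\<dots> = pmf ?r (x, y') * pmf (Wch x y') y"
    unfolding xyy by (rule pmf_bind_triple)
  finally show "pmf (map_pmf pXYY q) (x, y, y') = pmf ?r (x, y') * pmf (Wch x y') y" .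
  have x: "map_pmf pX q = map_pmf fst ?r"
    by (simp add: pmf.map_comp o_def case_prod_unfold)
  have "map_pmf pUX q = map_pmf (\<lambda>(u, x, y', y). (u, x)) ?m"
    by (simp add: pmf.map_comp o_def case_prod_unfold)
  also have "\<dots> = bind_pmf PU (\<lambda>u. map_pmf (Pair u) (map_pmf fst ?r))"
    unfolding m by (simp add: map_bind_pmf pmf.map_comp o_def case_prod_unfold bind_return_eq_map_pmf)
  finally show "pmf (map_pmf pUX q) (u, x) =
      pmf PU u * pmf (map_pmf pX q) x"
    by (simp add: x pmf_bind_map_Pair)
qed

section \<open>The law of a code and its time-averaged letter\<close>

context
  fixes PU :: "'u::finite pmf" and Wch :: "'x::finite \<Rightarrow> 'y::finite \<Rightarrow> 'y pmf" and y0 :: 'y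
    and f :: "nat \<Rightarrow> 'u list \<Rightarrow> 'x" and g :: "'y list \<Rightarrow> 'v::finite list" and n :: nat
begin

definition step_kernel :: "('u \<times> 'y) list \<Rightarrow> ('u \<times> 'y) pmf" where
  "step_kernel zs = bind_pmf PU (\<lambda>u. map_pmf (Pair u) (Wch (f (Suc (length zs)) (map fst zs)) (last (y0 # map snd zs))))"

definition code_law :: "('u \<times> 'y) list pmf" where
  "code_law = seq_law step_kernel n"

text \<open>Position \<open>t\<close> belongs to time \<open>Suc t\<close>, hence
  \<open>f (Suc t)\<close>. The function s puts its argument in place of the output at this
  position: it is determined by the outputs at the other positions, and at the actual output it
  returns the reconstruction.\<close>

definition letter_at :: "('u \<times> 'y) list \<Rightarrow> nat \<Rightarrow> ('u, 'x, 'y, 'v) letter" where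
  "letter_at zs t = (fst (zs ! t), f (Suc t) (take t (map fst zs)), (\<lambda>y. g ((map snd zs)[t := y]) ! t),
     (y0 # map snd zs) ! t, snd (zs ! t))"

text \<open>The time is drawn uniformly and then forgotten. It does not become part of the auxiliary
  variable, whose range therefore does not grow with \<open>n\<close>.\<close>

definition averaged_letter :: "('u, 'x, 'y, 'v) letter pmf" where
  "averaged_letter = bind_pmf code_law (\<lambda>zs. map_pmf (letter_at zs) (pmf_of_set {..<n}))"

lemma channel_inputs_snoc: "channel_inputs f (us @ [u]) = channel_inputs f us @ [f (Suc (length us)) us]"
  by (auto simp: channel_inputs_def)

lemma seq_law_code:
  "bind_pmf (replicate_pmf k PU) (\<lambda>us. map_pmf (zip us) (channel_outputs Wch (channel_inputs f us) y0)) = seq_law step_kernel k"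
proof (induction k)
  case 0
  then show ?case by (simp add: bind_return_pmf channel_inputs_def)
next
  case (Suc k)
  have rep: "replicate_pmf (Suc k) PU = bind_pmf (replicate_pmf k PU) (\<lambda>us. bind_pmf PU (\<lambda>u. return_pmf (us @ [u])))"
    using replicate_pmf_distrib[of k 1 PU] by (simp add: bind_assoc_pmf bind_return_pmf)
  have "bind_pmf (replicate_pmf (Suc k) PU) (\<lambda>us. map_pmf (zip us) (channel_outputs Wch (channel_inputs f us) y0))
     = bind_pmf (replicate_pmf k PU) (\<lambda>us. bind_pmf PU (\<lambda>u. bind_pmf (channel_outputs Wch (channel_inputs f us) y0) (\<lambda>ys.
         map_pmf (\<lambda>y. zip (us @ [u]) (ys @ [y])) (Wch (f (Suc (length us)) us) (last (y0 # ys))))))"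
    unfolding rep
    by (simp add: bind_assoc_pmf bind_return_pmf channel_inputs_snoc channel_outputs_append map_bind_pmf
        pmf.map_comp o_def bind_map_pmf bind_return_eq_map_pmf)
  also have "\<dots> = bind_pmf (replicate_pmf k PU) (\<lambda>us. bind_pmf (channel_outputs Wch (channel_inputs f us) y0) (\<lambda>ys. bind_pmf PU (\<lambda>u.
         map_pmf (\<lambda>y. zip (us @ [u]) (ys @ [y])) (Wch (f (Suc (length us)) us) (last (y0 # ys))))))"
    by (intro bind_pmf_cong_UNIV) (rule bind_commute_pmf)
  also have "\<dots> = bind_pmf (replicate_pmf k PU) (\<lambda>us. bind_pmf (channel_outputs Wch (channel_inputs f us) y0) (\<lambda>ys.
         map_pmf (\<lambda>a. zip us ys @ [a]) (step_kernel (zip us ys))))"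
  proof (intro bind_pmf_cong refl)
    fix us ys
    assume "us \<in> set_pmf (replicate_pmf k PU)" "ys \<in> set_pmf (channel_outputs Wch (channel_inputs f us) y0)"
    then have len: "length us = length ys"
      by (auto simp: length_replicate_pmf channel_inputs_def dest!: length_channel_outputs)
    have "map_pmf (\<lambda>a. zip us ys @ [a]) (step_kernel (zip us ys)) = bind_pmf PU (\<lambda>u.
       map_pmf (\<lambda>y. zip us ys @ [(u, y)]) (Wch (f (Suc (length us)) us) (last (y0 # ys))))"
      using len by (simp add: step_kernel_def map_bind_pmf pmf.map_comp o_def)
    then show "bind_pmf PU (\<lambda>u. map_pmf (\<lambda>y. zip (us @ [u]) (ys @ [y])) (Wch (f (Suc (length us)) us) (last (y0 # ys))))
      = map_pmf (\<lambda>a. zip us ys @ [a]) (step_kernel (zip us ys))"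
      using len by simp
  qed
  also have "\<dots> = seq_law step_kernel (Suc k)"
    by (simp add: Suc[symmetric] bind_assoc_pmf bind_map_pmf)
  finally show ?case .
qed

lemma expct_induced:
  "expct (induced_pmf PU Wch y0 n (f, g)) F =
    expct code_law (\<lambda>zs. F (map fst zs, channel_inputs f (map fst zs), map snd zs, g (map snd zs)))"
proof -
  have "expct (induced_pmf PU Wch y0 n (f, g)) F = expct (replicate_pmf n PU) (\<lambda>us.
      expct (channel_outputs Wch (channel_inputs f us) y0) (\<lambda>ys. F (us, channel_inputs f us, ys, g ys)))"
    by (simp add: induced_pmf_def expct_bind)
  also have "\<dots> = expct (replicate_pmf n PU) (\<lambda>us. expct (channel_outputs Wch (channel_inputs f us) y0) (\<lambda>ys.
      F (map fst (zip us ys), channel_inputs f (map fst (zip us ys)), map snd (zip us ys), g (map snd (zip us ys)))))"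
  proof (intro expct_cong)
    fix us ys
    assume "us \<in> set_pmf (replicate_pmf n PU)" "ys \<in> set_pmf (channel_outputs Wch (channel_inputs f us) y0)"
    then have "length us = length ys"
      by (auto simp: length_replicate_pmf channel_inputs_def dest!: length_channel_outputs)
    then show "F (us, channel_inputs f us, ys, g ys) = F (map fst (zip us ys), channel_inputs f (map fst (zip us ys)), map snd (zip us ys), g (map snd (zip us ys)))"
      by simp
  qed
  also have "\<dots> = expct code_law (\<lambda>zs. F (map fst zs, channel_inputs f (map fst zs), map snd zs, g (map snd zs)))"
    unfolding code_law_def seq_law_code[symmetric] by (simp add: expct_bind)
  finally show ?thesis .
qed

lemma finite_code_law [simp]: "finite (set_pmf code_law)"
  by (simp add: code_law_def)

lemma expct_averaged_letter:
  assumes "n > 0"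
  shows "expct averaged_letter F = expct code_law (\<lambda>zs. \<Sum>t<n. F (letter_at zs t)) / n"
proof -
  have ne: "{..<n} \<noteq> {}" using assms by (simp add: lessThan_empty_iff)
  have "expct averaged_letter F = expct code_law (\<lambda>zs. expct (pmf_of_set {..<n}) (\<lambda>t. F (letter_at zs t)))"
    unfolding averaged_letter_def using ne by (subst expct_bind) auto
  also have "\<dots> = expct code_law (\<lambda>zs. (\<Sum>t<n. F (letter_at zs t)) / n)"
    using ne by (simp add: integral_pmf_of_set)
  finally show ?thesis by simp
qed

text \<open>At each time the input and the previous state are functions of the past, while the new
  source symbol and the channel step are drawn afterwards. By linearity the average over the times
  inherits the condition.\<close>

lemma causal_averaged_letter:
  assumes "n > 0"
  shows "causal_law PU Wch averaged_letter"
  unfolding causal_law_def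
proof (intro allI)
  fix u x y' y
  have marg: "pmf (map_pmf h averaged_letter) b = (\<Sum>t<n. pmf (map_pmf (\<lambda>zs. h (letter_at zs t)) code_law) b) / n"
    for h :: "('u, 'x, 'y, 'v) letter \<Rightarrow> 'z" and b
  proof -
    have "pmf (map_pmf h averaged_letter) b = expct averaged_letter (\<lambda>a. of_bool (h a = b))"
      by (simp add: pmf_map vimage_def expct_of_bool)
    also have "\<dots> = (\<Sum>t<n. expct code_law (\<lambda>zs. of_bool (h (letter_at zs t) = b))) / n"
      by (simp only: expct_averaged_letter[OF assms] expct_sum finite_code_law)
    finally show ?thesis by (simp add: pmf_map vimage_def expct_of_bool)
  qed
  have "pmf (map_pmf (\<lambda>zs. pUXYY (letter_at zs t)) code_law) (u, x, y', y) =
     pmf PU u * pmf (map_pmf (\<lambda>zs. pXY' (letter_at zs t)) code_law) (x, y') * pmf (Wch x y') y"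
    if t: "t < n" for t
  proof -
    define past where "past zs = (f (Suc t) (map fst zs), last (y0 # map snd zs))" for zs :: "('u \<times> 'y) list"
    have last: "(y0 # map snd zs) ! t = last (y0 # map snd (take t zs))" if "length zs = n" for zs :: "('u \<times> 'y) list"
      using that t by (cases t) (auto simp: last_conv_nth nth_Cons' min_def)
    have "map_pmf (\<lambda>zs. pXY' (letter_at zs t)) code_law = map_pmf (\<lambda>zs. past (take t zs)) code_law"
      using last by (intro map_pmf_cong) (auto simp: letter_at_def past_def take_map code_law_def dest!: length_seq_law)
    also have "\<dots> = map_pmf past (map_pmf (take t) code_law)" by (simp add: pmf.map_comp o_def)
    also have "map_pmf (take t) code_law = seq_law step_kernel t"
      unfolding code_law_def using t by (intro take_seq_law) simp
    finally have R: "map_pmf (\<lambda>zs. pXY' (letter_at zs t)) code_law = map_pmf past (seq_law step_kernel t)" .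
    have "map_pmf (\<lambda>zs. pUXYY (letter_at zs t)) code_law
      = map_pmf (\<lambda>zs. let (x, y') = past (take t zs); (u, y) = zs ! t in (u, x, y', y)) (map_pmf (take (Suc t)) code_law)"
      unfolding pmf.map_comp o_def
      using last t by (intro map_pmf_cong) (auto simp: letter_at_def past_def take_map code_law_def Let_def min_def case_prod_unfold dest!: length_seq_law)
    also have "map_pmf (take (Suc t)) code_law = seq_law step_kernel (Suc t)"
      unfolding code_law_def using t by (intro take_seq_law) simp
    also have "map_pmf (\<lambda>zs. let (x, y') = past (take t zs); (u, y) = zs ! t in (u, x, y', y)) (seq_law step_kernel (Suc t))
      = bind_pmf (seq_law step_kernel t) (\<lambda>zs. map_pmf (\<lambda>a. (fst a, fst (past zs), snd (past zs), snd a)) (step_kernel zs))"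
      unfolding seq_law.simps map_bind_pmf pmf.map_comp o_def
      by (intro bind_pmf_cong map_pmf_cong refl) (auto simp: Let_def case_prod_unfold nth_append dest!: length_seq_law)
    also have "\<dots> = bind_pmf (seq_law step_kernel t) (\<lambda>zs. bind_pmf PU (\<lambda>u. map_pmf (\<lambda>y. (u, fst (past zs), snd (past zs), y))
         (Wch (fst (past zs)) (snd (past zs)))))"
      by (intro bind_pmf_cong refl) (auto simp: step_kernel_def map_bind_pmf pmf.map_comp o_def past_def dest!: length_seq_law)
    also have "\<dots> = bind_pmf PU (\<lambda>u. bind_pmf (map_pmf past (seq_law step_kernel t)) (\<lambda>(x, y'). map_pmf (\<lambda>y. (u, x, y', y)) (Wch x y')))"
      by (subst bind_commute_pmf) (simp add: bind_map_pmf case_prod_unfold)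
    also have "\<dots> = bind_pmf PU (\<lambda>u. map_pmf (Pair u) (bind_pmf (map_pmf past (seq_law step_kernel t)) (\<lambda>(x, y'). map_pmf (\<lambda>y. (x, y', y)) (Wch x y'))))"
      by (simp add: map_bind_pmf pmf.map_comp o_def case_prod_unfold)
    finally have L: "map_pmf (\<lambda>zs. pUXYY (letter_at zs t)) code_law = \<dots>" .
    show ?thesis
      unfolding L R by (simp add: pmf_bind_map_Pair pmf_bind_triple)
  qed
  then show "pmf (map_pmf pUXYY averaged_letter) (u, x, y', y) =
     pmf PU u * pmf (map_pmf pXY' averaged_letter) (x, y') * pmf (Wch x y') y"
    unfolding marg by (simp add: sum_distrib_left sum_distrib_right)
qed

text \<open>The reference law of the Kullback-Leibler divergence first
  draws the outputs from the averaged output kernel and then, given all outputs, draws the source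
  symbols one after the other from the averaged conditional law of \<open>u\<close> given \<open>(s, x)\<close>; this is possible
  because the input at time \<open>t\<close> depends on the past source symbols only.\<close>

lemma gap_averaged_letter_nonneg:
  assumes "n > 0"
  shows "gap averaged_letter \<ge> 0"
proof -
  let ?q = averaged_letter
  define \<kappa> where "\<kappa> = cond_kernel ?q (\<lambda>(u, x, s, y', y). y) pY'"
  define \<rho> where "\<rho> = cond_kernel ?q (\<lambda>(u, x, s, y', y). u) pSX"
  define sf where "sf ys t = (\<lambda>y. g (ys[t := y]) ! t)" for ys t
  define kY where "kY ys = \<kappa> (last (y0 # ys))" for ys
  \<comment> \<open>When the source symbol at position \<open>length us\<close> is drawn, all
    outputs are known, which determines s, and so are the earlier source symbols, which determine x
    through \<open>f\<close>.\<close>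
  define kU where "kU ys us = \<rho> (sf ys (length us), f (Suc (length us)) us)" for ys us
  define R where "R = bind_pmf (seq_law kY n) (\<lambda>ys. map_pmf (\<lambda>us. (ys, us)) (seq_law (kU ys) n))"
  define r where "r = map_pmf (\<lambda>(ys, us). zip us ys) R"
  \<comment> \<open>The contribution of one letter to the logarithm of the ratio between the code
    law and the reference law.\<close>
  define \<phi> where "\<phi> = (\<lambda>(u, x, s, y', y). ln (pmf PU u) + ln (pmf (Wch x y') y) - ln (pmf (\<kappa> y') y) - ln (pmf (\<rho> (s, x)) u))"
  have supp: "letter_at zs t \<in> set_pmf ?q" if "zs \<in> set_pmf code_law" "t < n" for zs t
    using that by (auto simp: averaged_letter_def lessThan_empty_iff)
  have pos: "pmf PU u > 0" "pmf (Wch x y') y > 0" "pmf (\<kappa> y') y > 0" "pmf (\<rho> (s, x)) u > 0"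
    if q: "(u, x, s, y', y) \<in> set_pmf ?q" for u x s y' y
  proof -
    have "pmf (map_pmf pUXYY ?q) (u, x, y', y) > 0"
      using q by (force simp: pmf_positive_iff)
    then have "pmf PU u * pmf (map_pmf pXY' ?q) (x, y') * pmf (Wch x y') y > 0"
      using causal_averaged_letter[OF assms] by (simp add: causal_law_def)
    then show "pmf PU u > 0" "pmf (Wch x y') y > 0" by (auto simp: zero_less_mult_iff)
    show "pmf (\<kappa> y') y > 0" "pmf (\<rho> (s, x)) u > 0"
      unfolding \<kappa>_def \<rho>_def using q
      by (subst pmf_cond_kernel; force simp: pmf_positive_iff intro!: divide_pos_pos)+
  qed
  \<comment> \<open>Both laws factor over the same letters, although they generate the symbols in
    different orders.\<close>
  have prods: "pmf code_law zs = (\<Prod>t<n. case letter_at zs t of (u, x, s, y', y) \<Rightarrow> pmf PU u * pmf (Wch x y') y)"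
    "pmf r zs = (\<Prod>t<n. case letter_at zs t of (u, x, s, y', y) \<Rightarrow> pmf (\<kappa> y') y * pmf (\<rho> (s, x)) u)"
    if len: "length zs = n" for zs
  proof -
    have last: "(y0 # map snd zs) ! t = last (y0 # map snd (take t zs))" if "t < n" for t
      using that len by (cases t) (auto simp: last_conv_nth nth_Cons' min_def)
    show "pmf code_law zs = (\<Prod>t<n. case letter_at zs t of (u, x, s, y', y) \<Rightarrow> pmf PU u * pmf (Wch x y') y)"
      unfolding code_law_def pmf_seq_law[OF len]
    proof (intro prod.cong refl)
      fix t assume "t \<in> {..<n}"
      then have t: "t < n" by simp
      obtain u y where zt: "zs ! t = (u, y)" by (cases "zs ! t")
      show "pmf (step_kernel (take t zs)) (zs ! t) = (case letter_at zs t of (u, x, s, y', y) \<Rightarrow> pmf PU u * pmf (Wch x y') y)"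
        using t len by (simp add: zt step_kernel_def pmf_bind_map_Pair letter_at_def last[OF t] take_map min_def)
    qed
    have "inj_on (\<lambda>(ys, us). zip us ys) (set_pmf R \<union> {(map snd zs, map fst zs)})"
    proof (rule inj_onI, clarify)
      fix a b c d
      assume "(a, b) \<in> set_pmf R \<union> {(map snd zs, map fst zs)}" "(c, d) \<in> set_pmf R \<union> {(map snd zs, map fst zs)}"
        and eq: "zip b a = zip d c"
      then have "length a = n" "length b = n" "length c = n" "length d = n"
        using len by (auto simp: R_def dest!: length_seq_law)
      then show "a = c \<and> b = d" using eq by (metis map_fst_zip map_snd_zip)
    qed
    have "pmf r zs = pmf (map_pmf (\<lambda>(ys, us). zip us ys) R) ((\<lambda>(ys, us). zip us ys) (map snd zs, map fst zs))"
      by (simp add: r_def zip_map_fst_snd)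
    also have "\<dots> = pmf R (map snd zs, map fst zs)"
      by (rule pmf_map_inj_on_insert) fact
    also have "\<dots> = pmf (seq_law kY n) (map snd zs) * pmf (seq_law (kU (map snd zs)) n) (map fst zs)"
      unfolding R_def by (rule pmf_bind_map_Pair)
    also have "\<dots> = (\<Prod>t<n. pmf (kY (take t (map snd zs))) (map snd zs ! t) * pmf (kU (map snd zs) (take t (map fst zs))) (map fst zs ! t))"
      using len by (simp add: pmf_seq_law prod.distrib)
    also have "\<dots> = (\<Prod>t<n. case letter_at zs t of (u, x, s, y', y) \<Rightarrow> pmf (\<kappa> y') y * pmf (\<rho> (s, x)) u)"
      using len last by (intro prod.cong refl) (simp add: kY_def kU_def letter_at_def sf_def take_map min_def)
    finally show "pmf r zs = (\<Prod>t<n. case letter_at zs t of (u, x, s, y', y) \<Rightarrow> pmf (\<kappa> y') y * pmf (\<rho> (s, x)) u)" .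
  qed
  have len: "length zs = n" if "zs \<in> set_pmf code_law" for zs
    using that by (auto simp: code_law_def dest: length_seq_law)
  have rpos: "pmf r zs > 0" if "zs \<in> set_pmf code_law" for zs
    unfolding prods(2)[OF len[OF that]]
  proof (rule prod_pos)
    fix t assume "t \<in> {..<n}"
    then show "0 < (case letter_at zs t of (u, x, s, y', y) \<Rightarrow> pmf (\<kappa> y') y * pmf (\<rho> (s, x)) u)"
      using supp[OF that, of t] pos by (auto split: prod.split)
  qed
  have "0 \<le> expct code_law (\<lambda>zs. ln (pmf code_law zs / pmf r zs))"
    using rpos by (intro gibbs_inequality(1)) (auto simp: pmf_positive_iff)
  also have "\<dots> = expct code_law (\<lambda>zs. \<Sum>t<n. \<phi> (letter_at zs t))"
  proof (rule expct_cong)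
    fix zs assume zs: "zs \<in> set_pmf code_law"
    have "pmf code_law zs > 0" using zs by (simp add: pmf_positive_iff)
    then have "ln (pmf code_law zs / pmf r zs) = ln (pmf code_law zs) - ln (pmf r zs)"
      using rpos[OF zs] by (simp add: ln_div)
    also have "ln (pmf code_law zs) = (\<Sum>t<n. ln (case letter_at zs t of (u, x, s, y', y) \<Rightarrow> pmf PU u * pmf (Wch x y') y))"
      unfolding prods(1)[OF len[OF zs]]
    proof (rule ln_prod)
      fix t assume "t \<in> {..<n}"
      then have "0 < (case letter_at zs t of (u, x, s, y', y) \<Rightarrow> pmf PU u * pmf (Wch x y') y)"
        using supp[OF zs, of t] pos by (auto split: prod.split)
      then show "(case letter_at zs t of (u, x, s, y', y) \<Rightarrow> pmf PU u * pmf (Wch x y') y) \<noteq> 0" by linarith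
    qed simp
    also have "ln (pmf r zs) = (\<Sum>t<n. ln (case letter_at zs t of (u, x, s, y', y) \<Rightarrow> pmf (\<kappa> y') y * pmf (\<rho> (s, x)) u))"
      unfolding prods(2)[OF len[OF zs]]
    proof (rule ln_prod)
      fix t assume "t \<in> {..<n}"
      then have "0 < (case letter_at zs t of (u, x, s, y', y) \<Rightarrow> pmf (\<kappa> y') y * pmf (\<rho> (s, x)) u)"
        using supp[OF zs, of t] pos by (auto split: prod.split)
      then show "(case letter_at zs t of (u, x, s, y', y) \<Rightarrow> pmf (\<kappa> y') y * pmf (\<rho> (s, x)) u) \<noteq> 0" by linarith
    qed simp
    also have "(\<Sum>t<n. ln (case letter_at zs t of (u, x, s, y', y) \<Rightarrow> pmf PU u * pmf (Wch x y') y)) -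
       (\<Sum>t<n. ln (case letter_at zs t of (u, x, s, y', y) \<Rightarrow> pmf (\<kappa> y') y * pmf (\<rho> (s, x)) u)) = (\<Sum>t<n. \<phi> (letter_at zs t))"
      unfolding sum_subtractf[symmetric]
    proof (intro sum.cong refl)
      fix t assume "t \<in> {..<n}"
      then have "letter_at zs t \<in> set_pmf ?q" using supp[OF zs] by simp
      moreover obtain u x s y' y where "letter_at zs t = (u, x, s, y', y)" by (cases "letter_at zs t")
      ultimately show "ln (case letter_at zs t of (u, x, s, y', y) \<Rightarrow> pmf PU u * pmf (Wch x y') y) -
         ln (case letter_at zs t of (u, x, s, y', y) \<Rightarrow> pmf (\<kappa> y') y * pmf (\<rho> (s, x)) u) = \<phi> (letter_at zs t)"
        using pos[of u x s y' y] by (simp add: \<phi>_def ln_mult)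
    qed
    finally show "ln (pmf code_law zs / pmf r zs) = (\<Sum>t<n. \<phi> (letter_at zs t))" .
  qed
  also have "\<dots> = n * expct ?q \<phi>"
    using assms by (simp add: expct_averaged_letter)
  \<comment> \<open>By causality P(u) = p(u,x) / p(x) and W(y|x,y') = p(x,y,y') / p(x,y') under the
    averaged letter, and \<kappa>, \<rho> are its conditional laws. So \<phi> agrees with the
    density of the gap on the support.\<close>
  also have "expct ?q \<phi> = gap ?q"
    unfolding gap_def
  proof (rule expct_cong)
    fix a assume a: "a \<in> set_pmf ?q"
    obtain u x s y' y where eq: "a = (u, x, s, y', y)" by (cases a)
    have mpos: "pmf (map_pmf h ?q) (h a) > 0" for h :: "_ \<Rightarrow> 'z" using a by (auto simp: pmf_positive_iff)
    note m = causal_law_marginals[OF causal_averaged_letter[OF assms]]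
    have k: "pmf (\<kappa> y') y = pmf (map_pmf pYY' ?q) (y, y') / pmf (map_pmf pY' ?q) y'"
      unfolding \<kappa>_def using a by (subst pmf_cond_kernel) (force simp: eq, simp add: case_prod_unfold)
    have rh: "pmf (\<rho> (s, x)) u = pmf (map_pmf pUSX ?q) (u, s, x) / pmf (map_pmf pSX ?q) (s, x)"
      unfolding \<rho>_def using a by (subst pmf_cond_kernel) (force simp: eq, simp add: case_prod_unfold)
    show "\<phi> a = ratio_gap ?q a"
      using mpos[of "\<lambda>(u, x, s, y', y). (y, y')"] mpos[of "\<lambda>(u, x, s, y', y). y'"]
        mpos[of "\<lambda>(u, x, s, y', y). (u, s, x)"] mpos[of "\<lambda>(u, x, s, y', y). (s, x)"]
        mpos[of "\<lambda>(u, x, s, y', y). (x, y')"] mpos[of "\<lambda>(u, x, s, y', y). x"] pos[OF a[unfolded eq]]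
      unfolding eq \<phi>_def ratio_gap_def prod.case k rh m
      by (simp add: ln_div ln_mult)
  qed
  finally show ?thesis using assms by (simp add: zero_le_mult_iff)
qed

end

text \<open>The law of the observed averaged letter is the expected empirical distribution, so its
  distance to \<open>P\<close> is at most the expected distance. The latter is below \<epsilon>
  except with probability \<epsilon>, when it is still at most 2, which gives 3 \<epsilon>.\<close>

lemma averaged_letter_close:
  fixes PU :: "'u::finite pmf" and Wch :: "'x::finite \<Rightarrow> 'y::finite \<Rightarrow> 'y pmf" and y0 :: 'y
    and f :: "nat \<Rightarrow> 'u list \<Rightarrow> 'x" and g :: "'y list \<Rightarrow> 'v::finite list"
    and P :: "('u \<times> 'x \<times> 'y \<times> 'y \<times> 'v) pmf"
  assumes n: "n > 0" and c: "(f, g) \<in> codes n" and "\<epsilon> > 0"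
    and prob: "prob (induced_pmf PU Wch y0 n (f, g)) {s. l1_dist (empirical y0 n s) (pmf P) \<ge> \<epsilon>} \<le> \<epsilon>"
  shows "(\<Sum>a\<in>UNIV. \<bar>pmf (map_pmf observe (averaged_letter PU Wch y0 f g n)) a - pmf P a\<bar>) \<le> 3 * \<epsilon>"
proof -
  define L where "L = code_law PU Wch y0 f n"
  define emp where "emp zs = empirical y0 n (map fst zs, channel_inputs f (map fst zs), map snd zs, g (map snd zs))"
    for zs :: "('u \<times> 'y) list"
  have fin: "finite (set_pmf L)" by (simp add: L_def)
  have len: "length zs = n" if "zs \<in> set_pmf L" for zs
    using that by (auto simp: L_def code_law_def dest: length_seq_law)
  have pmf_obs: "pmf (map_pmf observe (averaged_letter PU Wch y0 f g n)) a = expct L (\<lambda>zs. emp zs a)" for a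
  proof -
    have "pmf (map_pmf observe (averaged_letter PU Wch y0 f g n)) a
        = expct (averaged_letter PU Wch y0 f g n) (\<lambda>b. of_bool (observe b = a))"
      by (simp add: pmf_map vimage_def expct_of_bool)
    also have "\<dots> = expct L (\<lambda>zs. (\<Sum>t<n. of_bool (observe (letter_at y0 f g zs t) = a)) / n)"
      unfolding expct_averaged_letter[OF n] L_def by simp
    also have "\<dots> = expct L (\<lambda>zs. emp zs a)"
    proof (rule expct_cong)
      fix zs assume "zs \<in> set_pmf L"
      then have l: "length zs = n" by (rule len)
      obtain u x y' y v where a: "a = (u, x, y', y, v)" by (cases a)
      have obs: "observe (letter_at y0 f g zs t) = (map fst zs ! t, channel_inputs f (map fst zs) ! t,
          (y0 # map snd zs) ! t, map snd zs ! t, g (map snd zs) ! t)" if "t < n" for t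
      proof -
        have "(map snd zs)[t := snd (zs ! t)] = map snd zs"
          using that l by (metis list_update_id nth_map)
        then show ?thesis
          using that l by (simp add: channel_inputs_def observe_def letter_at_def del: upt_Suc)
      qed
      have "(\<Sum>t<n. of_bool (observe (letter_at y0 f g zs t) = a) :: real) =
        (\<Sum>t<n. of_bool (map fst zs ! t = u \<and> channel_inputs f (map fst zs) ! t = x \<and>
          (y0 # map snd zs) ! t = y' \<and> map snd zs ! t = y \<and> g (map snd zs) ! t = v))"
        by (intro sum.cong refl) (simp only: obs a lessThan_iff prod.inject)
      then show "(\<Sum>t<n. of_bool (observe (letter_at y0 f g zs t) = a)) / n = emp zs a"
        by (simp add: emp_def empirical_def a)
    qed
    finally show ?thesis .
  qed
  have "(\<Sum>a\<in>UNIV. \<bar>pmf (map_pmf observe (averaged_letter PU Wch y0 f g n)) a - pmf P a\<bar>)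
      \<le> (\<Sum>a\<in>UNIV. expct L (\<lambda>zs. \<bar>emp zs a - pmf P a\<bar>))"
  proof (rule sum_mono)
    fix a
    have "pmf (map_pmf observe (averaged_letter PU Wch y0 f g n)) a - pmf P a = expct L (\<lambda>zs. emp zs a - pmf P a)"
      using fin by (simp add: pmf_obs integrable_measure_pmf_finite)
    then show "\<bar>pmf (map_pmf observe (averaged_letter PU Wch y0 f g n)) a - pmf P a\<bar> \<le> expct L (\<lambda>zs. \<bar>emp zs a - pmf P a\<bar>)"
      by (simp add: integral_abs_bound)
  qed
  also have "\<dots> = expct L (\<lambda>zs. l1_dist (emp zs) (pmf P))"
    by (simp only: l1_dist_def expct_sum[OF fin])
  also have "\<dots> \<le> expct L (\<lambda>zs. \<epsilon> + 2 * of_bool (l1_dist (emp zs) (pmf P) \<ge> \<epsilon>))"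
  proof (rule expct_mono[OF fin])
    fix zs assume zs: "zs \<in> set_pmf L"
    have "length (g (map snd zs)) = n" using c len[OF zs] by (auto simp: codes_def)
    then have "l1_dist (emp zs) (pmf P) = discrepancy (pmf P) (observed (map fst zs) (channel_inputs f (map fst zs)) y0 (map snd zs) (g (map snd zs))) / n"
      unfolding emp_def using n len[OF zs] by (intro l1_dist_empirical) (auto simp: channel_inputs_def simp del: upt_Suc)
    also have "\<dots> \<le> (2 * n) / n"
      using len[OF zs] by (intro divide_right_mono order_trans[OF discrepancy_le]) auto
    also have "\<dots> = 2" using n by simp
    finally show "l1_dist (emp zs) (pmf P) \<le> \<epsilon> + 2 * of_bool (l1_dist (emp zs) (pmf P) \<ge> \<epsilon>)"
      using \<open>\<epsilon> > 0\<close> by auto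
  qed
  also have "\<dots> = \<epsilon> + 2 * expct (induced_pmf PU Wch y0 n (f, g)) (\<lambda>s. of_bool (l1_dist (empirical y0 n s) (pmf P) \<ge> \<epsilon>))"
    unfolding expct_induced using fin by (simp add: expct_add L_def emp_def)
  also have "\<dots> \<le> \<epsilon> + 2 * \<epsilon>" using prob by (simp add: expct_of_bool)
  finally show ?thesis by simp
qed

section \<open>Limits of single-letter laws\<close>

text \<open>Away from 0 this is continuity; at 0 it rests on |t ln t| \<le> 2 sqrt t for t between 0
  and 1.\<close>

lemma tendsto_mult_ln:
  fixes a :: "nat \<Rightarrow> real"
  assumes lim: "a \<longlonglongrightarrow> l" and nonneg: "\<And>k. a k \<ge> 0"
  shows "(\<lambda>k. a k * ln (a k)) \<longlonglongrightarrow> l * ln l"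
proof (cases "l = 0")
  case False
  then show ?thesis by (intro tendsto_intros lim)
next
  case True
  have bound: "\<bar>t * ln t\<bar> \<le> 2 * sqrt t" if "0 \<le> t" "t \<le> 1" for t :: real
  proof (cases "t = 0")
    case False
    then have t: "t > 0" using that by simp
    have "- ln t = 2 * ln (1 / sqrt t)" using t by (simp add: ln_div ln_sqrt)
    also have "\<dots> \<le> 2 * (1 / sqrt t)" using ln_le_minus_one[of "1 / sqrt t"] t by simp
    finally have "t * (- ln t) \<le> t * (2 * (1 / sqrt t))" using t by (intro mult_left_mono) auto
    also have "\<dots> = 2 * sqrt t" using t by (simp add: field_simps)
    finally have "t * (- ln t) \<le> 2 * sqrt t" .
    moreover have "ln t \<le> 0" using t that by simp
    then have "\<bar>t * ln t\<bar> = t * (- ln t)" using t by (simp add: abs_mult)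
    ultimately show ?thesis by simp
  qed simp
  have "eventually (\<lambda>k. a k < 1) sequentially"
    using lim True by (intro order_tendstoD) auto
  then have "eventually (\<lambda>k. norm (a k * ln (a k)) \<le> 2 * sqrt (a k)) sequentially"
    by eventually_elim (use bound nonneg in auto)
  moreover have "(\<lambda>k. 2 * sqrt (a k)) \<longlonglongrightarrow> 2 * sqrt 0"
    using lim True by (intro tendsto_intros) auto
  then have "(\<lambda>k. 2 * sqrt (a k)) \<longlonglongrightarrow> 0" by simp
  ultimately have "(\<lambda>k. a k * ln (a k)) \<longlonglongrightarrow> 0"
    by (rule Lim_null_comparison)
  then show ?thesis using True by simp
qed

lemma tendsto_pmf_map:
  fixes q :: "nat \<Rightarrow> 'a::finite pmf"
  assumes "\<And>a. (\<lambda>k. pmf (q k) a) \<longlonglongrightarrow> pmf q' a"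
  shows "(\<lambda>k. pmf (map_pmf h (q k)) b) \<longlonglongrightarrow> pmf (map_pmf h q') b"
  unfolding pmf_map_eq_sum by (intro tendsto_intros assms)

text \<open>Minus the Shannon entropy of \<open>h\<close> under \<open>q\<close>, in nats.\<close>

definition log_mean :: "'a::finite pmf \<Rightarrow> ('a \<Rightarrow> 'b::finite) \<Rightarrow> real" where
  "log_mean q h = expct q (\<lambda>a. ln (pmf (map_pmf h q) (h a)))"

lemma tendsto_log_mean:
  fixes q :: "nat \<Rightarrow> 'a::finite pmf" and h :: "'a \<Rightarrow> 'b::finite"
  assumes "\<And>a. (\<lambda>k. pmf (q k) a) \<longlonglongrightarrow> pmf q' a"
  shows "(\<lambda>k. log_mean (q k) h) \<longlonglongrightarrow> log_mean q' h"
proof -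
  have "log_mean p h = (\<Sum>b\<in>UNIV. pmf (map_pmf h p) b * ln (pmf (map_pmf h p) b))" for p
    using expct_finite_type[of "map_pmf h p" "\<lambda>b. ln (pmf (map_pmf h p) b)"] by (simp add: log_mean_def)
  then show ?thesis
    by (simp only:) (intro tendsto_sum tendsto_mult_ln tendsto_pmf_map assms pmf_nonneg)
qed

lemma gap_eq:
  fixes q :: "('u::finite, 'x::finite, 'y::finite, 'v::finite) letter pmf"
  shows "gap q = log_mean q pXYY + log_mean q pY'
    - log_mean q pXY' - log_mean q pYY'
    - log_mean q pUSX - log_mean q pX
    + log_mean q pUX + log_mean q pSX"
  by (simp add: gap_def ratio_gap_def log_mean_def case_prod_unfold integrable_measure_pmf_finite)

lemma tendsto_gap:
  fixes q :: "nat \<Rightarrow> ('u::finite, 'x::finite, 'y::finite, 'v::finite) letter pmf"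
  assumes "\<And>a. (\<lambda>k. pmf (q k) a) \<longlonglongrightarrow> pmf q' a"
  shows "(\<lambda>k. gap (q k)) \<longlonglongrightarrow> gap q'"
  unfolding gap_eq by (intro tendsto_add tendsto_diff tendsto_log_mean assms)

text \<open>Probability vectors lie in a compact cube, and total mass 1 passes to the limit because
  the type is finite.\<close>

lemma pmf_convergent_subsequence:
  fixes q :: "nat \<Rightarrow> 'a::finite pmf"
  obtains r q' where "strict_mono r" "\<And>a. (\<lambda>k. pmf (q (r k)) a) \<longlonglongrightarrow> pmf q' a"
proof -
  define v :: "nat \<Rightarrow> real^'a" where "v k = (\<chi> a. pmf (q k) a)" for k
  have "seq_compact (cbox (0 :: real^'a) (\<chi> a. 1))"
    using compact_cbox compact_imp_seq_compact by blast
  moreover have "v k \<in> cbox 0 (\<chi> a. 1)" for k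
    by (auto simp: v_def mem_box_cart pmf_le_1)
  ultimately obtain l r where l: "strict_mono r" "(v \<circ> r) \<longlonglongrightarrow> l"
    unfolding seq_compact_def by metis
  have lim: "(\<lambda>k. pmf (q (r k)) a) \<longlonglongrightarrow> l $ a" for a
    using tendsto_vec_nth[OF l(2), of a] by (simp add: v_def o_def)
  have nonneg: "l $ a \<ge> 0" for a
    by (rule LIMSEQ_le_const[OF lim]) auto
  have "(\<lambda>k. \<Sum>a\<in>UNIV. pmf (q (r k)) a) \<longlonglongrightarrow> (\<Sum>a\<in>UNIV. l $ a)"
    by (intro tendsto_intros lim)
  then have sum1: "(\<Sum>a\<in>UNIV. l $ a) = 1"
    by (simp add: sum_pmf_eq_1 LIMSEQ_const_iff)
  have "(\<integral>\<^sup>+a. ennreal (l $ a) \<partial>count_space UNIV) = 1"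
    using sum_ennreal[of UNIV "\<lambda>a. l $ a"] nonneg sum1 by (simp add: nn_integral_count_space_finite)
  then have "pmf (embed_pmf (\<lambda>a. l $ a)) a = l $ a" for a
    using nonneg by (intro pmf_embed_pmf) auto
  then show ?thesis using l(1) lim by (intro that[of r "embed_pmf (\<lambda>a. l $ a)"]) auto
qed

text \<open>The k-th law comes from a code with tolerance 1 / (k + 1). All these laws live on one
  finite type of letters, so a subsequence converges, and the causal law, the sign of the gap and
  the distance to \<open>P\<close> pass to the limit.\<close>

lemma achievable_limit_letter:
  fixes PU :: "'u::finite pmf" and Wch :: "'x::finite \<Rightarrow> 'y::finite \<Rightarrow> 'y pmf"
    and P :: "('u \<times> 'x \<times> 'y \<times> 'y \<times> 'v::finite) pmf"
  assumes "achievable PU Wch y0 P"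
  obtains q :: "('u, 'x, 'y, 'v) letter pmf"
  where "causal_law PU Wch q" "gap q \<ge> 0" "map_pmf observe q = P"
proof -
  define good where "good k q \<longleftrightarrow> causal_law PU Wch q \<and> gap q \<ge> 0 \<and>
      (\<Sum>a\<in>UNIV. \<bar>pmf (map_pmf observe q) a - pmf P a\<bar>) \<le> 3 * inverse (real (Suc k))"
    for k and q :: "('u, 'x, 'y, 'v) letter pmf"
  have "\<exists>q. good k q" for k
  proof -
    let ?\<epsilon> = "inverse (real (Suc k))"
    have "?\<epsilon> > 0" by simp
    then obtain N0 where N0: "\<And>n. n \<ge> N0 \<Longrightarrow> \<exists>c\<in>codes n. prob (induced_pmf PU Wch y0 n c)
          {s. l1_dist (empirical y0 n s) (pmf P) \<ge> ?\<epsilon>} \<le> ?\<epsilon>"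
      using assms unfolding achievable_def by blast
    define n where "n = Suc N0"
    obtain f g where c: "(f, g) \<in> codes n" "prob (induced_pmf PU Wch y0 n (f, g))
          {s. l1_dist (empirical y0 n s) (pmf P) \<ge> ?\<epsilon>} \<le> ?\<epsilon>"
      using N0[of n] by (auto simp: n_def)
    have "n > 0" by (simp add: n_def)
    show ?thesis
      unfolding good_def
    proof (intro exI conjI)
      show "causal_law PU Wch (averaged_letter PU Wch y0 f g n)"
        by (rule causal_averaged_letter[OF \<open>n > 0\<close>])
      show "gap (averaged_letter PU Wch y0 f g n) \<ge> 0"
        by (rule gap_averaged_letter_nonneg[OF \<open>n > 0\<close>])
      show "(\<Sum>a\<in>UNIV. \<bar>pmf (map_pmf observe (averaged_letter PU Wch y0 f g n)) a - pmf P a\<bar>) \<le> 3 * ?\<epsilon>"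
        by (rule averaged_letter_close[OF \<open>n > 0\<close> c(1) \<open>?\<epsilon> > 0\<close> c(2)])
    qed
  qed
  then obtain q where "\<And>k. good k (q k)" by metis
  then have q: "\<And>k. causal_law PU Wch (q k)" "\<And>k. gap (q k) \<ge> 0"
    "\<And>k. (\<Sum>a\<in>UNIV. \<bar>pmf (map_pmf observe (q k)) a - pmf P a\<bar>) \<le> 3 * inverse (real (Suc k))"
    by (simp_all only: good_def)
  obtain r q' where r: "strict_mono r" and lim: "\<And>a. (\<lambda>k. pmf (q (r k)) a) \<longlonglongrightarrow> pmf q' a"
    using pmf_convergent_subsequence[of q] by blast
  show ?thesis
  proof (rule that[of q'])
    show "causal_law PU Wch q'"
      unfolding causal_law_def
    proof (intro allI)
      fix u x y' y
      have 1: "(\<lambda>k. pmf (map_pmf pUXYY (q (r k))) (u, x, y', y))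
          \<longlonglongrightarrow> pmf (map_pmf pUXYY q') (u, x, y', y)"
        by (rule tendsto_pmf_map[OF lim])
      have 2: "(\<lambda>k. pmf PU u * pmf (map_pmf pXY' (q (r k))) (x, y') * pmf (Wch x y') y)
          \<longlonglongrightarrow> pmf PU u * pmf (map_pmf pXY' q') (x, y') * pmf (Wch x y') y"
        by (intro tendsto_intros tendsto_pmf_map lim)
      show "pmf (map_pmf pUXYY q') (u, x, y', y)
        = pmf PU u * pmf (map_pmf pXY' q') (x, y') * pmf (Wch x y') y"
        using LIMSEQ_unique[OF 1] 2 q(1) by (simp add: causal_law_def)
    qed
    show "gap q' \<ge> 0"
      using q(2) by (intro LIMSEQ_le_const[OF tendsto_gap[OF lim]]) auto
    show "map_pmf observe q' = P"
    proof (rule pmf_eqI)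
      fix a
      have "(\<lambda>k. 3 * inverse (real (Suc (r k)))) \<longlonglongrightarrow> 3 * 0"
        using LIMSEQ_subseq_LIMSEQ[OF LIMSEQ_inverse_real_of_nat r]
        by (intro tendsto_mult tendsto_const) (simp add: o_def)
      then have zero: "(\<lambda>k. 3 * inverse (real (Suc (r k)))) \<longlonglongrightarrow> 0" by simp
      have bound: "norm (pmf (map_pmf observe (q (r k))) a - pmf P a) \<le> 3 * inverse (real (Suc (r k)))" for k
        using order_trans[OF member_le_sum[of a UNIV "\<lambda>a. \<bar>pmf (map_pmf observe (q (r k))) a - pmf P a\<bar>"] q(3)[of "r k"]]
        by simp
      have "(\<lambda>k. pmf (map_pmf observe (q (r k))) a - pmf P a) \<longlonglongrightarrow> 0"
        by (rule Lim_null_comparison[OF _ zero]) (intro always_eventually allI bound)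
      then have "(\<lambda>k. pmf (map_pmf observe (q (r k))) a) \<longlonglongrightarrow> pmf P a"
        by (rule LIM_zero_cancel)
      with tendsto_pmf_map[OF lim] show "pmf (map_pmf observe q') a = pmf P a"
        by (rule LIMSEQ_unique)
    qed
  qed
qed

text \<open>The auxiliary variable is s, numbered by \<open>to_nat\<close>. V is then a
  deterministic function of W and Y, and the law of W may depend on all of (u, x, y, y'), as the
  outer factorization permits.\<close>

lemma letter_joint:
  fixes PU :: "'u::finite pmf" and Wch :: "'x::finite \<Rightarrow> 'y::finite \<Rightarrow> 'y pmf"
    and q :: "('u, 'x, 'y, 'v::finite) letter pmf"
  assumes causal: "causal_law PU Wch q"
  defines "enc \<equiv> (to_nat :: ('y \<Rightarrow> 'v) \<Rightarrow> nat)"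
  defines "Q \<equiv> map_pmf (\<lambda>(u, x, s, y', y). (u, x, enc s, y', y, s y)) q"
  shows "outer_factorization PU Wch (range enc) Q"
    and "marginal_UXYYV Q = map_pmf observe q"
    and "info_gap Q = gap q / ln 2"
proof -
  have inj: "inj enc" by (simp add: enc_def)
  show "marginal_UXYYV Q = map_pmf observe q"
    by (simp add: marginal_UXYYV_def Q_def pmf.map_comp o_def observe_def case_prod_unfold)
  have fin: "finite (set_pmf Q)" by (simp add: Q_def)
  have m1: "pmf (map_pmf (\<lambda>(u, x, s, y', y). (u, enc s, x)) q) (u, enc s, x) =
      pmf (map_pmf pUSX q) (u, s, x)" for u s x
    unfolding pmf_map using inj by (intro arg_cong[of _ _ "prob q"]) (auto dest: injD)
  have m2: "pmf (map_pmf (\<lambda>(u, x, s, y', y). (enc s, x)) q) (enc s, x) =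
      pmf (map_pmf pSX q) (s, x)" for s x
    unfolding pmf_map using inj by (intro arg_cong[of _ _ "prob q"]) (auto dest: injD)
  show "info_gap Q = gap q / ln 2"
  proof -
    have pos: "pmf (map_pmf h q) (h a) > 0" if "a \<in> set_pmf q" for h :: "_ \<Rightarrow> 'z" and a
      using that by (auto simp: pmf_positive_iff)
    let ?XY = "\<lambda>(u, x, s, y', y).
        ln (pmf (map_pmf pXYY q) (x, y, y') * pmf (map_pmf pY' q) y' /
          (pmf (map_pmf pXY' q) (x, y') * pmf (map_pmf pYY' q) (y, y')))"
    let ?US = "\<lambda>(u, x, s, y', y).
        ln (pmf (map_pmf pUSX q) (u, s, x) * pmf (map_pmf pX q) x /
          (pmf (map_pmf pUX q) (u, x) * pmf (map_pmf pSX q) (s, x)))"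
    have "cond_mutual_info Q jX jY jY'
        = expct q ?XY / ln 2"
      unfolding cond_mutual_info_eq[OF fin] unfolding Q_def
      by (simp add: pmf.map_comp o_def case_prod_unfold)
    moreover have "cond_mutual_info Q jU jW jX
        = expct q ?US / ln 2"
      unfolding cond_mutual_info_eq[OF fin] unfolding Q_def
      by (simp add: pmf.map_comp o_def case_prod_unfold m1[unfolded case_prod_unfold] m2[unfolded case_prod_unfold])
    ultimately have "info_gap Q = (expct q ?XY - expct q ?US) / ln 2"
      by (simp only: info_gap_def diff_divide_distrib)
    also have "expct q ?XY - expct q ?US = expct q (\<lambda>a. ?XY a - ?US a)"
      by (rule Bochner_Integration.integral_diff[symmetric]) (auto intro: integrable_measure_pmf_finite)
    also have "expct q (\<lambda>a. ?XY a - ?US a) = gap q"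
      unfolding gap_def
    proof (rule expct_cong)
      fix a assume a: "a \<in> set_pmf q"
      obtain u x s y' y where eq: "a = (u, x, s, y', y)" by (cases a)
      show "?XY a - ?US a = ratio_gap q a"
        using pos[OF a, of "\<lambda>(u, x, s, y', y). (x, y, y')"] pos[OF a, of "\<lambda>(u, x, s, y', y). y'"]
          pos[OF a, of "\<lambda>(u, x, s, y', y). (x, y')"] pos[OF a, of "\<lambda>(u, x, s, y', y). (y, y')"]
          pos[OF a, of "\<lambda>(u, x, s, y', y). (u, s, x)"] pos[OF a, of "\<lambda>(u, x, s, y', y). x"]
          pos[OF a, of "\<lambda>(u, x, s, y', y). (u, x)"] pos[OF a, of "\<lambda>(u, x, s, y', y). (s, x)"]
        unfolding eq ratio_gap_def prod.case by (simp add: ln_div ln_mult)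
    qed
    finally show ?thesis .
  qed
  define PX where "PX = map_pmf pX q"
  define PY' where "PY' = cond_kernel q pY' pX"
  define PW where "PW u x y y' = map_pmf enc (cond_kernel q (\<lambda>(u, x, s, y', y). s) pUXYY (u, x, y', y))"
    for u x y y'
  define PV :: "'y \<Rightarrow> 'x \<Rightarrow> nat \<Rightarrow> 'v pmf" where "PV y x w = return_pmf (inv enc w y)" for y x w
  have XY': "pmf PX x * pmf (PY' x) y' = pmf (map_pmf pXY' q) (x, y')" for x y'
  proof (cases "x \<in> pX ` set_pmf q")
    case True
    then have "pmf PX x \<noteq> 0" by (simp add: PX_def set_pmf_iff[symmetric])
    moreover have "pmf (map_pmf (\<lambda>(u, x, s, y', y). (y', x)) q) (y', x) = pmf (map_pmf pXY' q) (x, y')"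
      unfolding pmf_map by (rule arg_cong[of _ _ "prob q"]) auto
    ultimately show ?thesis
      using pmf_cond_kernel[OF True, of "\<lambda>(u, x, s, y', y). y'" y'] by (simp add: PY'_def PX_def case_prod_unfold)
  next
    case False
    then have "pmf PX x = 0" by (simp add: PX_def pmf_eq_0_set_pmf)
    moreover have "pmf (map_pmf pXY' q) (x, y') = 0"
      using False by (force simp: pmf_eq_0_set_pmf)
    ultimately show ?thesis by simp
  qed
  have main: "pmf Q (u, x, w, y', y, v) =
      pmf PU u * pmf PX x * pmf (PY' x) y' * pmf (Wch x y') y * pmf (PW u x y y') w * pmf (PV y x w) v" for u x w y' y v
  proof -
    let ?m = "pmf (map_pmf pUXYY q) (u, x, y', y)"
    have m: "pmf PU u * pmf PX x * pmf (PY' x) y' * pmf (Wch x y') y = ?m"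
      using causal XY'[of x y'] by (simp add: causal_law_def mult.assoc)
    show ?thesis
    \<comment> \<open>All mass of \<open>Q\<close> lies where w = \<open>enc s\<close> and v =
      \<open>s y\<close> for some s; elsewhere one of the last two factors vanishes.\<close>
    proof (cases "\<exists>s. w = enc s \<and> v = s y")
      case True
      then obtain s where s: "w = enc s" "v = s y" by blast
      have Q: "pmf Q (u, x, w, y', y, v) = pmf q (u, x, s, y', y)"
      proof -
        have "(\<lambda>(u, x, s, y', y). (u, x, enc s, y', y, s y)) -` {(u, x, w, y', y, v)} = {(u, x, s, y', y)}"
          using inj by (auto simp: s dest: injD)
        then show ?thesis by (simp add: Q_def pmf_map measure_pmf_single)
      qed
      have PVs: "pmf (PV y x w) v = 1" by (simp add: PV_def s inv_f_f[OF inj])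
      have PWs: "pmf (PW u x y y') w = pmf (cond_kernel q (\<lambda>(u, x, s, y', y). s) pUXYY (u, x, y', y)) s"
        using inj by (simp add: PW_def s pmf_map_inj')
      show ?thesis
      proof (cases "(u, x, y', y) \<in> pUXYY ` set_pmf q")
        case in_supp: True
        then have "?m \<noteq> 0" by (simp add: set_pmf_iff[symmetric])
        moreover have "pmf (map_pmf (\<lambda>\<omega>. ((\<lambda>(u, x, s, y', y). s) \<omega>, pUXYY \<omega>)) q) (s, u, x, y', y)
            = pmf q (u, x, s, y', y)"
        proof -
          have "(\<lambda>\<omega>. ((\<lambda>(u, x, s, y', y). s) \<omega>, pUXYY \<omega>)) -` {(s, u, x, y', y)} = {(u, x, s, y', y)}"
            by auto
          then show ?thesis by (simp only: pmf_map measure_pmf_single)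
        qed
        ultimately show ?thesis
          unfolding m Q PVs PWs pmf_cond_kernel[OF in_supp] by simp
      next
        case False
        then have "?m = 0" by (simp add: pmf_eq_0_set_pmf)
        moreover have "pmf q (u, x, s, y', y) = 0" using False by (force simp: pmf_eq_0_set_pmf)
        ultimately show ?thesis unfolding m Q by simp
      qed
    next
      case False
      then have "pmf Q (u, x, w, y', y, v) = 0"
        by (auto simp: Q_def pmf_eq_0_set_pmf)
      moreover have "pmf (PW u x y y') w * pmf (PV y x w) v = 0"
      proof (cases "w \<in> range enc")
        case True
        then obtain s where s: "w = enc s" by blast
        then have "inv enc w = s" using inj by simp
        then have "pmf (PV y x w) v = 0" using False s by (auto simp: PV_def)
        then show ?thesis by simp
      next
        case False
        then have "pmf (PW u x y y') w = 0" by (auto simp: PW_def pmf_eq_0_set_pmf)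
        then show ?thesis by simp
      qed
      ultimately show ?thesis by (simp add: mult.assoc)
    qed
  qed
  show "outer_factorization PU Wch (range enc) Q"
    unfolding outer_factorization_def
    by (intro exI[of _ PX] exI[of _ PY'] exI[of _ PW] exI[of _ PV] conjI allI main) (auto simp: PW_def)
qed

theorem outer_bound:
  fixes PU :: "'u::finite pmf" and Wch :: "'x::finite \<Rightarrow> 'y::finite \<Rightarrow> 'y pmf"
    and P :: "('u \<times> 'x \<times> 'y \<times> 'y \<times> 'v::finite) pmf"
  assumes "achievable PU Wch y0 P"
  shows "\<exists>A Q. finite A \<and> outer_factorization PU Wch A Q \<and> marginal_UXYYV Q = P \<and> info_gap Q \<ge> 0"
proof -
  obtain q :: "('u, 'x, 'y, 'v) letter pmf"
    where q: "causal_law PU Wch q" "gap q \<ge> 0" "map_pmf observe q = P"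
    by (rule achievable_limit_letter[OF assms])
  have "gap q / ln 2 \<ge> 0" using q(2) by simp
  then show ?thesis
    using letter_joint[OF q(1)] q(3)
    by (intro exI[of _ "range (to_nat :: ('y \<Rightarrow> 'v) \<Rightarrow> nat)"]
        exI[of _ "map_pmf (\<lambda>(u, x, s, y', y). (u, x, to_nat s, y', y, s y)) q"]) simp
qed

theorem theorem1:
  fixes PU :: "'u::finite pmf"
    and Wch :: "'x::finite \<Rightarrow> 'y::finite \<Rightarrow> 'y pmf"
    and y0 :: 'y
    and P :: "('u \<times> 'x \<times> 'y \<times> 'y \<times> 'v::finite) pmf"
  assumes "ergodic_channel Wch"
  shows "((\<exists>A Q. finite A \<and> inner_factorization PU Wch A Q \<and> marginal_UXYYV Q = P \<and> info_gap Q \<ge> 0)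
           \<longrightarrow> achievable PU Wch y0 P) \<and>
         (achievable PU Wch y0 P \<longrightarrow>
           (\<exists>A Q. finite A \<and> outer_factorization PU Wch A Q \<and> marginal_UXYYV Q = P \<and> info_gap Q \<ge> 0))"
proof (intro conjI impI)
  assume "\<exists>A Q. finite A \<and> inner_factorization PU Wch A Q \<and> marginal_UXYYV Q = P \<and> info_gap Q \<ge> 0"
  then obtain A Q where "finite A" "inner_factorization PU Wch A Q" "info_gap Q \<ge> 0" and P: "marginal_UXYYV Q = P"
    by blast
  from inner_bound[OF assms this(1-3)] show "achievable PU Wch y0 P" by (simp add: P)
qed (rule outer_bound)

end
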